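(* Let $k>2$ and $n\ge 1$ be integers. Among the $n$-homogeneous C*-algebras over the sphere $S^k$, only the trivial one has a Cartan subalgebra; that is, if an $n$-homogeneous C*-algebra $A$ over $S^k$ has a Cartan subalgebra, then $A\cong C(S^k,M_n)$. Moreover, up to equivalence, $C(S^k,M_n)$ has a unique Cartan subalgebra, given by $C(S^k,D_n)$.
   Context: $M_n=M_n(\mathbb C)$, and $D_n\subseteq M_n$ is the subalgebra of diagonal matrices. An $n$-homogeneous C*-algebra over a compact Hausdorff space $T$ is the C*-algebra of continuous sections of a (necessarily locally trivial) C*-bundle over $T$ with fibre $M_n$. A Cartan subalgebra of a C*-algebra $A$ is an abelian sub-C*-algebra $B \subseteq A$ such that (1) $B$ contains an approximate unit of $A$; (2) $B$ is maximal abelian in $A$; (3) $B$ is regular, i.e. $N_A(B)=\{n\in A : nBn^*\subseteq B \text{ and } n^*Bn\subseteq B\}$ generates $A$ as a C*-algebra; (4) there exists a faithful conditional expectation of $A$ onto $B$. Two Cartan subalgebras $B_1,B_2$ of $A$ are equivalent if there is an automorphism $\varphi$ of $A$ with $\varphi(B_1)=B_2$. *)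

theory Defs
  imports "HOL-Analysis.Analysis"
begin

section \<open>C*-algebras\<close>

text \<open>Complex *-algebras with a norm, not assumed to have a unit.\<close>

record 'a cstar =
  cs_carrier :: "'a set"
  cs_zero :: 'a
  cs_add :: "'a \<Rightarrow> 'a \<Rightarrow> 'a"
  cs_scale :: "complex \<Rightarrow> 'a \<Rightarrow> 'a"
  cs_mult :: "'a \<Rightarrow> 'a \<Rightarrow> 'a"
  cs_star :: "'a \<Rightarrow> 'a"
  cs_norm :: "'a \<Rightarrow> real"

definition cs_diff :: "'a cstar \<Rightarrow> 'a \<Rightarrow> 'a \<Rightarrow> 'a" where
  "cs_diff A x y = cs_add A x (cs_scale A (-1) y)"

locale cstar_algebra =
  fixes A :: "'a cstar"
  assumes zero_closed: "cs_zero A \<in> cs_carrier A"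
    and add_closed: "\<lbrakk>x \<in> cs_carrier A; y \<in> cs_carrier A\<rbrakk> \<Longrightarrow> cs_add A x y \<in> cs_carrier A"
    and scale_closed: "x \<in> cs_carrier A \<Longrightarrow> cs_scale A c x \<in> cs_carrier A"
    and mult_closed: "\<lbrakk>x \<in> cs_carrier A; y \<in> cs_carrier A\<rbrakk> \<Longrightarrow> cs_mult A x y \<in> cs_carrier A"
    and star_closed: "x \<in> cs_carrier A \<Longrightarrow> cs_star A x \<in> cs_carrier A"
    and add_assoc: "\<lbrakk>x \<in> cs_carrier A; y \<in> cs_carrier A; z \<in> cs_carrier A\<rbrakk> \<Longrightarrow>
          cs_add A (cs_add A x y) z = cs_add A x (cs_add A y z)"
    and add_commute: "\<lbrakk>x \<in> cs_carrier A; y \<in> cs_carrier A\<rbrakk> \<Longrightarrow> cs_add A x y = cs_add A y x"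
    and add_zero: "x \<in> cs_carrier A \<Longrightarrow> cs_add A x (cs_zero A) = x"
    and diff_self: "x \<in> cs_carrier A \<Longrightarrow> cs_diff A x x = cs_zero A"
    and scale_one: "x \<in> cs_carrier A \<Longrightarrow> cs_scale A 1 x = x"
    and scale_scale: "x \<in> cs_carrier A \<Longrightarrow> cs_scale A c (cs_scale A d x) = cs_scale A (c * d) x"
    and scale_add_right: "\<lbrakk>x \<in> cs_carrier A; y \<in> cs_carrier A\<rbrakk> \<Longrightarrow>
          cs_scale A c (cs_add A x y) = cs_add A (cs_scale A c x) (cs_scale A c y)"
    and scale_add_left: "x \<in> cs_carrier A \<Longrightarrow>
          cs_scale A (c + d) x = cs_add A (cs_scale A c x) (cs_scale A d x)"
    and mult_assoc: "\<lbrakk>x \<in> cs_carrier A; y \<in> cs_carrier A; z \<in> cs_carrier A\<rbrakk> \<Longrightarrow>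
          cs_mult A (cs_mult A x y) z = cs_mult A x (cs_mult A y z)"
    and mult_add_right: "\<lbrakk>x \<in> cs_carrier A; y \<in> cs_carrier A; z \<in> cs_carrier A\<rbrakk> \<Longrightarrow>
          cs_mult A x (cs_add A y z) = cs_add A (cs_mult A x y) (cs_mult A x z)"
    and mult_add_left: "\<lbrakk>x \<in> cs_carrier A; y \<in> cs_carrier A; z \<in> cs_carrier A\<rbrakk> \<Longrightarrow>
          cs_mult A (cs_add A x y) z = cs_add A (cs_mult A x z) (cs_mult A y z)"
    and mult_scale_left: "\<lbrakk>x \<in> cs_carrier A; y \<in> cs_carrier A\<rbrakk> \<Longrightarrow>
          cs_mult A (cs_scale A c x) y = cs_scale A c (cs_mult A x y)"
    and mult_scale_right: "\<lbrakk>x \<in> cs_carrier A; y \<in> cs_carrier A\<rbrakk> \<Longrightarrow>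
          cs_mult A x (cs_scale A c y) = cs_scale A c (cs_mult A x y)"
    and star_star: "x \<in> cs_carrier A \<Longrightarrow> cs_star A (cs_star A x) = x"
    and star_add: "\<lbrakk>x \<in> cs_carrier A; y \<in> cs_carrier A\<rbrakk> \<Longrightarrow>
          cs_star A (cs_add A x y) = cs_add A (cs_star A x) (cs_star A y)"
    and star_scale: "x \<in> cs_carrier A \<Longrightarrow>
          cs_star A (cs_scale A c x) = cs_scale A (cnj c) (cs_star A x)"
    and star_mult: "\<lbrakk>x \<in> cs_carrier A; y \<in> cs_carrier A\<rbrakk> \<Longrightarrow>
          cs_star A (cs_mult A x y) = cs_mult A (cs_star A y) (cs_star A x)"
    and norm_nonneg: "x \<in> cs_carrier A \<Longrightarrow> 0 \<le> cs_norm A x"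
    and norm_eq_zero: "x \<in> cs_carrier A \<Longrightarrow> cs_norm A x = 0 \<longleftrightarrow> x = cs_zero A"
    and norm_triangle: "\<lbrakk>x \<in> cs_carrier A; y \<in> cs_carrier A\<rbrakk> \<Longrightarrow>
          cs_norm A (cs_add A x y) \<le> cs_norm A x + cs_norm A y"
    and norm_scale: "x \<in> cs_carrier A \<Longrightarrow> cs_norm A (cs_scale A c x) = cmod c * cs_norm A x"
    and norm_mult: "\<lbrakk>x \<in> cs_carrier A; y \<in> cs_carrier A\<rbrakk> \<Longrightarrow>
          cs_norm A (cs_mult A x y) \<le> cs_norm A x * cs_norm A y"
    and cstar_identity: "x \<in> cs_carrier A \<Longrightarrow>
          cs_norm A (cs_mult A (cs_star A x) x) = (cs_norm A x)\<^sup>2"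
    and complete: "\<lbrakk>\<forall>i::nat. s i \<in> cs_carrier A;
          \<forall>\<epsilon>>0. \<exists>N. \<forall>i\<ge>N. \<forall>j\<ge>N. cs_norm A (cs_diff A (s i) (s j)) < \<epsilon>\<rbrakk> \<Longrightarrow>
          \<exists>x\<in>cs_carrier A. (\<lambda>i. cs_norm A (cs_diff A (s i) x)) \<longlonglongrightarrow> 0"

definition star_iso :: "'a cstar \<Rightarrow> 'b cstar \<Rightarrow> ('a \<Rightarrow> 'b) \<Rightarrow> bool" where
  "star_iso A B \<phi> \<longleftrightarrow> bij_betw \<phi> (cs_carrier A) (cs_carrier B) \<and>
     (\<forall>x\<in>cs_carrier A. \<forall>y\<in>cs_carrier A. \<phi> (cs_add A x y) = cs_add B (\<phi> x) (\<phi> y)) \<and>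
     (\<forall>c. \<forall>x\<in>cs_carrier A. \<phi> (cs_scale A c x) = cs_scale B c (\<phi> x)) \<and>
     (\<forall>x\<in>cs_carrier A. \<forall>y\<in>cs_carrier A. \<phi> (cs_mult A x y) = cs_mult B (\<phi> x) (\<phi> y)) \<and>
     (\<forall>x\<in>cs_carrier A. \<phi> (cs_star A x) = cs_star B (\<phi> x))"

definition star_isomorphic :: "'a cstar \<Rightarrow> 'b cstar \<Rightarrow> bool" where
  "star_isomorphic A B \<longleftrightarrow> (\<exists>\<phi>. star_iso A B \<phi>)"

definition cs_positive :: "'a cstar \<Rightarrow> 'a \<Rightarrow> bool" where
  "cs_positive A x \<longleftrightarrow> (\<exists>y\<in>cs_carrier A. x = cs_mult A (cs_star A y) y)"

section \<open>Cartan subalgebras\<close>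

definition sub_cstar_algebra :: "'a cstar \<Rightarrow> 'a set \<Rightarrow> bool" where
  "sub_cstar_algebra A B \<longleftrightarrow> B \<subseteq> cs_carrier A \<and> cs_zero A \<in> B \<and>
     (\<forall>x\<in>B. \<forall>y\<in>B. cs_add A x y \<in> B) \<and>
     (\<forall>c. \<forall>x\<in>B. cs_scale A c x \<in> B) \<and>
     (\<forall>x\<in>B. \<forall>y\<in>B. cs_mult A x y \<in> B) \<and>
     (\<forall>x\<in>B. cs_star A x \<in> B) \<and>
     (\<forall>x\<in>cs_carrier A. (\<forall>\<epsilon>>0. \<exists>b\<in>B. cs_norm A (cs_diff A x b) < \<epsilon>) \<longrightarrow> x \<in> B)"

definition abelian_sub_cstar_algebra :: "'a cstar \<Rightarrow> 'a set \<Rightarrow> bool" where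
  "abelian_sub_cstar_algebra A B \<longleftrightarrow> sub_cstar_algebra A B \<and>
     (\<forall>x\<in>B. \<forall>y\<in>B. cs_mult A x y = cs_mult A y x)"

text \<open>An approximate unit is an increasing net \<open>u\<close> of positive contractions, indexed by a set
  \<open>\<Lambda>\<close> directed by \<open>le\<close>.\<close>

definition approximate_unit ::
    "'a cstar \<Rightarrow> 'i set \<Rightarrow> ('i \<Rightarrow> 'i \<Rightarrow> bool) \<Rightarrow> ('i \<Rightarrow> 'a) \<Rightarrow> bool" where
  "approximate_unit A \<Lambda> le u \<longleftrightarrow>
     \<Lambda> \<noteq> {} \<and> (\<forall>i\<in>\<Lambda>. le i i) \<and>
     (\<forall>i\<in>\<Lambda>. \<forall>j\<in>\<Lambda>. \<forall>k\<in>\<Lambda>. le i j \<longrightarrow> le j k \<longrightarrow> le i k) \<and>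
     (\<forall>i\<in>\<Lambda>. \<forall>j\<in>\<Lambda>. \<exists>k\<in>\<Lambda>. le i k \<and> le j k) \<and>
     (\<forall>i\<in>\<Lambda>. u i \<in> cs_carrier A \<and> cs_positive A (u i) \<and> cs_norm A (u i) \<le> 1) \<and>
     (\<forall>i\<in>\<Lambda>. \<forall>j\<in>\<Lambda>. le i j \<longrightarrow> cs_positive A (cs_diff A (u j) (u i))) \<and>
     (\<forall>a\<in>cs_carrier A. \<forall>\<epsilon>>0. \<exists>i\<in>\<Lambda>. \<forall>j\<in>\<Lambda>. le i j \<longrightarrow>
        cs_norm A (cs_diff A (cs_mult A (u j) a) a) < \<epsilon> \<and>
        cs_norm A (cs_diff A (cs_mult A a (u j)) a) < \<epsilon>)"

text \<open>Taking indices in \<open>'a\<close> itself loses no generality: for \<open>0 \<le> u \<le> v \<le> 1\<close> one has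
  \<open>\<parallel>(1 - v) a\<parallel>\<^sup>2 \<le> \<parallel>a\<^sup>* (1 - u) a\<parallel>\<close>, so an increasing net of positive contractions that is an
  approximate unit can be replaced by its range, ordered as a subset of \<open>A\<close>.\<close>

definition contains_approximate_unit :: "'a cstar \<Rightarrow> 'a set \<Rightarrow> bool" where
  "contains_approximate_unit A B \<longleftrightarrow>
     (\<exists>(\<Lambda> :: 'a set) le u. approximate_unit A \<Lambda> le u \<and> u ` \<Lambda> \<subseteq> B)"

definition maximal_abelian :: "'a cstar \<Rightarrow> 'a set \<Rightarrow> bool" where
  "maximal_abelian A B \<longleftrightarrow> abelian_sub_cstar_algebra A B \<and>
     (\<forall>C. abelian_sub_cstar_algebra A C \<and> B \<subseteq> C \<longrightarrow> C = B)"

definition normalizers :: "'a cstar \<Rightarrow> 'a set \<Rightarrow> 'a set" where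
  "normalizers A B = {n \<in> cs_carrier A.
     (\<forall>b\<in>B. cs_mult A (cs_mult A n b) (cs_star A n) \<in> B) \<and>
     (\<forall>b\<in>B. cs_mult A (cs_mult A (cs_star A n) b) n \<in> B)}"

definition generates :: "'a cstar \<Rightarrow> 'a set \<Rightarrow> bool" where
  "generates A S \<longleftrightarrow> \<Inter>{C. sub_cstar_algebra A C \<and> S \<subseteq> C} = cs_carrier A"

definition conditional_expectation :: "'a cstar \<Rightarrow> 'a set \<Rightarrow> ('a \<Rightarrow> 'a) \<Rightarrow> bool" where
  "conditional_expectation A B E \<longleftrightarrow>
     E ` cs_carrier A \<subseteq> B \<and> (\<forall>b\<in>B. E b = b) \<and>
     (\<forall>x\<in>cs_carrier A. \<forall>y\<in>cs_carrier A. E (cs_add A x y) = cs_add A (E x) (E y)) \<and>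
     (\<forall>c. \<forall>x\<in>cs_carrier A. E (cs_scale A c x) = cs_scale A c (E x)) \<and>
     (\<forall>x\<in>cs_carrier A. cs_positive A x \<longrightarrow> cs_positive A (E x)) \<and>
     (\<forall>x\<in>cs_carrier A. cs_norm A (E x) \<le> cs_norm A x) \<and>
     (\<forall>x\<in>cs_carrier A. \<forall>b\<in>B. E (cs_mult A b x) = cs_mult A b (E x) \<and>
                               E (cs_mult A x b) = cs_mult A (E x) b)"

definition faithful_on :: "'a cstar \<Rightarrow> ('a \<Rightarrow> 'a) \<Rightarrow> bool" where
  "faithful_on A E \<longleftrightarrow>
     (\<forall>x\<in>cs_carrier A. E (cs_mult A (cs_star A x) x) = cs_zero A \<longrightarrow> x = cs_zero A)"

definition cartan_subalgebra :: "'a cstar \<Rightarrow> 'a set \<Rightarrow> bool" where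
  "cartan_subalgebra A B \<longleftrightarrow>
     abelian_sub_cstar_algebra A B \<and>
     contains_approximate_unit A B \<and>
     maximal_abelian A B \<and>
     generates A (normalizers A B) \<and>
     (\<exists>E. conditional_expectation A B E \<and> faithful_on A E)"

definition cartan_equivalent :: "'a cstar \<Rightarrow> 'a set \<Rightarrow> 'a set \<Rightarrow> bool" where
  "cartan_equivalent A B1 B2 \<longleftrightarrow> (\<exists>\<phi>. star_iso A A \<phi> \<and> \<phi> ` B1 = B2)"

section \<open>C*-bundles and their section algebras\<close>

record ('t, 'e) cbundle =
  total_space :: "'e topology"
  proj :: "'e \<Rightarrow> 't"
  fib_zero :: "'t \<Rightarrow> 'e"
  fib_add :: "'e \<Rightarrow> 'e \<Rightarrow> 'e"
  fib_scale :: "complex \<Rightarrow> 'e \<Rightarrow> 'e"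
  fib_mult :: "'e \<Rightarrow> 'e \<Rightarrow> 'e"
  fib_star :: "'e \<Rightarrow> 'e"
  fib_norm :: "'e \<Rightarrow> real"

definition fibre :: "('t, 'e) cbundle \<Rightarrow> 't \<Rightarrow> 'e cstar" where
  "fibre \<xi> t = \<lparr> cs_carrier = {e \<in> topspace (total_space \<xi>). proj \<xi> e = t},
     cs_zero = fib_zero \<xi> t, cs_add = fib_add \<xi>, cs_scale = fib_scale \<xi>,
     cs_mult = fib_mult \<xi>, cs_star = fib_star \<xi>, cs_norm = fib_norm \<xi> \<rparr>"

definition fibre_product :: "('t, 'e) cbundle \<Rightarrow> ('e \<times> 'e) topology" where
  "fibre_product \<xi> = subtopology (prod_topology (total_space \<xi>) (total_space \<xi>))
     {(x, y). proj \<xi> x = proj \<xi> y}"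

text \<open>C*-bundles in the sense of Fell: the norm is continuous (not merely upper semicontinuous)
  on the total space, and local triviality is not part of the definition. The last axiom says
  that \<open>x\<^sub>i \<rightarrow> 0\<^sub>t\<close> whenever \<open>proj x\<^sub>i \<rightarrow> t\<close> and \<open>\<parallel>x\<^sub>i\<parallel> \<rightarrow> 0\<close>.\<close>

locale cstar_bundle =
  fixes T :: "'t topology" and \<xi> :: "('t, 'e) cbundle"
  assumes proj_continuous: "continuous_map (total_space \<xi>) T (proj \<xi>)"
    and proj_open: "open_map (total_space \<xi>) T (proj \<xi>)"
    and proj_surj: "proj \<xi> ` topspace (total_space \<xi>) = topspace T"
    and fibre_cstar: "t \<in> topspace T \<Longrightarrow> cstar_algebra (fibre \<xi> t)"
    and norm_continuous: "continuous_map (total_space \<xi>) euclideanreal (fib_norm \<xi>)"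
    and add_continuous:
      "continuous_map (fibre_product \<xi>) (total_space \<xi>) (\<lambda>(x, y). fib_add \<xi> x y)"
    and scale_continuous: "continuous_map (total_space \<xi>) (total_space \<xi>) (fib_scale \<xi> c)"
    and mult_continuous:
      "continuous_map (fibre_product \<xi>) (total_space \<xi>) (\<lambda>(x, y). fib_mult \<xi> x y)"
    and star_continuous: "continuous_map (total_space \<xi>) (total_space \<xi>) (fib_star \<xi>)"
    and zero_nhds: "\<lbrakk>t \<in> topspace T; openin (total_space \<xi>) U; fib_zero \<xi> t \<in> U\<rbrakk> \<Longrightarrow>
      \<exists>V \<epsilon>. openin T V \<and> t \<in> V \<and> \<epsilon> > 0 \<and>
        {x \<in> topspace (total_space \<xi>). proj \<xi> x \<in> V \<and> fib_norm \<xi> x < \<epsilon>} \<subseteq> U"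

definition cstar_bundle_with_fibre :: "'t topology \<Rightarrow> ('t, 'e) cbundle \<Rightarrow> 'a cstar \<Rightarrow> bool" where
  "cstar_bundle_with_fibre T \<xi> F \<longleftrightarrow>
     cstar_bundle T \<xi> \<and> (\<forall>t\<in>topspace T. star_isomorphic (fibre \<xi> t) F)"

text \<open>The set \<open>S\<close> of functions on \<open>X\<close>, with pointwise operations taken in the algebras \<open>F t\<close> and
  with the supremum norm. Functions are made extensional (undefined off \<open>X\<close>), so that equality of
  elements is equality on \<open>X\<close>.\<close>

definition pointwise_algebra :: "'t set \<Rightarrow> ('t \<Rightarrow> 'a cstar) \<Rightarrow> ('t \<Rightarrow> 'a) set \<Rightarrow> ('t \<Rightarrow> 'a) cstar" where
  "pointwise_algebra X F S = \<lparr> cs_carrier = S,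
     cs_zero = (\<lambda>t\<in>X. cs_zero (F t)),
     cs_add = (\<lambda>f g. \<lambda>t\<in>X. cs_add (F t) (f t) (g t)),
     cs_scale = (\<lambda>c f. \<lambda>t\<in>X. cs_scale (F t) c (f t)),
     cs_mult = (\<lambda>f g. \<lambda>t\<in>X. cs_mult (F t) (f t) (g t)),
     cs_star = (\<lambda>f. \<lambda>t\<in>X. cs_star (F t) (f t)),
     cs_norm = (\<lambda>f. SUP t\<in>X. cs_norm (F t) (f t)) \<rparr>"

definition section_algebra :: "'t topology \<Rightarrow> ('t, 'e) cbundle \<Rightarrow> ('t \<Rightarrow> 'e) cstar" where
  "section_algebra T \<xi> = pointwise_algebra (topspace T) (fibre \<xi>)
     {s \<in> extensional (topspace T). continuous_map T (total_space \<xi>) s \<and>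
        (\<forall>t\<in>topspace T. proj \<xi> (s t) = t)}"

section \<open>Matrices and matrix-valued functions\<close>

definition conj_transpose :: "complex^'n^'n \<Rightarrow> complex^'n^'n" where
  "conj_transpose M = (\<chi> i j. cnj (M $ j $ i))"

definition matrix_algebra :: "(complex^'n^'n) cstar" where
  "matrix_algebra = \<lparr> cs_carrier = UNIV, cs_zero = 0, cs_add = (+),
     cs_scale = (\<lambda>c M. \<chi> i j. c * M $ i $ j), cs_mult = (**), cs_star = conj_transpose,
     cs_norm = (\<lambda>M. onorm ((*v) M)) \<rparr>"

definition diagonal_matrices :: "(complex^'n^'n) set" where
  "diagonal_matrices = {M. \<forall>i j. i \<noteq> j \<longrightarrow> M $ i $ j = 0}"

text \<open>Since \<open>M\<^sub>n\<close> is finite-dimensional, its operator-norm topology is the Euclidean one.\<close>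

definition matrix_functions :: "'t topology \<Rightarrow> ('t \<Rightarrow> complex^'n^'n) cstar" where
  "matrix_functions T = pointwise_algebra (topspace T) (\<lambda>_. matrix_algebra)
     {f \<in> extensional (topspace T). continuous_map T euclidean f}"

definition diagonal_functions :: "'t topology \<Rightarrow> ('t \<Rightarrow> complex^'n^'n) set" where
  "diagonal_functions T =
     {f \<in> cs_carrier (matrix_functions T). \<forall>t\<in>topspace T. f t \<in> diagonal_matrices}"

end

theory Submission
  imports Defs "HOL-Computational_Algebra.Fundamental_Theorem_Algebra"
begin

text \<open>A conditional expectation \<open>E\<close> of a section algebra \<open>A\<close> with fibres \<open>A\<^sub>t \<cong> M\<^sub>n\<close> onto a Cartan
  subalgebra \<open>B\<close> is \<open>C(S\<^sup>k)\<close>-linear, so it induces idempotents of the \<open>A\<^sub>t\<close> with ranges the fibres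
  \<open>B\<^sub>t\<close> of \<open>B\<close>. The ranks of these idempotents and of their complements are lower semicontinuous and
  add up to \<open>n\<^sup>2\<close>. Hence \<open>dim B\<^sub>t\<close> is locally constant, and the minimal projections of \<open>B\<^sub>t\<close> vary
  continuously with \<open>t\<close>. Maximality of \<open>B\<close> now makes them minimal in \<open>A\<^sub>t\<close>, so that locally there
  are continuous matrix units \<open>e\<^sub>i\<^sub>j\<close> (a frame) with \<open>e\<^sub>i\<^sub>i\<close> in \<open>B\<close>. Over a connected set two frames
  differ by a permutation and by circle-valued functions. These have continuous logarithms on convex
  sets and on the equator \<open>S\<^sup>k\<^sup>-\<^sup>1\<close>, which is simply connected because \<open>k > 2\<close>. By Tietze's theorem
  frames over two closed sets with such an intersection can be made to agree there. This gives a frame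
  over each hemisphere and then over \<open>S\<^sup>k\<close>, that is, an isomorphism of \<open>A\<close> with \<open>C(S\<^sup>k, M\<^sub>n)\<close> that
  carries \<open>B\<close> to \<open>C(S\<^sup>k, D\<^sub>n)\<close>.\<close>

section \<open>Complex matrices as a ring\<close>

text \<open>Bundles are taken in Fell's sense, so neither local triviality nor a single nonzero
  continuous section is given. Sections through prescribed points are built from the openness of the
  projection and the completeness of the fibres, and continuity is expressed only through the norms
  and the set of sections; this is why the fibres may be identified with M_n point by point. Strict
  norm inequalities persist nearby and become equations because a nonzero projection has norm 1 and
  two distinct commuting projections are at distance at least 1. Real logarithms are needed because
  Tietze's theorem extends real functions, whereas a circle-valued function on a closed set need not
  extend. The algebra of matrix-valued functions is handled as another instance of the same setting:
  the trivialization is proved once, and applied to that algebra it is an automorphism, which is the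
  uniqueness claim.\<close>

typedef (overloaded) 'n cmat = "UNIV :: (complex^'n^'n) set"
  morphisms rep_cmat Cmat by simp

declare Cmat_inverse [simplified, simp] rep_cmat_inverse [simp]

lemma cmat_eqI: "rep_cmat x = rep_cmat y \<Longrightarrow> x = y"
  by (simp add: rep_cmat_inject)

definition ent :: "'n::finite cmat \<Rightarrow> 'n \<Rightarrow> 'n \<Rightarrow> complex" where
  "ent x i j = rep_cmat x $ i $ j"

lemma cmat_ent_eqI: "(\<And>i j. ent x i j = ent y i j) \<Longrightarrow> x = y"
  by (rule cmat_eqI) (simp add: ent_def vec_eq_iff)

lemma matrix_mult_add_rdistrib: "(A + B) ** C = A ** C + B ** (C :: complex^'n^'m)"
  by (simp add: matrix_matrix_mult_def vec_eq_iff distrib_right sum.distrib)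

text \<open>The product \<open>*\<close> on \<open>complex^'n^'n\<close> is componentwise; on this
  copy of the type it is the matrix product, so that ring rewriting applies to it.\<close>

instantiation cmat :: (finite) ring_1
begin
definition "0 = Cmat 0"
definition "1 = Cmat (mat 1)"
definition "x + y = Cmat (rep_cmat x + rep_cmat y)"
definition "x - y = Cmat (rep_cmat x - rep_cmat y)"
definition "- x = Cmat (- rep_cmat x)"
definition "x * y = Cmat (rep_cmat x ** rep_cmat y)"

instance
proof
  have "mat 1 $ i $ i \<noteq> (0::complex^'a^'a) $ i $ i" for i :: 'a
    by (simp add: mat_def)
  then have "(mat 1::complex^'a^'a) \<noteq> 0" by metis
  then show "(0::'a cmat) \<noteq> 1"
    unfolding zero_cmat_def one_cmat_def by (metis Cmat_inverse UNIV_I)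
qed (auto simp: zero_cmat_def one_cmat_def plus_cmat_def minus_cmat_def uminus_cmat_def
    times_cmat_def matrix_mul_assoc matrix_add_ldistrib matrix_mult_add_rdistrib
    ac_simps)
end

lemma rep_simps [simp]:
  "rep_cmat 0 = 0" "rep_cmat 1 = mat 1" "rep_cmat (x + y) = rep_cmat x + rep_cmat y"
  "rep_cmat (x - y) = rep_cmat x - rep_cmat y" "rep_cmat (- x) = - rep_cmat x"
  "rep_cmat (x * y) = rep_cmat x ** rep_cmat y"
  by (simp_all add: zero_cmat_def one_cmat_def plus_cmat_def minus_cmat_def uminus_cmat_def
      times_cmat_def)

text \<open>Scalars are embedded as central matrices: scaling becomes a ring product, and
  \<open>cc_comm\<close> and \<open>cc_left_comm\<close> move scalars through products.\<close>

definition cc :: "complex \<Rightarrow> 'n::finite cmat" where "cc c = Cmat (mat c)"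

definition adj :: "'n::finite cmat \<Rightarrow> 'n cmat" where "adj x = Cmat (conj_transpose (rep_cmat x))"

definition unit_mat :: "'n::finite \<Rightarrow> 'n \<Rightarrow> 'n cmat" where
  "unit_mat i j = Cmat (\<chi> a b. if a = i \<and> b = j then 1 else 0)"

lemma ent_simps [simp]:
  "ent 0 i j = 0" "ent 1 i j = (if i = j then 1 else 0)" "ent (x + y) i j = ent x i j + ent y i j"
  "ent (x - y) i j = ent x i j - ent y i j" "ent (- x) i j = - ent x i j"
  "ent (cc c) i j = (if i = j then c else 0)"
  "ent (adj x) i j = cnj (ent x j i)"
  "ent (unit_mat a b) i j = (if i = a \<and> j = b then 1 else 0)"
  by (simp_all add: ent_def cc_def adj_def conj_transpose_def unit_mat_def mat_def)

lemma ent_mult: "ent (x * y) i j = (\<Sum>k\<in>UNIV. ent x i k * ent y k j)"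
  by (simp add: ent_def matrix_matrix_mult_def)

lemma ent_sum: "ent (sum f A) i j = (\<Sum>a\<in>A. ent (f a) i j)"
  by (induction A rule: infinite_finite_induct) auto

lemma sum_delta_and:
  fixes f :: "'n::finite \<Rightarrow> complex"
  shows "(\<Sum>b\<in>UNIV. f b * (if P \<and> b = j then 1 else 0)) = (if P then f j else 0)"
    "(\<Sum>b\<in>UNIV. (if b = j \<and> P then 1 else 0) * f b) = (if P then f j else 0)"
proof -
  have "(\<Sum>b\<in>UNIV. f b * (if P \<and> b = j then 1 else 0)) = (\<Sum>b\<in>UNIV. if b = j then if P then f b else 0 else 0)"
    "(\<Sum>b\<in>UNIV. (if b = j \<and> P then 1 else 0) * f b) = (\<Sum>b\<in>UNIV. if b = j then if P then f b else 0 else 0)"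
    by (rule sum.cong; auto)+
  then show "(\<Sum>b\<in>UNIV. f b * (if P \<and> b = j then 1 else 0)) = (if P then f j else 0)"
    "(\<Sum>b\<in>UNIV. (if b = j \<and> P then 1 else 0) * f b) = (if P then f j else 0)"
    by simp_all
qed

lemma ent_cc_mult [simp]: "ent (cc c * x) i j = c * ent x i j"
proof -
  have "ent (cc c * x) i j = (\<Sum>k\<in>UNIV. if k = i then c * ent x k j else 0)"
    unfolding ent_mult by (rule sum.cong) auto
  then show ?thesis by simp
qed

lemma ent_mult_cc [simp]: "ent (x * cc c) i j = ent x i j * c"
proof -
  have "ent (x * cc c) i j = (\<Sum>k\<in>UNIV. if k = j then ent x i k * c else 0)"
    unfolding ent_mult by (rule sum.cong) auto
  then show ?thesis by simp
qed

lemma rep_cc_mult: "rep_cmat (cc c * x) = (\<chi> i j. c * rep_cmat x $ i $ j)"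
  using ent_cc_mult [of c x] by (simp add: ent_def vec_eq_iff)

lemma cc_comm: "x * cc c = cc c * x"
  by (rule cmat_ent_eqI) simp

lemma cc_left_comm: "x * (cc c * y) = cc c * (x * y)"
  by (metis cc_comm mult.assoc)

lemma cc_hom [simp]: "cc 0 = 0" "cc 1 = 1"
  by (rule cmat_ent_eqI; simp)+

lemma cc_mult: "cc (a * b) = cc a * cc b"
  and cc_add: "cc (a + b) = cc a + cc b"
  and cc_diff: "cc (a - b) = cc a - cc b"
  and cc_minus: "cc (- a) = - cc a"
  by (rule cmat_ent_eqI; simp)+

lemma cc_cc_mult: "cc a * (cc b * x) = cc (a * b) * x"
  by (simp add: cc_mult mult.assoc)

lemma cc_sum: "cc (sum f A) = (\<Sum>a\<in>A. cc (f a))"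
  by (induction A rule: infinite_finite_induct) (auto simp: cc_add)

lemma cc_mult_eq_0: "cc c * x = 0 \<longleftrightarrow> c = 0 \<or> x = 0"
proof -
  have "x = 0" if "cc c * x = 0" "c \<noteq> 0"
  proof -
    have "x = cc (inverse c * c) * x" using that by simp
    also have "\<dots> = cc (inverse c) * (cc c * x)" by (simp only: cc_cc_mult)
    finally show ?thesis using that by simp
  qed
  then show ?thesis by auto
qed

lemma cc_mult_cancel: "x \<noteq> 0 \<Longrightarrow> cc a * x = cc b * x \<longleftrightarrow> a = b"
  using cc_mult_eq_0 [of "a - b" x] by (auto simp: cc_diff algebra_simps)

lemma adj_adj [simp]: "adj (adj x) = x"
  and adj_add: "adj (x + y) = adj x + adj y"
  and adj_diff: "adj (x - y) = adj x - adj y"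
  and adj_cc [simp]: "adj (cc c) = cc (cnj c)"
  and adj_0 [simp]: "adj 0 = 0"
  and adj_1 [simp]: "adj 1 = 1"
  by (rule cmat_ent_eqI; simp)+

lemma adj_mult: "adj (x * y) = adj y * adj x"
  by (rule cmat_ent_eqI) (simp add: ent_mult mult.commute)

lemma adj_sum: "adj (sum f A) = (\<Sum>a\<in>A. adj (f a))"
  by (induction A rule: infinite_finite_induct) (auto simp: adj_add)

lemma adj_eq_0: "adj x = 0 \<longleftrightarrow> x = 0"
  by (metis adj_0 adj_adj)

lemma unit_mat_expand: "x = (\<Sum>i\<in>UNIV. \<Sum>j\<in>UNIV. cc (ent x i j) * unit_mat i j)"
proof (rule cmat_ent_eqI)
  fix i j
  have "(\<Sum>b\<in>UNIV. ent x a b * (if i = a \<and> j = b then 1 else 0)) = (if i = a then ent x a j else 0)" for a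
    using sum_delta_and(1)[of "ent x a" "i = a" j] by (simp add: eq_commute)
  then show "ent x i j = ent (\<Sum>i\<in>UNIV. \<Sum>j\<in>UNIV. cc (ent x i j) * unit_mat i j) i j"
    by (simp add: ent_sum)
qed

lemma ent_mult_unit: "ent (p * unit_mat a b) i k = (if k = b then ent p i a else 0)"
  using sum_delta_and(1)[of "ent p i" "k = b" a] by (simp add: ent_mult conj_commute)

text \<open>The product is a column of \<open>p\<close> times a row of \<open>q\<close>. Both the
  primeness of M_n and the trace of a minimal projection are read off from these entries.\<close>

lemma ent_mult_unit_mult: "ent (p * unit_mat a b * q) i j = ent p i a * ent q b j"
proof -
  have "ent (p * unit_mat a b * q) i j = (\<Sum>k\<in>UNIV. if k = b then ent p i a * ent q k j else 0)"
    unfolding ent_mult [of "p * unit_mat a b"] ent_mult_unit by (rule sum.cong) auto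
  then show ?thesis by simp
qed

section \<open>The trace and its faithfulness\<close>

definition trc :: "'n::finite cmat \<Rightarrow> complex" where "trc x = (\<Sum>i\<in>UNIV. ent x i i)"

lemma trc_add: "trc (x + y) = trc x + trc y" by (simp add: trc_def sum.distrib)
lemma trc_sum: "trc (sum f A) = (\<Sum>a\<in>A. trc (f a))"
  by (induction A rule: infinite_finite_induct) (auto simp: trc_add, simp_all add: trc_def)
lemma trc_cc [simp]: "trc (cc c * x) = c * trc x" by (simp add: trc_def sum_distrib_left)
lemma trc_comm: "trc (x * y) = trc (y * x)"
  unfolding trc_def ent_mult by (subst sum.swap) (simp add: mult.commute)
lemma trc_one: "trc (1::'n::finite cmat) = of_nat CARD('n)" by (simp add: trc_def)

text \<open>The squared Hilbert-Schmidt norm of \<open>x\<close>. It makes the trace faithful, and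
  it later identifies certain scalars as nonnegative reals.\<close>

lemma trc_adj_mult: "trc (adj x * x) = of_real (\<Sum>i\<in>UNIV. \<Sum>k\<in>UNIV. (cmod (ent x k i))\<^sup>2)"
  unfolding trc_def ent_mult by (simp only: of_real_sum ent_simps complex_norm_square mult.commute)

lemma trc_adj_mult_eq_0: "trc (adj x * x) = 0 \<longleftrightarrow> x = 0"
proof
  assume "trc (adj x * x) = 0"
  then have "(\<Sum>i\<in>UNIV. \<Sum>k\<in>UNIV. (cmod (ent x k i))\<^sup>2) = 0"
    unfolding trc_adj_mult of_real_eq_0_iff .
  then have "\<forall>i k. ent x k i = 0"
    by (simp add: sum_nonneg_eq_0_iff sum_nonneg)
  then show "x = 0" by (intro cmat_ent_eqI) simp
qed (simp add: trc_def)

lemma adj_mult_eq_0: "adj x * x = 0 \<longleftrightarrow> x = 0"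
  using trc_adj_mult_eq_0 [of x] by (auto simp: trc_def)

text \<open>A matrix unit placed between a nonzero entry of \<open>p\<close> and one of
  \<open>q\<close> gives the witness. This supplies the elements that connect two minimal
  projections of a fibre.\<close>

lemma prime_cmat:
  fixes p q :: "'n::finite cmat"
  assumes "p \<noteq> 0" "q \<noteq> 0" obtains x where "p * x * q \<noteq> 0"
proof -
  obtain a b c d where *: "ent p a b \<noteq> 0" "ent q c d \<noteq> 0"
    using assms by (metis cmat_ent_eqI ent_simps(1))
  have "ent (p * unit_mat b c * q) a d = ent p a b * ent q c d" by (rule ent_mult_unit_mult)
  with * have "p * unit_mat b c * q \<noteq> 0" by auto
  then show ?thesis using that by blast
qed

subsection \<open>Projections\<close>

definition is_proj :: "'n::finite cmat \<Rightarrow> bool" where "is_proj p \<longleftrightarrow> p * p = p \<and> adj p = p"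

text \<open>An algebraic form of rank one: the corner of \<open>p\<close> consists of the multiples
  of \<open>p\<close>.\<close>

definition minimal_proj :: "'n::finite cmat \<Rightarrow> bool" where
  "minimal_proj p \<longleftrightarrow> is_proj p \<and> p \<noteq> 0 \<and> (\<forall>x. \<exists>c. p * x * p = cc c * p)"

text \<open>Taking traces determines the scalar by which \<open>p * x * p\<close> is a multiple of
  \<open>p\<close>. Evaluated at matrix units this becomes an identity between entries of
  \<open>p\<close>, which sums to \<tau>^3 = \<tau>; and \<tau> is a positive sum of
  squares.\<close>

lemma minimal_proj_trc:
  assumes "minimal_proj p" shows "trc p = 1"
proof -
  have p: "p * p = p" "adj p = p" "p \<noteq> 0" using assms by (auto simp: minimal_proj_def is_proj_def)
  define \<tau> where "\<tau> = trc p"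
  have \<tau>: "\<tau> \<noteq> 0" using trc_adj_mult_eq_0 [of p] p by (simp add: \<tau>_def)
  have ex: "\<exists>c. p * x * p = cc c * p" for x using assms by (auto simp: minimal_proj_def)
  have scal: "cc \<tau> * (p * x * p) = cc (trc (p * x)) * p" for x
  proof -
    obtain c where c: "p * x * p = cc c * p" using ex by blast
    have "trc (p * x) = trc (p * x * p)" by (metis p(1) trc_comm mult.assoc)
    also have "\<dots> = c * \<tau>" by (simp add: c \<tau>_def)
    finally show ?thesis using c by (simp add: cc_cc_mult mult.commute)
  qed
  have tu: "trc (p * unit_mat a b) = ent p b a" for a b
    by (simp add: trc_def ent_mult_unit)
  note pu = ent_mult_unit_mult [of p _ _ p]
  have eq: "\<tau> * (ent p i a * ent p b j) = ent p b a * ent p i j" for a b i j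
    using arg_cong [OF scal [of "unit_mat a b"], of "\<lambda>x. ent x i j"] by (simp add: tu pu)
  \<comment> \<open>Instances of \<open>eq\<close> with a = i and j = b, summed over i and
    b.\<close>
  have "\<tau> * (\<tau> * \<tau>) = \<tau> * (\<Sum>i\<in>UNIV. \<Sum>b\<in>UNIV. (ent p i i * ent p b b))"
    by (simp only: \<tau>_def trc_def sum_product)
  also have "\<dots> = (\<Sum>i\<in>UNIV. \<Sum>b\<in>UNIV. ent p i b * ent p b i)"
    by (simp add: sum_distrib_left eq mult.commute)
  also have "\<dots> = trc (p * p)" by (simp add: trc_def ent_mult)
  also have "\<dots> = \<tau>" by (simp add: p \<tau>_def)
  finally have t2: "\<tau> * \<tau> = 1" using \<tau> by simp
  have "\<tau> = trc (adj p * p)" by (simp add: p \<tau>_def)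
  then obtain r where r: "\<tau> = of_real r" "r \<ge> 0"
    unfolding trc_adj_mult by (metis (no_types, lifting) sum_nonneg zero_le_power2)
  have "r * r = 1" using t2 r by (metis of_real_eq_1_iff of_real_mult)
  then have "r = 1" using r(2) by (simp add: square_eq_1_iff)
  then show ?thesis using r \<tau>_def by simp
qed

text \<open>Take the trace of both sides. The count allows the index type \<open>'n\<close> to label
  the minimal projections of a fibre.\<close>

lemma card_minimal_proj:
  fixes Q :: "'n::finite cmat set"
  assumes "\<And>q. q \<in> Q \<Longrightarrow> minimal_proj q" "\<Sum>Q = 1"
  shows "card Q = CARD('n)"
proof -
  have "(of_nat CARD('n) :: complex) = trc (\<Sum>Q :: 'n cmat)" by (simp add: assms trc_one)
  also have "\<dots> = of_nat (card Q)" unfolding trc_sum by (simp add: assms minimal_proj_trc)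
  finally show ?thesis using of_nat_eq_iff by metis
qed

text \<open>The bound is the real dimension of M_n, so the coefficients of the relation can be taken
  real.\<close>

lemma real_dependent_cmat:
  fixes Q :: "'n::finite cmat set"
  assumes "finite Q" "card Q > DIM(complex^'n^'n)"
  obtains r :: "'n cmat \<Rightarrow> real" where "\<exists>q\<in>Q. r q \<noteq> 0" "(\<Sum>q\<in>Q. cc (of_real (r q)) * q) = 0"
proof -
  have inj: "inj_on rep_cmat Q" by (meson cmat_eqI inj_onI)
  have "card (rep_cmat ` Q) > DIM(complex^'n^'n)" using assms card_image[OF inj] by simp
  then have "dependent (rep_cmat ` Q)" using assms(1) by (simp add: dependent_biggerset)
  then obtain u where u: "(\<Sum>v\<in>rep_cmat ` Q. u v *\<^sub>R v) = 0" "\<exists>v\<in>rep_cmat ` Q. u v \<noteq> 0"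
    using assms(1) real_vector.dependent_finite [of "rep_cmat ` Q"] by auto
  have scale: "rep_cmat (cc (of_real r) * x) = r *\<^sub>R rep_cmat x" for r and x :: "'n cmat"
    unfolding rep_cc_mult by (simp add: vec_eq_iff) (simp add: scaleR_conv_of_real)
  have rs: "rep_cmat (\<Sum>q\<in>A. f q) = (\<Sum>q\<in>A. rep_cmat (f q))" for A and f :: "'n cmat \<Rightarrow> 'n cmat"
    by (induction A rule: infinite_finite_induct) auto
  have "rep_cmat (\<Sum>q\<in>Q. cc (of_real (u (rep_cmat q))) * q) = 0"
    unfolding rs scale using u(1) by (simp add: sum.reindex[OF inj])
  then have "(\<Sum>q\<in>Q. cc (of_real (u (rep_cmat q))) * q) = 0" by (simp add: cmat_eqI)
  then show ?thesis using that [of "u \<circ> rep_cmat"] u(2) by auto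
qed

text \<open>Multiplying a linear relation by one member isolates its coefficient. The bound is
  crude, but depends on n alone.\<close>

lemma card_orth_proj_le:
  fixes Q :: "'n::finite cmat set"
  assumes "finite Q" "0 \<notin> Q" "\<And>q. q \<in> Q \<Longrightarrow> q * q = q"
    and "\<And>p q. \<lbrakk>p \<in> Q; q \<in> Q; p \<noteq> q\<rbrakk> \<Longrightarrow> p * q = 0"
  shows "card Q \<le> DIM(complex^'n^'n)"
proof (rule ccontr)
  assume "\<not> card Q \<le> DIM(complex^'n^'n)"
  then obtain r :: "'n cmat \<Rightarrow> real" and q where r: "q \<in> Q" "r q \<noteq> 0"
    "(\<Sum>q\<in>Q. cc (of_real (r q)) * q) = 0"
    using real_dependent_cmat [OF assms(1)] by (metis not_le)
  have "0 = (\<Sum>p\<in>Q. cc (of_real (r p)) * p) * q" using r by simp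
  also have "\<dots> = (\<Sum>p\<in>Q. if p = q then cc (of_real (r q)) * q else 0)"
    unfolding sum_distrib_right by (rule sum.cong) (use assms r(1) in \<open>auto simp: mult.assoc\<close>)
  also have "\<dots> = cc (of_real (r q)) * q" using assms(1) r(1) by simp
  finally show False using r assms(2) cc_mult_eq_0 by (metis of_real_eq_0_iff)
qed

subsection \<open>Finite-dimensional commutative *-algebras\<close>

definition comm_star_subalg :: "'n::finite cmat set \<Rightarrow> bool" where
  "comm_star_subalg C \<longleftrightarrow> 1 \<in> C \<and> (\<forall>x\<in>C. \<forall>y\<in>C. x + y \<in> C \<and> x * y \<in> C \<and> x * y = y * x) \<and>
     (\<forall>x\<in>C. adj x \<in> C) \<and> (\<forall>c. \<forall>x\<in>C. cc c * x \<in> C)"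

section \<open>Polynomials in a matrix and eigenvectors\<close>

definition poly_mat :: "complex poly \<Rightarrow> 'n::finite cmat \<Rightarrow> 'n cmat" where
  "poly_mat p y = fold_coeffs (\<lambda>a b. cc a + y * b) p 0"

lemma poly_mat_0 [simp]: "poly_mat 0 y = 0" by (simp add: poly_mat_def)

lemma poly_mat_pCons [simp]: "poly_mat (pCons a p) y = cc a + y * poly_mat p y"
  by (cases "p = 0 \<and> a = 0") (auto simp: poly_mat_def)

lemma poly_mat_add: "poly_mat (p + q) y = poly_mat p y + poly_mat q y"
proof (induction p arbitrary: q)
  case (pCons a p)
  then show ?case by (cases q) (auto simp: cc_add algebra_simps)
qed simp

lemma poly_mat_smult: "poly_mat (smult c p) y = cc c * poly_mat p y"
  by (induction p) (auto simp: cc_mult cc_left_comm distrib_left)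

lemma poly_mat_monom: "poly_mat (monom c k) y = cc c * y ^ k"
  by (induction k) (auto simp: monom_0 monom_Suc cc_left_comm)

lemma poly_mat_sum: "poly_mat (sum f A) y = (\<Sum>a\<in>A. poly_mat (f a) y)"
  by (induction A rule: infinite_finite_induct) (auto simp: poly_mat_add)

text \<open>The powers of \<open>y\<close> up to the real dimension are linearly dependent.
  Coinciding powers are treated separately, since they would collapse in the set to which the
  dependence lemma applies.\<close>

lemma annihilating_poly:
  fixes y :: "'n::finite cmat"
  obtains p where "p \<noteq> 0" "poly_mat p y = 0"
proof (cases "inj_on (\<lambda>k. y ^ k) {..DIM(complex^'n^'n)}")
  case False
  then obtain i j where ij: "i \<noteq> j" "y ^ i = y ^ j" by (auto simp: inj_on_def)
  show ?thesis
  proof (rule that)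
    show "monom 1 i + smult (-1) (monom 1 j) \<noteq> (0 :: complex poly)"
    proof
      assume "monom 1 i + smult (-1) (monom 1 j) = (0 :: complex poly)"
      then have "coeff (monom 1 i + smult (-1) (monom (1::complex) j)) i = 0" by simp
      then show False using ij by simp
    qed
    show "poly_mat (monom 1 i + smult (-1) (monom 1 j)) y = 0"
      by (simp add: poly_mat_add poly_mat_smult poly_mat_monom ij cc_minus del: smult_minus_left)
  qed
next
  case True
  let ?I = "{..DIM(complex^'n^'n)}"
  have "card ((\<lambda>k. y ^ k) ` ?I) > DIM(complex^'n^'n)" by (simp only: card_image[OF True] card_atMost lessI)
  then obtain r :: "'n cmat \<Rightarrow> real" where r: "\<exists>q\<in>(\<lambda>k. y ^ k) ` ?I. r q \<noteq> 0"
    "(\<Sum>q\<in>(\<lambda>k. y ^ k) ` ?I. cc (of_real (r q)) * q) = 0"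
    by (rule real_dependent_cmat [rotated]) auto
  then obtain k where k: "k \<in> ?I" "r (y ^ k) \<noteq> 0" by auto
  define p where "p = (\<Sum>k\<in>?I. monom (of_real (r (y ^ k)) :: complex) k)"
  have "coeff p k = of_real (r (y ^ k))"
    using k(1) by (simp add: p_def coeff_sum)
  with k have "p \<noteq> 0" by auto
  moreover have "poly_mat p y = 0"
    using r(2) unfolding sum.reindex[OF True] o_def by (simp add: p_def poly_mat_sum poly_mat_monom)
  ultimately show ?thesis using that by blast
qed

lemma poly_mat_eigen: "x * z = cc l * z \<Longrightarrow> poly_mat q x * z = cc (poly q l) * z"
proof (induction q)
  case (pCons a q)
  have "poly_mat (pCons a q) x * z = cc a * z + x * (poly_mat q x * z)"
    by (simp add: distrib_right mult.assoc)
  also have "poly_mat q x * z = cc (poly q l) * z" using pCons by blast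
  also have "x * (cc (poly q l) * z) = cc (poly q l) * (cc l * z)" by (subst cc_left_comm) (simp only: pCons.prems)
  also have "cc a * z + \<dots> = cc (poly (pCons a q) l) * z"
    by (simp only: cc_cc_mult cc_add distrib_right poly_pCons mult.commute [of l])
  finally show ?case .
qed simp

text \<open>Among the polynomials with r(y) p = 0 take one of least degree. It is not constant,
  since p is nonzero, so it has a root l; writing r = (X - l) q, minimality keeps q(y) p nonzero,
  and y - l annihilates it.\<close>

lemma eigen_element:
  fixes y p :: "'n::finite cmat"
  assumes "p \<noteq> 0"
  obtains l q where "poly_mat q y * p \<noteq> 0" "y * (poly_mat q y * p) = cc l * (poly_mat q y * p)"
proof -
  define P where "P = (\<lambda>r. r \<noteq> 0 \<and> poly_mat r y * p = 0)"
  obtain r0 where "P r0" unfolding P_def using annihilating_poly [of y] by (metis mult_zero_left)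
  then obtain r where r: "P r" "\<And>q. P q \<Longrightarrow> degree r \<le> degree q"
    using ex_has_least_nat [of P r0 degree] by blast
  have "\<not> constant (poly r)"
  proof
    assume "constant (poly r)"
    then obtain c where "r = [:c:]" using constant_degree degree_eq_zeroE by metis
    then show False using r(1) assms cc_mult_eq_0 [of c p] by (auto simp: P_def)
  qed
  then obtain l where "poly r l = 0" using fundamental_theorem_of_algebra by blast
  then obtain q where q: "r = [:- l, 1:] * q" by (metis poly_eq_0_iff_dvd dvdE)
  have q0: "q \<noteq> 0" using q r(1) by (auto simp: P_def)
  have "degree q < degree r" unfolding q using q0 by (subst degree_mult_eq) auto
  then have nz: "poly_mat q y * p \<noteq> 0" using r(2) [of q] q0 by (auto simp: P_def)
  have "r = smult (- l) q + pCons 0 q" using q by simp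
  then have "poly_mat r y = cc (- l) * poly_mat q y + y * poly_mat q y"
    by (metis poly_mat_add poly_mat_pCons poly_mat_smult cc_hom(1) add_0)
  then have "cc (- l) * (poly_mat q y * p) + y * (poly_mat q y * p) = 0"
    using r(1) by (metis P_def distrib_right mult.assoc)
  then show ?thesis using that nz by (simp add: cc_minus add_eq_0_iff)
qed

lemma poly_mat_closed:
  assumes "comm_star_subalg C" "y \<in> C" shows "poly_mat p y \<in> C"
proof -
  have *: "cc c \<in> C" for c using assms(1) by (metis comm_star_subalg_def mult.right_neutral)
  show ?thesis
  proof (induction p)
    case 0 show ?case using * [of 0] by simp
  next
    case (pCons a p)
    then show ?case using assms * by (auto simp: comm_star_subalg_def)
  qed
qed

text \<open>Normality rewrites the square of the self-adjoint \<open>adj z * z\<close> as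
  \<open>adj z * adj z * (z * z)\<close>, and \<open>adj_mult_eq_0\<close> applies twice.\<close>

lemma normal_square_eq_0:
  fixes z :: "'n::finite cmat"
  assumes "adj z * z = z * adj z" "z * z = 0" shows "z = 0"
proof -
  have "adj (adj z * z) * (adj z * z) = adj z * (z * adj z) * z" by (simp add: adj_mult mult.assoc)
  also have "\<dots> = adj z * adj z * (z * z)" by (metis assms(1) mult.assoc)
  finally have "adj z * z = 0" using assms(2) adj_mult_eq_0 by auto
  then show ?thesis by (simp add: adj_mult_eq_0)
qed

section \<open>Partitions of 1 into orthogonal projections of a commutative algebra\<close>

definition partition_in :: "'n::finite cmat set \<Rightarrow> 'n cmat set \<Rightarrow> bool" where
  "partition_in C Q \<longleftrightarrow> finite Q \<and> Q \<subseteq> C \<and> 0 \<notin> Q \<and> (\<forall>q\<in>Q. is_proj q) \<and> \<Sum>Q = 1 \<and>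
     (\<forall>p\<in>Q. \<forall>q\<in>Q. p \<noteq> q \<longrightarrow> p * q = 0)"

text \<open>The defect \<open>y = e - e * adj e\<close> satisfies \<open>adj y * y = 0\<close>,
  because \<open>e\<close> and \<open>adj e\<close> are commuting idempotents. Hence
  \<open>e\<close> equals \<open>e * adj e\<close>, which is self-adjoint.\<close>

lemma comm_idempotent_is_proj:
  assumes C: "comm_star_subalg C" "e \<in> C" "e * e = e" shows "is_proj e"
proof -
  have comm: "adj e * e = e * adj e" using C by (auto simp: comm_star_subalg_def)
  have aa: "adj e * adj e = adj e" using C(3) by (metis adj_mult)
  define y where "y = e - e * adj e"
  have "adj y * y = adj e * e - adj e * e * adj e - e * adj e * e + e * adj e * (e * adj e)"
    by (simp add: y_def adj_diff adj_mult algebra_simps)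
  also have "\<dots> = 0"
  proof -
    have "adj e * e * adj e = e * adj e" "e * adj e * e = e * adj e"
      by (metis comm aa mult.assoc, metis comm C(3) mult.assoc)
    moreover from this have "e * adj e * (e * adj e) = e * adj e" by (metis aa mult.assoc)
    ultimately show ?thesis by (simp add: comm)
  qed
  finally have "y = 0" by (simp add: adj_mult_eq_0)
  then have "e = e * adj e" by (simp add: y_def)
  then have "adj e = e" by (metis adj_adj adj_mult)
  then show ?thesis using C(3) by (simp add: is_proj_def)
qed

text \<open>A non-minimal member \<open>p\<close> of a partition splits: if \<open>x p\<close> is not a multiple of \<open>p\<close>, an
  eigenvector \<open>z = q(x) p\<close> of multiplication by \<open>x\<close> is, up to a factor, an idempotent, because
  \<open>z\<^sup>2 = q(x) z\<close> is again a multiple of \<open>z\<close>.\<close>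

lemma partition_refine:
  fixes C :: "'n::finite cmat set"
  assumes C: "comm_star_subalg C" and Q: "partition_in C Q" and p: "p \<in> Q" "x \<in> C"
    and np: "\<nexists>c. x * p = cc c * p"
  obtains Q' where "partition_in C Q'" "card Q' > card Q"
proof -
  have Cc: "a + b \<in> C" "a * b \<in> C" "a * b = b * a" "adj a \<in> C" "cc c * a \<in> C" "1 \<in> C"
    if "a \<in> C" "b \<in> C" for a b c
    using C that by (auto simp: comm_star_subalg_def)
  have pC: "p \<in> C" and pp: "p * p = p" "is_proj p" "p \<noteq> 0" and fin: "finite Q"
    using Q p by (auto simp: partition_in_def is_proj_def)
  obtain l q where q: "poly_mat q x * p \<noteq> 0" "x * (poly_mat q x * p) = cc l * (poly_mat q x * p)"
    using eigen_element [OF pp(3)] .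
  define z where "z = poly_mat q x * p"
  have zC: "z \<in> C" using poly_mat_closed [OF C p(2)] Cc(2) pC by (simp add: z_def)
  have zp: "z * p = z" by (simp add: z_def mult.assoc pp)
  have z0: "z \<noteq> 0" and xz: "x * z = cc l * z" using q by (auto simp: z_def)
  define c where "c = poly q l"
  have "z * z = poly_mat q x * (p * z)" by (simp add: z_def mult.assoc)
  also have "p * z = z" using Cc(3)[OF pC zC] zp by simp
  also have "poly_mat q x * z = cc c * z" unfolding c_def by (rule poly_mat_eigen [OF xz])
  finally have zz: "z * z = cc c * z" .
  \<comment> \<open>As a member of a commutative *-algebra, z is normal, so its square is nonzero
    along with z.\<close>
  have c0: "c \<noteq> 0"
  proof
    assume "c = 0"
    then have "z * z = 0" by (simp add: zz)
    then show False using z0 normal_square_eq_0 [OF Cc(3)[OF Cc(4)[OF zC zC] zC]] by blast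
  qed
  define e where "e = cc (inverse c) * z"
  have eC: "e \<in> C" using Cc(5)[OF zC zC] by (simp add: e_def)
  have ee: "e * e = e"
  proof -
    have "e * e = cc (inverse c) * (cc (inverse c) * (z * z))"
      unfolding e_def by (metis cc_left_comm mult.assoc)
    then show ?thesis using c0 by (simp add: zz cc_cc_mult e_def)
  qed
  have ep: "e * p = e" by (simp add: e_def mult.assoc zp)
  have pe: "p * e = e" using ep Cc(3)[OF pC eC] by simp
  have e0: "e \<noteq> 0" using z0 c0 by (simp add: e_def cc_mult_eq_0)
  have xe: "x * e = cc l * e" by (metis e_def cc_left_comm xz cc_cc_mult mult.commute)
  have enp: "e \<noteq> p" using xe np by blast
  have prj: "is_proj e" using comm_idempotent_is_proj [OF C eC ee] .
  define f where "f = p - e"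
  have fC: "f \<in> C" using Cc(1)[OF pC Cc(5)[OF eC eC, of "-1"]] by (simp add: f_def cc_minus)
  have f: "is_proj f" "f \<noteq> 0" "f * p = f" "e * f = 0" "f * e = 0"
    using pp prj enp ep pe ee by (auto simp: f_def is_proj_def algebra_simps adj_diff)
  have pq: "p * q = 0" "q * p = 0" if "q \<in> Q - {p}" for q
    using Q p that by (auto simp: partition_in_def)
  have eq: "e * q = 0" "q * e = 0" "f * q = 0" "q * f = 0" if "q \<in> Q - {p}" for q
  proof -
    show "e * q = 0" using pq(1)[OF that] ep by (metis mult.assoc mult_zero_right)
    show "q * e = 0" using pq(2)[OF that] pe by (metis mult.assoc mult_zero_left)
    then show "f * q = 0" "q * f = 0" using \<open>e * q = 0\<close> pq[OF that] by (auto simp: f_def algebra_simps)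
  qed
  have nin: "e \<notin> Q - {p}" "f \<notin> Q - {p}" "e \<noteq> f"
    using eq ee e0 f by (metis, metis is_proj_def, metis)
  define Q' where "Q' = insert e (insert f (Q - {p}))"
  have "card Q' = card (Q - {p}) + 2" using nin fin by (simp add: Q'_def)
  moreover have "card Q = card (Q - {p}) + 1" using card.remove [OF fin p(1)] by simp
  ultimately have "card Q' > card Q" by simp
  moreover have "partition_in C Q'"
  proof -
    have "\<Sum>Q' = e + (f + \<Sum>(Q - {p}))" using nin fin by (simp add: Q'_def)
    also have "\<dots> = \<Sum>Q" using sum.remove [OF fin p(1), of "\<lambda>x. x"] by (simp add: f_def)
    finally have "\<Sum>Q' = 1" using Q by (simp add: partition_in_def)
    moreover have "\<forall>p\<in>Q'. \<forall>q\<in>Q'. p \<noteq> q \<longrightarrow> p * q = 0"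
      using eq f(4,5) Q by (auto simp: Q'_def partition_in_def)
    moreover have "Q' \<subseteq> C" "0 \<notin> Q'" "\<forall>q\<in>Q'. is_proj q" "finite Q'"
      using Q eC fC e0 f prj by (auto simp: Q'_def partition_in_def)
    ultimately show ?thesis by (simp add: partition_in_def)
  qed
  ultimately show ?thesis using that by blast
qed

text \<open>The members of \<open>Q\<close> are the minimal projections of \<open>C\<close>, and
  they span it: expand x as x times the sum of \<open>Q\<close>.\<close>

definition spectral_projs :: "'n::finite cmat set \<Rightarrow> 'n cmat set \<Rightarrow> bool" where
  "spectral_projs C Q \<longleftrightarrow> partition_in C Q \<and> (\<forall>x\<in>C. \<forall>q\<in>Q. \<exists>c. x * q = cc c * q)"

lemma partition_card_le: "partition_in C Q \<Longrightarrow> card Q \<le> DIM(complex^'n^'n)"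
  for Q :: "'n::finite cmat set"
  by (rule card_orth_proj_le) (auto simp: partition_in_def is_proj_def)

text \<open>A partition of greatest cardinality exists by the dimension bound, and
  \<open>partition_refine\<close> leaves no room for a non-scalar action on one of its
  members.\<close>

lemma spectral_projs_exist:
  fixes C :: "'n::finite cmat set"
  assumes C: "comm_star_subalg C" obtains Q where "spectral_projs C Q"
proof -
  have "1 \<in> C" using C unfolding comm_star_subalg_def by (elim conjE)
  then have "partition_in C {1}" by (simp add: partition_in_def is_proj_def)
  then have "\<exists>Q. partition_in C Q \<and> (\<forall>Q'. partition_in C Q' \<longrightarrow> card Q' \<le> card Q)"
  proof (rule Lattices_Big.ex_has_greatest_nat)
    show "\<forall>Q. partition_in C Q \<longrightarrow> card Q < Suc (DIM(complex^'n^'n))"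
      by (auto simp only: less_Suc_eq_le intro: partition_card_le)
  qed
  then obtain Q where Q: "partition_in C Q" "\<And>Q'. partition_in C Q' \<Longrightarrow> card Q' \<le> card Q"
    by blast
  have "\<exists>c. x * q = cc c * q" if "x \<in> C" "q \<in> Q" for x q
    using partition_refine [OF C Q(1) that(2,1)] Q(2) by (metis not_le)
  then have "spectral_projs C Q" using Q(1) by (simp add: spectral_projs_def)
  then show ?thesis using that by blast
qed

section \<open>Continuous fields of C*-norms on the matrix algebra\<close>

text \<open>A field of C*-algebras with fibres \<open>M\<^sub>n\<close> is represented, after choosing an isomorphism of each
  fibre with \<open>M\<^sub>n\<close> separately (with no continuity in the base point), by the norms \<open>nu t\<close> transported
  to \<open>M\<^sub>n\<close> and the set \<open>G\<close> of continuous sections, viewed as functions into \<open>M\<^sub>n\<close>. Values outside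
  \<open>X\<close> are irrelevant.\<close>

locale norm_field =
  fixes X :: "'v::euclidean_space set" and nu :: "'v \<Rightarrow> 'n::finite cmat \<Rightarrow> real"
  assumes compact_X: "compact X"
    and nu_nonneg: "t \<in> X \<Longrightarrow> 0 \<le> nu t x"
    and nu_eq_0: "t \<in> X \<Longrightarrow> nu t x = 0 \<longleftrightarrow> x = 0"
    and nu_triangle: "t \<in> X \<Longrightarrow> nu t (x + y) \<le> nu t x + nu t y"
    and nu_scale: "t \<in> X \<Longrightarrow> nu t (cc c * x) = cmod c * nu t x"
    and nu_mult: "t \<in> X \<Longrightarrow> nu t (x * y) \<le> nu t x * nu t y"
    and nu_cstar: "t \<in> X \<Longrightarrow> nu t (adj x * x) = (nu t x)\<^sup>2"
begin

lemma nu_0 [simp]: "t \<in> X \<Longrightarrow> nu t 0 = 0" by (simp add: nu_eq_0)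

lemma nu_minus [simp]: "t \<in> X \<Longrightarrow> nu t (- x) = nu t x"
  using nu_scale [of t "-1" x] by (simp add: cc_minus)

lemma nu_diff_comm: "t \<in> X \<Longrightarrow> nu t (x - y) = nu t (y - x)"
  using nu_minus [of t "x - y"] by simp

lemma nu_diff_triangle: "t \<in> X \<Longrightarrow> nu t (x - z) \<le> nu t (x - y) + nu t (y - z)"
  using nu_triangle [of t "x - y" "y - z"] by simp

lemma nu_diff_le: "t \<in> X \<Longrightarrow> nu t (x - y) \<le> nu t x + nu t y"
  using nu_triangle [of t x "- y"] by simp

lemma nu_abs_diff: "t \<in> X \<Longrightarrow> \<bar>nu t x - nu t y\<bar> \<le> nu t (x - y)"
  using nu_diff_triangle [of t x 0 y] nu_diff_triangle [of t y 0 x] nu_diff_comm [of t x y] by simp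

lemma nu_sum: "t \<in> X \<Longrightarrow> nu t (sum f A) \<le> (\<Sum>a\<in>A. nu t (f a))"
  by (induction A rule: infinite_finite_induct) (auto intro: order_trans [OF nu_triangle])

lemma nu_sum2:
  assumes "t \<in> X"
  shows "nu t (\<Sum>i\<in>A. \<Sum>j\<in>B. f i j) \<le> (\<Sum>i\<in>A. \<Sum>j\<in>B. nu t (f i j))"
  by (rule order_trans [OF nu_sum sum_mono]) (use assms nu_sum in auto)

lemma nu_adj: assumes t: "t \<in> X" shows "nu t (adj x) = nu t x"
proof -
  have le: "nu t y \<le> nu t (adj y)" for y
  proof (cases "y = 0")
    case False
    have "nu t y * nu t y \<le> nu t (adj y) * nu t y"
      using nu_cstar [OF t, of y] nu_mult [OF t, of "adj y" y] by (simp add: power2_eq_square)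
    moreover have "nu t y > 0" using False nu_nonneg [OF t, of y] nu_eq_0 [OF t, of y] by linarith
    ultimately show ?thesis by simp
  qed (use t in simp)
  show ?thesis using le [of x] le [of "adj x"] by simp
qed

lemma nu_proj: assumes t: "t \<in> X" and p: "is_proj p" "p \<noteq> 0" shows "nu t p = 1"
proof -
  have "nu t p = (nu t p)\<^sup>2" using nu_cstar [OF t, of p] p by (simp add: is_proj_def)
  moreover have "nu t p \<noteq> 0" using nu_eq_0 t p by blast
  ultimately show ?thesis by (simp add: power2_eq_square)
qed

lemma nu_one: "t \<in> X \<Longrightarrow> nu t 1 = 1"
  by (rule nu_proj) (auto simp: is_proj_def)

end

text \<open>A continuous field of C*-algebras in the manner of Dixmier. \<open>full\<close> provides
  sections through every point, and \<open>complete\<close> closes \<open>G\<close> under local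
  approximation, in the form that the error tends to 0 at t.\<close>

locale cfield = norm_field X nu
  for X :: "'v::euclidean_space set" and nu :: "'v \<Rightarrow> 'n::finite cmat \<Rightarrow> real" +
  fixes G :: "('v \<Rightarrow> 'n cmat) set"
  assumes G_add: "\<lbrakk>a \<in> G; b \<in> G\<rbrakk> \<Longrightarrow> (\<lambda>t. a t + b t) \<in> G"
    and G_scale: "a \<in> G \<Longrightarrow> (\<lambda>t. cc c * a t) \<in> G"
    and G_mult: "\<lbrakk>a \<in> G; b \<in> G\<rbrakk> \<Longrightarrow> (\<lambda>t. a t * b t) \<in> G"
    and G_adj: "a \<in> G \<Longrightarrow> (\<lambda>t. adj (a t)) \<in> G"
    and nu_cont: "a \<in> G \<Longrightarrow> continuous_on X (\<lambda>t. nu t (a t))"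
    and full: "t \<in> X \<Longrightarrow> \<exists>a\<in>G. a t = x"
    and complete: "(\<And>t. t \<in> X \<Longrightarrow> \<exists>a\<in>G. a t = s t \<and>
          ((\<lambda>u. nu u (s u - a u)) \<longlongrightarrow> 0) (at t within X)) \<Longrightarrow> s \<in> G"
begin

lemma G_zero: "X \<noteq> {} \<Longrightarrow> (\<lambda>t. 0) \<in> G"
  using full G_scale [of _ 0] by force

lemma G_minus: "a \<in> G \<Longrightarrow> (\<lambda>t. - a t) \<in> G"
  using G_scale [of a "-1"] by (simp add: cc_minus)

lemma G_diff: "\<lbrakk>a \<in> G; b \<in> G\<rbrakk> \<Longrightarrow> (\<lambda>t. a t - b t) \<in> G"
  using G_add [OF _ G_minus, of a b] by simp

lemma G_sum: "\<lbrakk>X \<noteq> {}; \<And>i. i \<in> I \<Longrightarrow> a i \<in> G\<rbrakk> \<Longrightarrow> (\<lambda>t. \<Sum>i\<in>I. a i t) \<in> G"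
  by (induction I rule: infinite_finite_induct) (auto intro: G_zero G_add)

lemma nu_tendsto: "\<lbrakk>a \<in> G; t \<in> X; K \<subseteq> X\<rbrakk> \<Longrightarrow> ((\<lambda>u. nu u (a u)) \<longlongrightarrow> nu t (a t)) (at t within K)"
  using nu_cont [of a] unfolding continuous_on_def by (blast intro: tendsto_within_subset)

lemma nu_tendsto_0: "\<lbrakk>a \<in> G; t \<in> X; a t = 0; K \<subseteq> X\<rbrakk> \<Longrightarrow> ((\<lambda>u. nu u (a u)) \<longlongrightarrow> 0) (at t within K)"
  using nu_tendsto [of a t K] by simp

lemma squeeze_0:
  assumes "((\<lambda>u. f u) \<longlongrightarrow> 0) (at t within K)" "\<And>u. u \<in> K \<Longrightarrow> g u \<le> f u" "\<And>u. u \<in> K \<Longrightarrow> (0::real) \<le> g u"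
  shows "(g \<longlongrightarrow> 0) (at t within K)"
  by (rule tendsto_sandwich [OF _ _ tendsto_const assms(1)])
    (use assms in \<open>auto simp: eventually_at_filter\<close>)

subsection \<open>Sections over subsets\<close>

text \<open>Relative continuity on a subset, tested against global sections with the same value at
  the point. By \<open>sec_approx\<close> any such test section gives the same answer.\<close>

definition sec :: "'v set \<Rightarrow> ('v \<Rightarrow> 'n cmat) \<Rightarrow> bool" where
  "sec K s \<longleftrightarrow> (\<forall>t\<in>K. \<exists>a\<in>G. a t = s t \<and> ((\<lambda>u. nu u (s u - a u)) \<longlongrightarrow> 0) (at t within K))"

lemma G_sec: assumes "a \<in> G" "K \<subseteq> X" shows "sec K a"
  unfolding sec_def
proof (intro ballI bexI conjI)
  show "((\<lambda>u. nu u (a u - a u)) \<longlongrightarrow> 0) (at t within K)" for t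
    by (rule squeeze_0 [OF tendsto_const]) (use assms in auto)
qed (use assms in auto)

lemma sec_G: "sec X s \<Longrightarrow> s \<in> G"
  unfolding sec_def by (rule complete) blast

lemma sec_mono: "\<lbrakk>sec K s; L \<subseteq> K\<rbrakk> \<Longrightarrow> sec L s"
  unfolding sec_def by (meson subsetD tendsto_within_subset)

lemma sec_cong: assumes "sec K s" "\<And>t. t \<in> K \<Longrightarrow> s t = s' t" shows "sec K s'"
  unfolding sec_def
proof
  fix t assume t: "t \<in> K"
  then obtain a where a: "a \<in> G" "a t = s t" "((\<lambda>u. nu u (s u - a u)) \<longlongrightarrow> 0) (at t within K)"
    using assms by (auto simp: sec_def)
  have "((\<lambda>u. nu u (s' u - a u)) \<longlongrightarrow> 0) (at t within K)"
    using a(3) by (rule Lim_transform_eventually) (simp add: eventually_at_filter assms(2))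
  then show "\<exists>a\<in>G. a t = s' t \<and> ((\<lambda>u. nu u (s' u - a u)) \<longlongrightarrow> 0) (at t within K)"
    using a assms(2) [OF t] by auto
qed

text \<open>Two global sections with the same value at t have a difference whose norm tends to 0
  there.\<close>

lemma sec_approx:
  assumes s: "sec K s" and K: "K \<subseteq> X" and t: "t \<in> K" and a: "a \<in> G" "a t = s t"
  shows "((\<lambda>u. nu u (s u - a u)) \<longlongrightarrow> 0) (at t within K)"
proof -
  obtain b where b: "b \<in> G" "b t = s t" "((\<lambda>u. nu u (s u - b u)) \<longlongrightarrow> 0) (at t within K)"
    using s t by (auto simp: sec_def)
  have "((\<lambda>u. nu u (b u - a u)) \<longlongrightarrow> 0) (at t within K)"
  proof (rule nu_tendsto_0 [OF G_diff [OF b(1) a(1)] _ _ K])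
    show "t \<in> X" using t K by blast
    show "b t - a t = 0" by (simp add: a(2) b(2))
  qed
  from tendsto_add [OF b(3) this]
  have "((\<lambda>u. nu u (s u - b u) + nu u (b u - a u)) \<longlongrightarrow> 0) (at t within K)" by simp
  then show ?thesis
    by (rule squeeze_0) (use K in \<open>blast intro: nu_diff_triangle nu_nonneg\<close>)+
qed

lemma secE:
  assumes "sec K s" "K \<subseteq> X" "t \<in> K"
  obtains a where "a \<in> G" "a t = s t" "((\<lambda>u. nu u (s u - a u)) \<longlongrightarrow> 0) (at t within K)"
  using assms by (auto simp: sec_def)

lemma sec_nu_tendsto:
  assumes "sec K s" "K \<subseteq> X" "t \<in> K"
  shows "((\<lambda>u. nu u (s u)) \<longlongrightarrow> nu t (s t)) (at t within K)"
proof -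
  obtain a where a: "a \<in> G" "a t = s t" "((\<lambda>u. nu u (s u - a u)) \<longlongrightarrow> 0) (at t within K)"
    using assms by (rule secE)
  have "((\<lambda>u. nu u (s u) - nu u (a u)) \<longlongrightarrow> 0) (at t within K)"
    unfolding tendsto_rabs_zero_iff [symmetric, of "\<lambda>u. nu u (s u) - nu u (a u)"]
    by (rule squeeze_0 [OF a(3)]) (use assms in \<open>auto intro: nu_abs_diff\<close>)
  from tendsto_add [OF this nu_tendsto [OF a(1), of t K]] show ?thesis using a assms by auto
qed

lemma sec_nu_cont: "\<lbrakk>sec K s; K \<subseteq> X\<rbrakk> \<Longrightarrow> continuous_on K (\<lambda>u. nu u (s u))"
  unfolding continuous_on_def using sec_nu_tendsto by blast

lemma sec_add: assumes "sec K s" "sec K s'" "K \<subseteq> X" shows "sec K (\<lambda>t. s t + s' t)"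
  unfolding sec_def
proof
  fix t assume t: "t \<in> K"
  obtain a where a: "a \<in> G" "a t = s t" "((\<lambda>u. nu u (s u - a u)) \<longlongrightarrow> 0) (at t within K)"
    using assms(1,3) t by (rule secE)
  obtain b where b: "b \<in> G" "b t = s' t" "((\<lambda>u. nu u (s' u - b u)) \<longlongrightarrow> 0) (at t within K)"
    using assms(2,3) t by (rule secE)
  have "((\<lambda>u. nu u (s u - a u) + nu u (s' u - b u)) \<longlongrightarrow> 0) (at t within K)"
    using tendsto_add [OF a(3) b(3)] by simp
  then have "((\<lambda>u. nu u ((s u + s' u) - (a u + b u))) \<longlongrightarrow> 0) (at t within K)"
  proof (rule squeeze_0)
    fix u assume "u \<in> K"
    then show "nu u (s u + s' u - (a u + b u)) \<le> nu u (s u - a u) + nu u (s' u - b u)"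
      using nu_triangle [of u "s u - a u" "s' u - b u"] assms(3) by (auto simp: algebra_simps)
  qed (use assms(3) in \<open>auto intro: nu_nonneg\<close>)
  with G_add [OF a(1) b(1)] a(2) b(2)
  show "\<exists>a\<in>G. a t = s t + s' t \<and> ((\<lambda>u. nu u (s u + s' u - a u)) \<longlongrightarrow> 0) (at t within K)"
    by (intro bexI [of _ "\<lambda>t. a t + b t"]) auto
qed

lemma sec_mult: assumes "sec K s" "sec K s'" "K \<subseteq> X" shows "sec K (\<lambda>t. s t * s' t)"
  unfolding sec_def
proof
  fix t assume t: "t \<in> K"
  obtain a where a: "a \<in> G" "a t = s t" "((\<lambda>u. nu u (s u - a u)) \<longlongrightarrow> 0) (at t within K)"
    using assms(1,3) t by (rule secE)
  obtain b where b: "b \<in> G" "b t = s' t" "((\<lambda>u. nu u (s' u - b u)) \<longlongrightarrow> 0) (at t within K)"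
    using assms(2,3) t by (rule secE)
  have "((\<lambda>u. nu u (s u - a u) * nu u (s' u) + nu u (a u) * nu u (s' u - b u)) \<longlongrightarrow>
      0 * nu t (s' t) + nu t (a t) * 0) (at t within K)"
    using assms t by (intro tendsto_intros a b sec_nu_tendsto nu_tendsto) auto
  then have "((\<lambda>u. nu u (s u * s' u - a u * b u)) \<longlongrightarrow> 0) (at t within K)"
    unfolding mult_zero_left mult_zero_right add_0
  proof (rule squeeze_0)
    fix u assume "u \<in> K"
    then have u: "u \<in> X" using assms by auto
    have "nu u (s u * s' u - a u * b u) = nu u ((s u - a u) * s' u + a u * (s' u - b u))"
      by (simp add: algebra_simps)
    also have "\<dots> \<le> nu u ((s u - a u) * s' u) + nu u (a u * (s' u - b u))" by (rule nu_triangle [OF u])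
    also have "\<dots> \<le> nu u (s u - a u) * nu u (s' u) + nu u (a u) * nu u (s' u - b u)"
      by (intro add_mono nu_mult u)
    finally show "nu u (s u * s' u - a u * b u) \<le> nu u (s u - a u) * nu u (s' u) + nu u (a u) * nu u (s' u - b u)" .
  qed (use assms(3) in \<open>auto intro: nu_nonneg\<close>)
  with G_mult [OF a(1) b(1)] a(2) b(2)
  show "\<exists>a\<in>G. a t = s t * s' t \<and> ((\<lambda>u. nu u (s u * s' u - a u)) \<longlongrightarrow> 0) (at t within K)"
    by (intro bexI [of _ "\<lambda>t. a t * b t"]) auto
qed

lemma sec_adj: assumes "sec K s" "K \<subseteq> X" shows "sec K (\<lambda>t. adj (s t))"
  unfolding sec_def
proof
  fix t assume t: "t \<in> K"
  obtain a where a: "a \<in> G" "a t = s t" "((\<lambda>u. nu u (s u - a u)) \<longlongrightarrow> 0) (at t within K)"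
    using assms t by (rule secE)
  have "((\<lambda>u. nu u (adj (s u) - adj (a u))) \<longlongrightarrow> 0) (at t within K)"
    by (rule squeeze_0 [OF a(3)]) (use assms in \<open>auto simp: nu_adj subset_iff nu_nonneg simp flip: adj_diff\<close>)
  with G_adj [OF a(1)] a(2)
  show "\<exists>a\<in>G. a t = adj (s t) \<and> ((\<lambda>u. nu u (adj (s u) - a u)) \<longlongrightarrow> 0) (at t within K)"
    by (intro bexI [of _ "\<lambda>t. adj (a t)"]) auto
qed

lemma sec_scale:
  assumes "sec K s" "K \<subseteq> X" "continuous_on K f" shows "sec K (\<lambda>t. cc (f t) * s t)"
  unfolding sec_def
proof
  fix t assume t: "t \<in> K"
  obtain a where a: "a \<in> G" "a t = s t" "((\<lambda>u. nu u (s u - a u)) \<longlongrightarrow> 0) (at t within K)"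
    using assms(1,2) t by (rule secE)
  have f: "(f \<longlongrightarrow> f t) (at t within K)" using assms(3) t by (simp add: continuous_on_def)
  have "((\<lambda>u. cmod (f u - f t) * nu u (s u) + cmod (f t) * nu u (s u - a u)) \<longlongrightarrow>
      cmod (f t - f t) * nu t (s t) + cmod (f t) * 0) (at t within K)"
    using assms t by (intro tendsto_intros a f sec_nu_tendsto) auto
  then have "((\<lambda>u. cmod (f u - f t) * nu u (s u) + cmod (f t) * nu u (s u - a u)) \<longlongrightarrow> 0) (at t within K)"
    by simp
  then have "((\<lambda>u. nu u (cc (f u) * s u - cc (f t) * a u)) \<longlongrightarrow> 0) (at t within K)"
  proof (rule squeeze_0)
    fix u assume "u \<in> K"
    then have u: "u \<in> X" using assms by auto
    have "nu u (cc (f u) * s u - cc (f t) * a u) = nu u (cc (f u - f t) * s u + cc (f t) * (s u - a u))"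
      by (simp add: cc_diff algebra_simps)
    also have "\<dots> \<le> nu u (cc (f u - f t) * s u) + nu u (cc (f t) * (s u - a u))" by (rule nu_triangle [OF u])
    finally show "nu u (cc (f u) * s u - cc (f t) * a u) \<le> cmod (f u - f t) * nu u (s u) + cmod (f t) * nu u (s u - a u)"
      by (simp add: nu_scale [OF u])
  qed (use assms(2) in \<open>auto intro: nu_nonneg\<close>)
  with G_scale [OF a(1), of "f t"] a(2)
  show "\<exists>a\<in>G. a t = cc (f t) * s t \<and> ((\<lambda>u. nu u (cc (f u) * s u - a u)) \<longlongrightarrow> 0) (at t within K)"
    by (intro bexI [of _ "\<lambda>u. cc (f t) * a u"]) auto
qed

lemma sec_minus: "\<lbrakk>sec K s; K \<subseteq> X\<rbrakk> \<Longrightarrow> sec K (\<lambda>t. - s t)"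
  using sec_scale [of K s "\<lambda>_. -1"] by (simp add: cc_minus)

lemma sec_diff: "\<lbrakk>sec K s; sec K s'; K \<subseteq> X\<rbrakk> \<Longrightarrow> sec K (\<lambda>t. s t - s' t)"
  using sec_add [of K s "\<lambda>t. - s' t"] sec_minus [of K s'] by simp

lemma sec_zero: "K \<subseteq> X \<Longrightarrow> sec K (\<lambda>t. 0)"
  by (cases "X = {}") (auto simp: sec_def [of "{}"] intro: G_sec G_zero)

lemma sec_sum: "\<lbrakk>\<And>i. i \<in> I \<Longrightarrow> sec K (s i); K \<subseteq> X\<rbrakk> \<Longrightarrow> sec K (\<lambda>t. \<Sum>i\<in>I. s i t)"
  by (induction I rule: infinite_finite_induct) (auto intro: sec_zero sec_add)

text \<open>Because \<open>e\<close> has norm 1, the modulus of f u - f t is the norm at u of a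
  section that vanishes at t.\<close>

lemma sec_coefficient_cont:
  assumes s: "sec K (\<lambda>t. cc (f t) * e t)" "sec K e" and K: "K \<subseteq> X" and e: "\<And>t. t \<in> K \<Longrightarrow> nu t (e t) = 1"
  shows "continuous_on K f"
  unfolding continuous_on_def
proof
  fix t assume t: "t \<in> K"
  have "sec K (\<lambda>u. cc (f u) * e u - cc (f t) * e u)"
    by (intro sec_diff s K sec_scale) auto
  from sec_nu_tendsto [OF this K t]
  have "((\<lambda>u. nu u (cc (f u - f t) * e u)) \<longlongrightarrow> 0) (at t within K)"
    using t K by (auto simp: cc_diff left_diff_distrib)
  then have "((\<lambda>u. cmod (f u - f t)) \<longlongrightarrow> 0) (at t within K)"
    by (rule Lim_transform_eventually)
      (use K in \<open>auto simp: eventually_at_filter nu_scale e subset_iff\<close>)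
  then show "(f \<longlongrightarrow> f t) (at t within K)"
    by (simp add: tendsto_norm_zero_iff LIM_zero_iff)
qed

lemma sec_local:
  assumes "\<And>t. t \<in> K \<Longrightarrow> \<exists>d>0. sec (K \<inter> ball t d) s" shows "sec K s"
  unfolding sec_def
proof
  fix t assume t: "t \<in> K"
  then obtain d where d: "d > 0" "sec (K \<inter> ball t d) s" using assms by blast
  then obtain a where a: "a \<in> G" "a t = s t" "((\<lambda>u. nu u (s u - a u)) \<longlongrightarrow> 0) (at t within (K \<inter> ball t d))"
    using t by (force simp: sec_def)
  have "at t within (K \<inter> ball t d) = at t within K"
    by (rule at_within_nhd [where S = "ball t d"]) (use d in auto)
  then show "\<exists>a\<in>G. a t = s t \<and> ((\<lambda>u. nu u (s u - a u)) \<longlongrightarrow> 0) (at t within K)" using a by auto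
qed

text \<open>The pasting lemma: at a point outside one of the closed sets the filter within that set
  is trivial.\<close>

lemma sec_glue_closed:
  assumes "sec K s" "sec L s" "closed K" "closed L" "K \<subseteq> X" "L \<subseteq> X"
  shows "sec (K \<union> L) s"
  unfolding sec_def
proof
  fix t assume t: "t \<in> K \<union> L"
  then obtain a where a: "a \<in> G" "a t = s t" using full assms by blast
  have *: "((\<lambda>u. nu u (s u - a u)) \<longlongrightarrow> 0) (at t within M)" if "sec M s" "closed M" "M \<subseteq> X" for M
  proof (cases "t \<in> M")
    case True then show ?thesis using sec_approx that a by blast
  next
    case False
    then have "at t within M = bot"
      using not_in_closure_trivial_limitI [of t M] that by (simp add: trivial_limit_def)
    then show ?thesis by simp
  qed
  have "((\<lambda>u. nu u (s u - a u)) \<longlongrightarrow> 0) (at t within (K \<union> L))"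
    unfolding at_within_union by (intro filterlim_sup *) (use assms in auto)
  then show "\<exists>a\<in>G. a t = s t \<and> ((\<lambda>u. nu u (s u - a u)) \<longlongrightarrow> 0) (at t within (K \<union> L))" using a by auto
qed

text \<open>\<open>B\<close> and \<open>E\<close> concern global sections only, so a local section
  is cut off to a global one that is unchanged on the ball of radius d/3.\<close>

lemma bump_extension:
  assumes s: "sec (X \<inter> ball t0 d) s" and d: "d > 0"
  obtains f g where "g \<in> G" "\<And>u. u \<in> X \<Longrightarrow> g u = cc (f u) * s u" "\<And>u. dist u t0 \<le> d/3 \<Longrightarrow> f u = 1"
    "\<And>u. u \<notin> ball t0 d \<Longrightarrow> f u = 0" "\<And>u. cmod (f u) \<le> 1"
proof -
  \<comment> \<open>A piecewise linear cutoff, 1 up to distance d/3 and 0 from 2d/3 on. The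
    remaining third gives every point outside the ball a neighbourhood on which the product
    vanishes.\<close>
  define f where "f = (\<lambda>u. complex_of_real (min 1 (max 0 (2 - 3 * dist u t0 / d))))"
  have f1: "f u = 1" if "dist u t0 \<le> d/3" for u
  proof -
    have "3 * dist u t0 / d \<le> 1" using that d by (simp add: field_simps)
    then show ?thesis by (simp add: f_def)
  qed
  have f0: "f u = 0" if "dist u t0 \<ge> 2*d/3" for u
  proof -
    have "3 * dist u t0 / d \<ge> 2" using that d by (simp add: field_simps)
    then show ?thesis by (simp add: f_def)
  qed
  have fc: "continuous_on A f" for A unfolding f_def by (intro continuous_intros) (use d in auto)
  have "sec X (\<lambda>u. cc (f u) * s u)"
  proof (rule sec_local)
    fix t assume t: "t \<in> X"
    show "\<exists>e>0. sec (X \<inter> ball t e) (\<lambda>u. cc (f u) * s u)"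
    proof (cases "dist t t0 < d")
      case True
      have sub: "X \<inter> ball t (d - dist t t0) \<subseteq> X \<inter> ball t0 d"
      proof
        fix u assume u: "u \<in> X \<inter> ball t (d - dist t t0)"
        then show "u \<in> X \<inter> ball t0 d" using dist_triangle [of t0 u t] by (auto simp: dist_commute)
      qed
      then have "sec (X \<inter> ball t (d - dist t t0)) (\<lambda>u. cc (f u) * s u)"
        by (intro sec_scale sec_mono [OF s] fc) auto
      then show ?thesis using True by (intro exI [of _ "d - dist t t0"]) auto
    next
      case False
      have "sec (X \<inter> ball t (d/3)) (\<lambda>u. cc (f u) * s u)"
      proof (rule sec_cong [OF sec_zero])
        fix u assume "u \<in> X \<inter> ball t (d/3)"
        then have "dist u t0 \<ge> 2*d/3" using dist_triangle [of t t0 u] False by auto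
        then show "0 = cc (f u) * s u" by (simp add: f0)
      qed auto
      then show ?thesis using d by (intro exI [of _ "d/3"]) auto
    qed
  qed
  then have "(\<lambda>u. cc (f u) * s u) \<in> G" by (rule sec_G)
  moreover have "f u = 0" if "u \<notin> ball t0 d" for u
    using that d by (intro f0) (auto simp: dist_commute)
  moreover have "cmod (f u) \<le> 1" for u by (simp add: f_def)
  ultimately show ?thesis using that f1 by blast
qed

subsection \<open>Local bases\<close>

text \<open>Being a basis is an open condition, with uniformly bounded coordinates. Otherwise unit
  coefficient vectors at points tending to t0 would give combinations of norm tending to 0; by
  compactness of the unit sphere a subsequence converges to a nonzero l, whose combination vanishes
  at t0, where it is \<open>Cmat l\<close>.\<close>

lemma local_basis:
  assumes t0: "t0 \<in> X" and a: "\<And>i j. a i j \<in> G" "\<And>i j. a i j t0 = unit_mat i j"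
  obtains M d where "M > 0" "d > 0" "\<And>u x. \<lbrakk>u \<in> X; dist u t0 < d\<rbrakk> \<Longrightarrow>
    \<exists>c. x = (\<Sum>i\<in>UNIV. \<Sum>j\<in>UNIV. cc (c i j) * a i j u) \<and> (\<forall>i j. cmod (c i j) \<le> M * nu u x)"
proof -
  have ne: "X \<noteq> {}" using t0 by auto
  define T where "T = (\<lambda>u (c::complex^'n^'n). \<Sum>i\<in>UNIV. \<Sum>j\<in>UNIV. cc (c$i$j) * a i j u)"
  have TG: "(\<lambda>u. T u c) \<in> G" for c
    unfolding T_def by (intro G_sum ne G_scale a)
  have T0: "T t0 c = Cmat c" for c
  proof -
    have "T t0 c = (\<Sum>i\<in>UNIV. \<Sum>j\<in>UNIV. cc (ent (Cmat c) i j) * unit_mat i j)"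
      by (simp add: T_def a ent_def)
    then show ?thesis using unit_mat_expand [of "Cmat c"] by simp
  qed
  have Tdiff: "T u (c - c') = T u c - T u c'" for u c c'
    by (simp add: T_def cc_diff left_diff_distrib sum_subtractf)
  have Tscale: "T u (r *\<^sub>R c) = cc (of_real r) * T u c" for u r c
    unfolding T_def sum_distrib_left
    by (intro sum.cong refl) (simp add: cc_cc_mult scaleR_conv_of_real [of r "_::complex"])
  have Tbound: "nu u (T u c) \<le> (\<Sum>i\<in>UNIV. \<Sum>j\<in>UNIV. norm c * nu u (a i j u))" if "u \<in> X" for u c
  proof -
    have "nu u (T u c) \<le> (\<Sum>i\<in>UNIV. \<Sum>j\<in>UNIV. nu u (cc (c$i$j) * a i j u))"
      unfolding T_def by (rule nu_sum2 [OF that])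
    also have "\<dots> \<le> (\<Sum>i\<in>UNIV. \<Sum>j\<in>UNIV. norm c * nu u (a i j u))"
      unfolding nu_scale [OF that]
      by (intro sum_mono mult_right_mono nu_nonneg that)
        (meson Finite_Cartesian_Product.norm_nth_le order_trans)
    finally show ?thesis .
  qed
  have "\<exists>m>0. \<exists>d>0. \<forall>u\<in>X. dist u t0 < d \<longrightarrow> (\<forall>c. m * norm c \<le> nu u (T u c))"
  proof (rule ccontr)
    assume neg: "\<not> ?thesis"
    have "\<exists>u c. u \<in> X \<and> dist u t0 < 1 / real (Suc k) \<and> norm c = 1 \<and> nu u (T u c) < 1 / real (Suc k)" for k
    proof -
      have "1 / real (Suc k) > 0" by simp
      then obtain u c where uc: "u \<in> X" "dist u t0 < 1 / real (Suc k)" "nu u (T u c) < 1 / real (Suc k) * norm c"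
        using neg by (metis not_le)
      have c0: "norm c > 0" using uc nu_nonneg [of u "T u c"] by (cases "c = 0") auto
      have "nu u (T u ((1 / norm c) *\<^sub>R c)) = nu u (T u c) / norm c"
        unfolding Tscale nu_scale [OF uc(1)] using c0 by (simp add: norm_divide)
      also have "\<dots> < 1 / real (Suc k)" using uc(3) c0 by (simp add: field_simps)
      finally show ?thesis using uc c0 by (intro exI [of _ u] exI [of _ "(1 / norm c) *\<^sub>R c"]) auto
    qed
    then obtain u c where uc: "\<And>k. u k \<in> X" "\<And>k. dist (u k) t0 < 1 / real (Suc k)" "\<And>k. norm (c k) = 1"
      "\<And>k. nu (u k) (T (u k) (c k)) < 1 / real (Suc k)" by metis
    have "compact (sphere (0::complex^'n^'n) 1)" by simp
    moreover have "\<forall>k. c k \<in> sphere 0 1" using uc by simp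
    ultimately obtain l r where lr: "l \<in> sphere 0 1" "strict_mono r" "(c \<circ> r) \<longlonglongrightarrow> l"
      unfolding compact_def by blast
    have inv0: "(\<lambda>k. 1 / real (Suc (r k))) \<longlonglongrightarrow> 0"
      using LIMSEQ_subseq_LIMSEQ [OF LIMSEQ_inverse_real_of_nat lr(2)]
      by (simp add: o_def inverse_eq_divide)
    have "(\<lambda>k. dist (u (r k)) t0) \<longlonglongrightarrow> 0"
    proof (rule tendsto_sandwich [OF _ _ tendsto_const inv0])
      show "\<forall>\<^sub>F k in sequentially. dist (u (r k)) t0 \<le> 1 / real (Suc (r k))"
        using less_imp_le [OF uc(2)] by (intro always_eventually allI)
    qed simp
    then have ur: "(\<lambda>k. u (r k)) \<longlonglongrightarrow> t0" by (rule tendsto_dist_iff [THEN iffD2])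
    have lim: "(\<lambda>k. nu (u (r k)) (b (u (r k)))) \<longlonglongrightarrow> nu t0 (b t0)" if "b \<in> G" for b
      using nu_cont [OF that] ur t0 uc(1) by (auto simp: continuous_on_sequentially o_def)
    have "(\<lambda>k. norm (l - c (r k)) ) \<longlonglongrightarrow> 0"
      using tendsto_norm_zero [OF LIM_zero [OF lr(3)]] by (simp add: o_def norm_minus_commute)
    then have "(\<lambda>k. (\<Sum>i\<in>UNIV. \<Sum>j\<in>UNIV. norm (l - c (r k)) * nu (u (r k)) (a i j (u (r k)))) + 1 / real (Suc (r k)))
       \<longlonglongrightarrow> (\<Sum>i\<in>UNIV. \<Sum>j\<in>UNIV. 0 * nu t0 (a i j t0)) + 0"
      by (intro tendsto_intros inv0 lim a)
    then have lim0: "(\<lambda>k. (\<Sum>i\<in>UNIV. \<Sum>j\<in>UNIV. norm (l - c (r k)) * nu (u (r k)) (a i j (u (r k)))) + 1 / real (Suc (r k))) \<longlonglongrightarrow> 0"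
      by simp
    have "(\<lambda>k. nu (u (r k)) (T (u (r k)) l)) \<longlonglongrightarrow> 0"
    proof (rule tendsto_sandwich [OF _ _ tendsto_const lim0])
      show "\<forall>\<^sub>F k in sequentially. 0 \<le> nu (u (r k)) (T (u (r k)) l)" by (simp add: uc(1) nu_nonneg)
      have "nu (u k) (T (u k) l) \<le> (\<Sum>i\<in>UNIV. \<Sum>j\<in>UNIV. norm (l - c k) * nu (u k) (a i j (u k))) + 1 / real (Suc k)" for k
        using nu_triangle [OF uc(1), of k "T (u k) (l - c k)" "T (u k) (c k)"] Tbound [OF uc(1), of k "l - c k"] uc(4) [of k]
        by (simp add: Tdiff)
      then show "\<forall>\<^sub>F k in sequentially. nu (u (r k)) (T (u (r k)) l) \<le>
         (\<Sum>i\<in>UNIV. \<Sum>j\<in>UNIV. norm (l - c (r k)) * nu (u (r k)) (a i j (u (r k)))) + 1 / real (Suc (r k))"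
        by simp
    qed
    then have "nu t0 (T t0 l) = 0" using lim [OF TG] LIMSEQ_unique by blast
    then have "Cmat l = 0" using nu_eq_0 [OF t0] T0 by simp
    then have "l = 0" by (metis Cmat_inverse UNIV_I rep_simps(1))
    then show False using lr(1) by simp
  qed
  then obtain m d where md: "m > 0" "d > 0" "\<And>u c. \<lbrakk>u \<in> X; dist u t0 < d\<rbrakk> \<Longrightarrow> m * norm c \<le> nu u (T u c)" by blast
  show ?thesis
  proof (rule that [of "1/m" d])
    fix u x assume u: "u \<in> X" "dist u t0 < d"
    define L where "L = (\<lambda>c. rep_cmat (T u c))"
    have Tadd: "T u (c + c') = T u c + T u c'" for c c'
      by (simp add: T_def cc_add distrib_right sum.distrib)
    have lin: "linear L"
    proof (rule linearI)
      show "L (c + c') = L c + L c'" for c c' by (simp add: L_def Tadd)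
      show "L (r *\<^sub>R c) = r *\<^sub>R L c" for r c
        unfolding L_def Tscale rep_cc_mult by (simp add: vec_eq_iff) (simp add: scaleR_conv_of_real)
    qed
    \<comment> \<open>The lower bound on norms excludes a kernel, and equality of dimensions then
      makes L onto.\<close>
    have "inj L"
    proof (rule linear_injective_0 [OF lin, THEN iffD2], intro allI impI)
      fix c assume "L c = 0"
      then have "T u c = 0" unfolding L_def by (metis cmat_eqI rep_simps(1))
      then have "m * norm c \<le> 0" using md(3) [OF u, of c] u by simp
      then show "c = 0" using md(1) by (simp add: mult_le_0_iff)
    qed
    then have "surj L" by (rule linear_injective_imp_surjective [OF lin]) simp
    then obtain c where "rep_cmat x = L c" by (metis surjD)
    then have c: "x = T u c" unfolding L_def by (simp add: cmat_eqI)
    have "cmod (c$i$j) \<le> 1/m * nu u x" for i j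
    proof -
      have "cmod (c$i$j) \<le> norm c" by (meson Finite_Cartesian_Product.norm_nth_le order_trans)
      then show ?thesis using md(3) [OF u, of c] md(1) c by (simp add: field_simps) (smt (verit) mult_left_mono)
    qed
    then show "\<exists>c. x = (\<Sum>i\<in>UNIV. \<Sum>j\<in>UNIV. cc (c i j) * a i j u) \<and> (\<forall>i j. cmod (c i j) \<le> 1/m * nu u x)"
      using c by (intro exI [of _ "\<lambda>i j. c$i$j"]) (auto simp: T_def)
  qed (use md in auto)
qed

text \<open>Let e be a global section with value 1 at t. Expanding 1 in a local basis writes 1 - e
  as a combination of the sections \<open>a i j - e * a i j\<close>, which vanish at t, with bounded
  coefficients.\<close>

lemma sec_one: assumes "K \<subseteq> X" shows "sec K (\<lambda>t. 1)"
proof (rule sec_mono [OF _ assms], unfold sec_def, intro ballI)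
  fix t assume t: "t \<in> X"
  obtain e where e: "e \<in> G" "e t = 1" using full [OF t] by blast
  have "\<forall>i j. \<exists>a\<in>G. a t = unit_mat i j" using full [OF t] by blast
  then obtain a where a: "\<And>i j. a i j \<in> G" "\<And>i j. a i j t = unit_mat i j" by metis
  obtain M d where M: "M > 0" "d > 0" "\<And>u x. \<lbrakk>u \<in> X; dist u t < d\<rbrakk> \<Longrightarrow>
    \<exists>c. x = (\<Sum>i\<in>UNIV. \<Sum>j\<in>UNIV. cc (c i j) * a i j u) \<and> (\<forall>i j. cmod (c i j) \<le> M * nu u x)"
    by (rule local_basis [OF t a]) blast
  have "((\<lambda>u. nu u (a i j u - e u * a i j u)) \<longlongrightarrow> 0) (at t within X)" for i j
    by (rule nu_tendsto_0 [OF G_diff [OF a(1) G_mult [OF e(1) a(1)]]]) (use t e in auto)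
  then have "((\<lambda>u. \<Sum>i\<in>UNIV. \<Sum>j\<in>UNIV. M * nu u (a i j u - e u * a i j u)) \<longlongrightarrow>
      (\<Sum>(i::'n)\<in>UNIV. \<Sum>(j::'n)\<in>UNIV. M * 0)) (at t within X)"
    by (intro tendsto_intros)
  then have lim: "((\<lambda>u. \<Sum>i\<in>UNIV. \<Sum>j\<in>UNIV. M * nu u (a i j u - e u * a i j u)) \<longlongrightarrow> 0) (at t within X)"
    by simp
  have bd: "nu u (1 - e u) \<le> (\<Sum>i\<in>UNIV. \<Sum>j\<in>UNIV. M * nu u (a i j u - e u * a i j u))"
    if u: "u \<in> X" "dist u t < d" for u
  proof -
    obtain c where c: "1 = (\<Sum>i\<in>UNIV. \<Sum>j\<in>UNIV. cc (c i j) * a i j u)" "\<And>i j. cmod (c i j) \<le> M"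
      using M(3) [OF u, of 1] nu_one [OF u(1)] by auto
    have "1 - e u = (1 - e u) * (\<Sum>i\<in>UNIV. \<Sum>j\<in>UNIV. cc (c i j) * a i j u)" by (simp flip: c(1))
    also have "\<dots> = (\<Sum>i\<in>UNIV. \<Sum>j\<in>UNIV. cc (c i j) * (a i j u - e u * a i j u))"
      unfolding sum_distrib_left
      by (intro sum.cong refl) (subst cc_left_comm, simp add: left_diff_distrib)
    finally have eq: "1 - e u = (\<Sum>i\<in>UNIV. \<Sum>j\<in>UNIV. cc (c i j) * (a i j u - e u * a i j u))" .
    have "nu u (1 - e u) \<le> (\<Sum>i\<in>UNIV. \<Sum>j\<in>UNIV. nu u (cc (c i j) * (a i j u - e u * a i j u)))"
      unfolding eq by (rule nu_sum2 [OF u(1)])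
    also have "\<dots> \<le> (\<Sum>i\<in>UNIV. \<Sum>j\<in>UNIV. M * nu u (a i j u - e u * a i j u))"
      unfolding nu_scale [OF u(1)] by (intro sum_mono mult_right_mono nu_nonneg u c)
    finally show ?thesis .
  qed
  have "((\<lambda>u. nu u (1 - e u)) \<longlongrightarrow> 0) (at t within X)"
    by (rule tendsto_sandwich [OF _ _ tendsto_const lim])
      (use M(2) bd in \<open>auto simp: eventually_at nu_nonneg intro!: exI [of _ d]\<close>)
  then show "\<exists>a\<in>G. a t = 1 \<and> ((\<lambda>u. nu u (1 - a u)) \<longlongrightarrow> 0) (at t within X)" using e by blast
qed

lemma G_one: "(\<lambda>t. 1) \<in> G" by (rule sec_G [OF sec_one]) simp

lemma G_scalar: "\<lbrakk>continuous_on X f; a \<in> G\<rbrakk> \<Longrightarrow> (\<lambda>t. cc (f t) * a t) \<in> G"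
  by (rule sec_G [OF sec_scale [OF G_sec]]) auto

end

section \<open>Cartan subalgebras of a continuous field\<close>

text \<open>\<open>B_max\<close> states that \<open>B\<close> contains its commutant in
  \<open>G\<close>, self-adjoint elements or not; the closure of \<open>B\<close> under sums,
  products and continuous scalars is derived from it. Equations are asked for on \<open>X\<close>
  only, because values elsewhere are arbitrary.\<close>

locale cartan_field = cfield X nu G
  for X :: "'v::euclidean_space set" and nu :: "'v \<Rightarrow> 'n::finite cmat \<Rightarrow> real" and G +
  fixes B :: "('v \<Rightarrow> 'n cmat) set" and E :: "('v \<Rightarrow> 'n cmat) \<Rightarrow> 'v \<Rightarrow> 'n cmat"
  assumes B_G: "b \<in> B \<Longrightarrow> b \<in> G"
    and B_comm: "\<lbrakk>b \<in> B; b' \<in> B; t \<in> X\<rbrakk> \<Longrightarrow> b t * b' t = b' t * b t"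
    and B_adj: "b \<in> B \<Longrightarrow> (\<lambda>t. adj (b t)) \<in> B"
    and B_max: "\<lbrakk>c \<in> G; \<And>b t. \<lbrakk>b \<in> B; t \<in> X\<rbrakk> \<Longrightarrow> c t * b t = b t * c t\<rbrakk> \<Longrightarrow> c \<in> B"
    and E_B: "a \<in> G \<Longrightarrow> E a \<in> B"
    and E_id: "\<lbrakk>b \<in> B; t \<in> X\<rbrakk> \<Longrightarrow> E b t = b t"
    and E_add: "\<lbrakk>a \<in> G; a' \<in> G; t \<in> X\<rbrakk> \<Longrightarrow> E (\<lambda>t. a t + a' t) t = E a t + E a' t"
    and E_scale: "\<lbrakk>a \<in> G; t \<in> X\<rbrakk> \<Longrightarrow> E (\<lambda>t. cc z * a t) t = cc z * E a t"
    and E_mod: "\<lbrakk>b \<in> B; a \<in> G; t \<in> X\<rbrakk> \<Longrightarrow> E (\<lambda>t. b t * a t) t = b t * E a t"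
    and E_contr: "\<lbrakk>a \<in> G; \<And>t. t \<in> X \<Longrightarrow> nu t (a t) \<le> k; t \<in> X\<rbrakk> \<Longrightarrow> nu t (E a t) \<le> k"
begin

lemma B_add: assumes "b \<in> B" "b' \<in> B" shows "(\<lambda>t. b t + b' t) \<in> B"
proof (rule B_max [OF G_add [OF assms [THEN B_G]]])
  fix c t assume "c \<in> B" "t \<in> X"
  then have "b t * c t = c t * b t" "b' t * c t = c t * b' t" using assms B_comm by blast+
  then show "(b t + b' t) * c t = c t * (b t + b' t)" by (simp only: distrib_left distrib_right)
qed

lemma B_mult: assumes "b \<in> B" "b' \<in> B" shows "(\<lambda>t. b t * b' t) \<in> B"
proof (rule B_max [OF G_mult [OF assms [THEN B_G]]])
  fix c t assume "c \<in> B" "t \<in> X"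
  then have *: "b t * c t = c t * b t" "b' t * c t = c t * b' t" using assms B_comm by blast+
  show "b t * b' t * c t = c t * (b t * b' t)" by (metis * mult.assoc)
qed

lemma B_scalar: assumes "continuous_on X f" "b \<in> B" shows "(\<lambda>t. cc (f t) * b t) \<in> B"
proof (rule B_max [OF G_scalar [OF assms(1) B_G [OF assms(2)]]])
  fix c t assume "c \<in> B" "t \<in> X"
  then have *: "b t * c t = c t * b t" using assms B_comm by blast
  show "cc (f t) * b t * c t = c t * (cc (f t) * b t)" by (metis * cc_left_comm mult.assoc)
qed

lemma B_scale: "b \<in> B \<Longrightarrow> (\<lambda>t. cc c * b t) \<in> B"
  by (rule B_scalar [OF continuous_on_const])

lemma B_one: "(\<lambda>t. 1) \<in> B"
  by (rule B_max [OF G_one]) auto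

lemma G_near:
  assumes a: "a \<in> G" and t: "t \<in> X" and less: "nu t (a t) < k"
  obtains d where "d > 0" "\<And>u. \<lbrakk>u \<in> X; dist u t < d\<rbrakk> \<Longrightarrow> nu u (a u) < k"
proof -
  have "((\<lambda>u. nu u (a u)) \<longlongrightarrow> nu t (a t)) (at t within X)" by (rule nu_tendsto) (use a t in auto)
  then have "\<forall>\<^sub>F u in at t within X. nu u (a u) < k" using less by (rule order_tendstoD)
  then obtain d where d: "d > 0" "\<And>u. \<lbrakk>u \<in> X; u \<noteq> t; dist u t < d\<rbrakk> \<Longrightarrow> nu u (a u) < k"
    unfolding eventually_at by blast
  show ?thesis
  proof (rule that [OF d(1)])
    fix u assume "u \<in> X" "dist u t < d"
    then show "nu u (a u) < k" using d(2) [of u] less by (cases "u = t") auto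
  qed
qed

definition Bt :: "'v \<Rightarrow> 'n cmat set" where "Bt t = {b t |b. b \<in> B}"

lemma Bt_I: "b \<in> B \<Longrightarrow> b t \<in> Bt t" by (auto simp: Bt_def)

lemma Bt_comm: "\<lbrakk>t \<in> X; x \<in> Bt t; y \<in> Bt t\<rbrakk> \<Longrightarrow> x * y = y * x"
  unfolding Bt_def using B_comm by blast

lemma Bt_alg: assumes t: "t \<in> X" shows "comm_star_subalg (Bt t)"
  unfolding comm_star_subalg_def
proof (intro conjI ballI allI)
  show "1 \<in> Bt t" using Bt_I [OF B_one] .
  fix x assume "x \<in> Bt t"
  then obtain b where b: "b \<in> B" "x = b t" by (auto simp: Bt_def)
  show "adj x \<in> Bt t" using Bt_I [OF B_adj [OF b(1)]] b(2) by simp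
  show "cc c * x \<in> Bt t" for c using Bt_I [OF B_scale [OF b(1)]] b(2) by simp
  fix y assume y: "y \<in> Bt t"
  then obtain b' where b': "b' \<in> B" "y = b' t" by (auto simp: Bt_def)
  show "x + y \<in> Bt t" "x * y \<in> Bt t" using Bt_I [OF B_add [OF b(1) b'(1)]] Bt_I [OF B_mult [OF b(1) b'(1)]] b(2) b'(2) by simp_all
  show "x * y = y * x" using b b' B_comm t by simp
qed

lemma Bt_add: "\<lbrakk>t \<in> X; x \<in> Bt t; y \<in> Bt t\<rbrakk> \<Longrightarrow> x + y \<in> Bt t"
  and Bt_scale: "\<lbrakk>t \<in> X; x \<in> Bt t\<rbrakk> \<Longrightarrow> cc c * x \<in> Bt t"
  using Bt_alg [of t] unfolding comm_star_subalg_def by blast+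

lemma Bt_sum: "\<lbrakk>t \<in> X; \<And>i. i \<in> I \<Longrightarrow> x i \<in> Bt t\<rbrakk> \<Longrightarrow> sum x I \<in> Bt t"
proof (induction I rule: infinite_finite_induct)
  case empty
  then show ?case using Bt_scale [OF _ Bt_I [OF B_one], of t 0] by simp
next
  case (infinite A)
  then show ?case using Bt_scale [OF _ Bt_I [OF B_one], of t 0] by simp
qed (simp add: Bt_add)

lemma E_zero: assumes "t \<in> X" shows "E (\<lambda>t. 0) t = 0"
  using E_scale [OF G_one assms, of 0] by simp

lemma E_diff:
  assumes "a \<in> G" "a' \<in> G" "t \<in> X" shows "E (\<lambda>t. a t - a' t) t = E a t - E a' t"
  using E_add [OF assms(1) G_scale [OF assms(2), of "-1"] assms(3)] E_scale [OF assms(2,3), of "-1"]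
  by (simp add: cc_minus)

lemma E_sum: "\<lbrakk>t \<in> X; \<And>i. i \<in> I \<Longrightarrow> a i \<in> G\<rbrakk> \<Longrightarrow> E (\<lambda>t. \<Sum>i\<in>I. a i t) t = (\<Sum>i\<in>I. E (a i) t)"
proof (induction I rule: infinite_finite_induct)
  case (insert i I)
  have "(\<lambda>t. \<Sum>i\<in>I. a i t) \<in> G" by (rule G_sum) (use insert in auto)
  then show ?case using insert by (simp add: E_add)
qed (simp_all add: E_zero)

text \<open>\<open>E\<close> is \<open>C(X)\<close>-linear, hence acts fibrewise.\<close>

lemma E_local:
  assumes a: "a \<in> G" and t0: "t0 \<in> X" "a t0 = 0" shows "E a t0 = 0"
proof -
  have "nu t0 (E a t0) \<le> \<epsilon>" if "\<epsilon> > 0" for \<epsilon>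
  proof -
    have "nu t0 (a t0) < \<epsilon>" using that t0 by simp
    then obtain d where d: "d > 0" "\<And>u. \<lbrakk>u \<in> X; dist u t0 < d\<rbrakk> \<Longrightarrow> nu u (a u) < \<epsilon>"
      by (rule G_near [OF a t0(1)]) blast
    have le: "nu u (a u) \<le> \<epsilon>" if "u \<in> X" "u \<in> ball t0 d" for u
      using d(2) [of u] that by (simp add: dist_commute)
    \<comment> \<open>The cutoff g is a scalar function on X, hence belongs to \<open>B\<close>.
      Replacing a by g a does not change \<open>E a\<close> at t0 and brings the norm below
      \<epsilon> on all of X.\<close>
    obtain f g where g: "g \<in> G" "\<And>u. u \<in> X \<Longrightarrow> g u = cc (f u) * 1" and f: "\<And>u. dist u t0 \<le> d/3 \<Longrightarrow> f u = 1"
      "\<And>u. u \<notin> ball t0 d \<Longrightarrow> f u = 0" "\<And>u. cmod (f u) \<le> 1"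
      by (rule bump_extension [OF sec_one [OF Int_lower1] d(1)]) blast
    have gB: "g \<in> B" by (rule B_max [OF g(1)]) (simp add: g(2) cc_comm)
    have "g t0 = 1" using g(2) [OF t0(1)] f(1) [of t0] d(1) by simp
    then have "E a t0 = E (\<lambda>t. g t * a t) t0" using E_mod [OF gB a t0(1)] by simp
    also have "nu t0 \<dots> \<le> \<epsilon>"
    proof (rule E_contr [OF G_mult [OF g(1) a] _ t0(1)])
      fix u assume u: "u \<in> X"
      have eq: "nu u (g u * a u) = cmod (f u) * nu u (a u)" using g(2) [OF u] by (simp add: nu_scale [OF u])
      show "nu u (g u * a u) \<le> \<epsilon>"
      proof (cases "u \<in> ball t0 d")
        case True
        have "cmod (f u) * nu u (a u) \<le> 1 * \<epsilon>"
          by (rule mult_mono [OF f(3) le [OF u True] zero_le_one nu_nonneg [OF u]])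
        then show ?thesis using eq by simp
      next
        case False
        then show ?thesis using eq f(2) [OF False] \<open>\<epsilon> > 0\<close> by simp
      qed
    qed
    finally show ?thesis .
  qed
  from this [of "nu t0 (E a t0) / 2"] have "nu t0 (E a t0) \<le> 0" by linarith
  then have "nu t0 (E a t0) = 0" using nu_nonneg [OF t0(1), of "E a t0"] by (rule antisym)
  then show ?thesis using nu_eq_0 [OF t0(1)] by blast
qed

subsection \<open>Lifting projections\<close>

text \<open>The factor 2 comes from the rounding of a single eigenvalue, the dimension from the
  bound on the number of spectral projections.\<close>

definition NN :: real where "NN = 2 * real DIM(complex^'n^'n)"

text \<open>Round the eigenvalues of x to 0 or 1. For an eigenvalue c the product of |c| and |c - 1|
  is at most the norm of \<open>x * x - x\<close>, and one of the two factors is at least 1/2, so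
  the other one is small.\<close>

lemma near_proj:
  assumes t: "t \<in> X" and x: "x \<in> Bt t"
  shows "\<exists>r\<in>Bt t. is_proj r \<and> nu t (x - r) \<le> NN * nu t (x * x - x)"
proof -
  obtain Q where Q: "spectral_projs (Bt t) Q" using spectral_projs_exist [OF Bt_alg [OF t]] .
  have fin: "finite Q" and QB: "Q \<subseteq> Bt t" and Q0: "0 \<notin> Q" and sum1: "\<Sum>Q = 1"
    and prj: "\<And>q. q \<in> Q \<Longrightarrow> is_proj q" and orth: "\<And>p q. \<lbrakk>p \<in> Q; q \<in> Q; p \<noteq> q\<rbrakk> \<Longrightarrow> p * q = 0"
    using Q unfolding spectral_projs_def partition_in_def by auto
  have "\<forall>q\<in>Q. \<exists>c. x * q = cc c * q" using Q x unfolding spectral_projs_def by blast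
  then obtain c where c: "\<And>q. q \<in> Q \<Longrightarrow> x * q = cc (c q) * q" by metis
  \<comment> \<open>Eigenvalues may be complex here; the real part decides which of 0 and 1 is
    certainly at distance at least 1/2, and the other one is taken.\<close>
  define d where "d = (\<lambda>q. if Re (c q) > 1/2 then 1 else (0::complex))"
  define r where "r = (\<Sum>q\<in>Q. cc (d q) * q)"
  define \<delta> where "\<delta> = nu t (x * x - x)"
  have n1: "nu t q = 1" if "q \<in> Q" for q by (rule nu_proj [OF t prj]) (use that Q0 in auto)
  have cd: "cmod (c q - d q) \<le> 2 * \<delta>" if q: "q \<in> Q" for q
  proof -
    have "x * x * q = cc (c q * c q) * q" by (metis c [OF q] cc_cc_mult cc_left_comm mult.assoc)
    then have "(x * x - x) * q = cc (c q * c q - c q) * q"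
      by (simp add: left_diff_distrib cc_diff c [OF q])
    then have "cmod (c q * c q - c q) * nu t q \<le> \<delta> * nu t q"
      using nu_mult [OF t, of "x * x - x" q] nu_scale [OF t, of "c q * c q - c q" q] by (simp add: \<delta>_def)
    then have le: "cmod (c q) * cmod (c q - 1) \<le> \<delta>"
      using n1 [OF q] by (simp add: norm_mult [symmetric] right_diff_distrib)
    show ?thesis
    proof (cases "Re (c q) > 1/2")
      case True
      then have "1/2 \<le> cmod (c q)" using complex_Re_le_cmod [of "c q"] by linarith
      then have "1/2 * cmod (c q - 1) \<le> cmod (c q) * cmod (c q - 1)" by (rule mult_right_mono) simp
      then show ?thesis using le True by (simp add: d_def)
    next
      case False
      then have "1/2 \<le> cmod (c q - 1)" using complex_Re_le_cmod [of "1 - c q"] by (simp add: norm_minus_commute)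
      then have "cmod (c q) * (1/2) \<le> cmod (c q) * cmod (c q - 1)" by (rule mult_left_mono) simp
      then show ?thesis using le False by (simp add: d_def)
    qed
  qed
  have xr: "x - r = (\<Sum>q\<in>Q. cc (c q - d q) * q)"
  proof -
    have "x = x * \<Sum>Q" using sum1 by simp
    also have "\<dots> = (\<Sum>q\<in>Q. cc (c q) * q)" unfolding sum_distrib_left by (rule sum.cong) (auto simp: c)
    finally show ?thesis by (simp add: r_def cc_diff left_diff_distrib sum_subtractf)
  qed
  have \<delta>0: "\<delta> \<ge> 0" using nu_nonneg t by (simp add: \<delta>_def)
  have "nu t (x - r) \<le> (\<Sum>q\<in>Q. nu t (cc (c q - d q) * q))" unfolding xr by (rule nu_sum [OF t])
  also have "\<dots> \<le> (\<Sum>q\<in>Q. 2 * \<delta>)"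
    by (rule sum_mono) (use cd n1 in \<open>simp add: nu_scale [OF t]\<close>)
  also have "\<dots> = real (card Q) * (2 * \<delta>)" by simp
  also have "\<dots> \<le> real DIM(complex^'n^'n) * (2 * \<delta>)"
  proof (rule mult_right_mono)
    have "card Q \<le> DIM(complex^'n^'n)" using Q partition_card_le unfolding spectral_projs_def by blast
    then show "real (card Q) \<le> real DIM(complex^'n^'n)" by (rule of_nat_mono)
  qed (use \<delta>0 in simp)
  finally have "nu t (x - r) \<le> NN * nu t (x * x - x)" by (simp add: NN_def \<delta>_def)
  moreover have "r \<in> Bt t" unfolding r_def by (intro Bt_sum t Bt_scale) (use QB in auto)
  moreover have "is_proj r"
  proof -
    have rq: "r * q = cc (d q) * q" if q: "q \<in> Q" for q
    proof -
      have "r * q = (\<Sum>p\<in>Q. if p = q then cc (d q) * q else 0)"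
        unfolding r_def sum_distrib_right
        by (rule sum.cong) (use orth q prj in \<open>auto simp: mult.assoc is_proj_def\<close>)
      then show ?thesis using fin q by simp
    qed
    have "r * r = r * (\<Sum>q\<in>Q. cc (d q) * q)" by (simp only: r_def)
    also have "\<dots> = (\<Sum>q\<in>Q. r * (cc (d q) * q))" by (simp only: sum_distrib_left)
    also have "\<dots> = (\<Sum>q\<in>Q. cc (d q) * q)"
    proof (rule sum.cong [OF refl])
      fix q assume "q \<in> Q"
      then have "r * (cc (d q) * q) = cc (d q) * (cc (d q) * q)" by (subst cc_left_comm) (simp only: rq)
      then show "r * (cc (d q) * q) = cc (d q) * q" by (simp add: d_def)
    qed
    finally have "r * r = r" by (simp only: r_def)
    moreover have "adj r = r"
      unfolding r_def adj_sum by (rule sum.cong [OF refl]) (use prj in \<open>auto simp: adj_mult d_def is_proj_def\<close>)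
    ultimately show ?thesis by (simp add: is_proj_def)
  qed
  ultimately show ?thesis by blast
qed

text \<open>For e = p - p q one has (p - q) e = e, so a distance below 1 forces e = 0; the same
  holds with p and q exchanged.\<close>

lemma proj_close_eq:
  assumes t: "t \<in> X" and p: "is_proj p" and q: "is_proj q" and c: "p * q = q * p" and "nu t (p - q) < 1"
  shows "p = q"
proof -
  have *: "p = p * q" if p: "is_proj p" and q: "is_proj q" and c: "p * q = q * p" and l: "nu t (p - q) < 1" for p q
  proof -
    define e where "e = p - p * q"
    have pq: "p * (p * q) = p * q" using p by (metis is_proj_def mult.assoc)
    have qq: "q * (p * q) = p * q" using q c by (metis is_proj_def mult.assoc)
    have pp: "p * p = p" using p by (simp add: is_proj_def)
    have "(p - q) * e = e" unfolding e_def by (simp add: algebra_simps pq qq pp flip: c)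
    then have "nu t e \<le> nu t (p - q) * nu t e" using nu_mult [OF t, of "p - q" e] by simp
    then have "(1 - nu t (p - q)) * nu t e \<le> 0" by (simp add: algebra_simps)
    then have "nu t e \<le> 0" using l by (simp add: mult_le_0_iff)
    then have "e = 0" using nu_nonneg [OF t, of e] nu_eq_0 [OF t] by simp
    then show ?thesis by (simp add: e_def)
  qed
  have "p = p * q" by (rule *) (use assms in auto)
  moreover have "q = q * p" by (rule *) (use assms nu_diff_comm [OF t] in auto)
  ultimately show ?thesis using c by simp
qed

text \<open>The rounding \<open>rd\<close> is an arbitrary pointwise choice, yet continuous. Near t1
  compare b with an element c of \<open>B\<close> that takes the rounded value at t1: the roundings
  of b and c are close commuting projections, hence equal, and the rounding error of c tends to 0 at
  t1.\<close>

lemma lift_proj: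
  assumes t0: "t0 \<in> X" and b: "b \<in> B" and p: "is_proj (b t0)"
  obtains d r where "d > 0" "sec (X \<inter> ball t0 d) r" "r t0 = b t0"
    "\<And>u. u \<in> X \<inter> ball t0 d \<Longrightarrow> is_proj (r u) \<and> r u \<in> Bt u"
proof -
  \<comment> \<open>The rounding error allowed by \<open>near_proj\<close>. It is kept below 1/4, so
    that two such errors and the distance from b to c add up to less than 1.\<close>
  define D where "D = (\<lambda>c u. NN * nu u (c u * c u - c u))"
  have dG: "(\<lambda>u. c u * c u - c u) \<in> G" if "c \<in> B" for c by (intro G_diff G_mult B_G that)
  have D_near: "\<exists>d>0. \<forall>u\<in>X. dist u t < d \<longrightarrow> D c u < 1/4" if "c \<in> B" "t \<in> X" "D c t < 1/4" for c t
  proof -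
    have "continuous_on X (\<lambda>u. D c u)" unfolding D_def by (intro continuous_intros nu_cont dG that)
    then have "(D c \<longlongrightarrow> D c t) (at t within X)" using that(2) by (simp add: continuous_on_def)
    then have "\<forall>\<^sub>F u in at t within X. D c u < 1/4" using that(3) by (rule order_tendstoD)
    then obtain d where "d > 0" "\<forall>u\<in>X. u \<noteq> t \<and> dist u t < d \<longrightarrow> D c u < 1/4"
      unfolding eventually_at by blast
    then show ?thesis using that(3) by (metis)
  qed
  define rd where "rd = (\<lambda>c u. SOME r. r \<in> Bt u \<and> is_proj r \<and> nu u (c u - r) \<le> D c u)"
  have rd: "rd c u \<in> Bt u" "is_proj (rd c u)" "nu u (c u - rd c u) \<le> D c u" if "c \<in> B" "u \<in> X" for c u
  proof -
    have "\<exists>r. r \<in> Bt u \<and> is_proj r \<and> nu u (c u - r) \<le> D c u"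
      using near_proj [OF that(2) Bt_I [OF that(1)]] unfolding D_def by blast
    from someI_ex [OF this] show "rd c u \<in> Bt u" "is_proj (rd c u)" "nu u (c u - rd c u) \<le> D c u"
      by (auto simp: rd_def)
  qed
  have Dz: "D c u = 0" if "is_proj (c u)" "u \<in> X" for c u using that by (simp add: D_def is_proj_def)
  have rdz: "rd c u = c u" if "c \<in> B" "is_proj (c u)" "u \<in> X" for c u
  proof -
    have "nu u (c u - rd c u) \<le> 0" using rd(3) [OF that(1,3)] Dz [of c u, OF that(2,3)] by simp
    then show ?thesis using nu_nonneg [OF that(3), of "c u - rd c u"] nu_eq_0 [OF that(3), of "c u - rd c u"] by simp
  qed
  obtain d where d: "d > 0" "\<And>u. \<lbrakk>u \<in> X; dist u t0 < d\<rbrakk> \<Longrightarrow> D b u < 1/4"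
    using D_near [OF b t0] Dz [of b t0, OF p t0] by auto
  have "sec (X \<inter> ball t0 d) (rd b)"
    unfolding sec_def
  proof
    fix t1 assume t1': "t1 \<in> X \<inter> ball t0 d"
    then have t1: "t1 \<in> X" "dist t1 t0 < d" by (auto simp: dist_commute)
    obtain c where c: "c \<in> B" "c t1 = rd b t1" using rd(1) [OF b t1(1)] by (auto simp: Bt_def)
    have pc: "is_proj (c t1)" using c rd(2) [OF b t1(1)] by simp
    obtain d1 where d1: "d1 > 0" "\<And>u. \<lbrakk>u \<in> X; dist u t1 < d1\<rbrakk> \<Longrightarrow> D c u < 1/4"
      using D_near [OF c(1) t1(1)] Dz [of c t1, OF pc t1(1)] by auto
    have "nu t1 (b t1 - c t1) < 1/4" using rd(3) [OF b t1(1)] d(2) [OF t1] c(2) by simp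
    then obtain d2 where d2: "d2 > 0" "\<And>u. \<lbrakk>u \<in> X; dist u t1 < d2\<rbrakk> \<Longrightarrow> nu u (b u - c u) < 1/4"
      using G_near [OF G_diff [OF B_G [OF b] B_G [OF c(1)]] t1(1)] by blast
    have eq: "rd b u = rd c u" if u: "u \<in> X" "dist u t0 < d" "dist u t1 < d1" "dist u t1 < d2" for u
    proof (rule proj_close_eq [OF u(1) rd(2) [OF b u(1)] rd(2) [OF c(1) u(1)]])
      show "rd b u * rd c u = rd c u * rd b u" by (rule Bt_comm [OF u(1) rd(1) [OF b u(1)] rd(1) [OF c(1) u(1)]])
      have "nu u (rd b u - rd c u) \<le> nu u (rd b u - b u) + (nu u (b u - c u) + nu u (c u - rd c u))"
        using nu_diff_triangle [OF u(1), of "rd b u" "rd c u" "b u"] nu_diff_triangle [OF u(1), of "b u" "rd c u" "c u"] by simp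
      also have "\<dots> < 1"
        using rd(3) [OF b u(1)] rd(3) [OF c(1) u(1)] d(2) [OF u(1,2)] d1(2) [OF u(1,3)] d2(2) [OF u(1,4)]
          nu_diff_comm [OF u(1), of "rd b u" "b u"] by simp
      finally show "nu u (rd b u - rd c u) < 1" .
    qed
    have bound: "nu u (rd b u - c u) \<le> D c u" if u: "u \<in> X \<inter> ball t0 d" "dist u t1 < min d1 d2" for u
    proof -
      have "u \<in> X" "dist u t0 < d" "dist u t1 < d1" "dist u t1 < d2" using u by (auto simp: dist_commute)
      with eq [of u] rd(3) [OF c(1), of u] nu_diff_comm [of u "rd c u" "c u"] show ?thesis by simp
    qed
    have "((\<lambda>u. nu u (c u * c u - c u)) \<longlongrightarrow> 0) (at t1 within (X \<inter> ball t0 d))"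
      by (rule nu_tendsto_0 [OF dG [OF c(1)] t1(1)]) (use pc in \<open>auto simp: is_proj_def\<close>)
    from tendsto_mult_left [OF this, of NN] have lim: "(D c \<longlongrightarrow> 0) (at t1 within (X \<inter> ball t0 d))" by (simp add: D_def)
    have "((\<lambda>u. nu u (rd b u - c u)) \<longlongrightarrow> 0) (at t1 within (X \<inter> ball t0 d))"
    proof (rule tendsto_sandwich [OF _ _ tendsto_const lim])
      show "\<forall>\<^sub>F u in at t1 within X \<inter> ball t0 d. 0 \<le> nu u (rd b u - c u)"
        by (auto simp: eventually_at_filter nu_nonneg)
      show "\<forall>\<^sub>F u in at t1 within X \<inter> ball t0 d. nu u (rd b u - c u) \<le> D c u"
        unfolding eventually_at using bound d1(1) d2(1) by (intro exI [of _ "min d1 d2"]) auto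
    qed
    with c B_G show "\<exists>a\<in>G. a t1 = rd b t1 \<and>
        ((\<lambda>u. nu u (rd b u - a u)) \<longlongrightarrow> 0) (at t1 within X \<inter> ball t0 d)" by blast
  qed
  then show ?thesis by (rule that [OF d(1)]) (use rdz [of b t0, OF b p t0] rd [OF b] in auto)
qed

end

subsection \<open>Local frames\<close>

lemma sum_proj_mult:
  assumes "finite Q" "q \<in> Q" "\<And>p. p \<in> Q \<Longrightarrow> is_proj (r p)" "\<And>p q. \<lbrakk>p \<in> Q; q \<in> Q; p \<noteq> q\<rbrakk> \<Longrightarrow> r p * r q = 0"
  shows "(\<Sum>p\<in>Q. r p) * r q = r q"
proof -
  have "(\<Sum>p\<in>Q. r p) * r q = (\<Sum>p\<in>Q. if p = q then r q else 0)"
    unfolding sum_distrib_right by (rule sum.cong) (use assms in \<open>auto simp: is_proj_def\<close>)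
  then show ?thesis using assms by simp
qed

lemma is_proj_sum:
  assumes "finite Q" "\<And>p. p \<in> Q \<Longrightarrow> is_proj (r p)" "\<And>p q. \<lbrakk>p \<in> Q; q \<in> Q; p \<noteq> q\<rbrakk> \<Longrightarrow> r p * r q = 0"
  shows "is_proj (\<Sum>p\<in>Q. r p)"
proof -
  have "(\<Sum>p\<in>Q. r p) * (\<Sum>q\<in>Q. r q) = (\<Sum>q\<in>Q. (\<Sum>p\<in>Q. r p) * r q)" by (rule sum_distrib_left)
  also have "\<dots> = (\<Sum>q\<in>Q. r q)" by (rule sum.cong [OF refl]) (rule sum_proj_mult [OF assms(1) _ assms(2,3)])
  finally have "(\<Sum>p\<in>Q. r p) * (\<Sum>q\<in>Q. r q) = (\<Sum>q\<in>Q. r q)" .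
  moreover have "adj (\<Sum>q\<in>Q. r q) = (\<Sum>q\<in>Q. r q)"
    unfolding adj_sum by (rule sum.cong [OF refl]) (use assms(2) in \<open>simp add: is_proj_def\<close>)
  ultimately show ?thesis by (simp add: is_proj_def)
qed

lemma is_proj_one_minus: "is_proj p \<Longrightarrow> is_proj (1 - p)"
  by (simp add: is_proj_def adj_diff algebra_simps)

lemma is_proj_mult:
  assumes p: "is_proj p" and q: "is_proj q" and c: "p * q = q * p"
  shows "is_proj (p * q)"
proof -
  have "p * q * (p * q) = p * (q * p) * q" by (simp only: mult.assoc)
  also have "\<dots> = (p * p) * (q * q)" by (simp only: c [symmetric] mult.assoc)
  also have "\<dots> = p * q" using p q by (simp add: is_proj_def)
  finally show ?thesis using p q c by (simp add: is_proj_def adj_mult)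
qed

context cfield
begin

lemma sec_eventually:
  assumes s: "sec (X \<inter> ball t0 d) s" and d: "d > 0" and t0: "t0 \<in> X"
  shows "nu t0 (s t0) < k \<Longrightarrow> \<forall>\<^sub>F u in nhds t0. u \<in> X \<longrightarrow> nu u (s u) < k"
    and "k < nu t0 (s t0) \<Longrightarrow> \<forall>\<^sub>F u in nhds t0. u \<in> X \<longrightarrow> k < nu u (s u)"
proof -
  have lim: "((\<lambda>u. nu u (s u)) \<longlongrightarrow> nu t0 (s t0)) (at t0 within (X \<inter> ball t0 d))"
    by (rule sec_nu_tendsto [OF s]) (use t0 d in auto)
  have *: "\<forall>\<^sub>F u in nhds t0. u \<in> X \<longrightarrow> P (nu u (s u))"
    if "\<forall>\<^sub>F u in at t0 within (X \<inter> ball t0 d). P (nu u (s u))" "P (nu t0 (s t0))" for P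
  proof -
    have "\<forall>\<^sub>F u in nhds t0. u \<in> ball t0 d" using d by (intro eventually_nhds_in_open) auto
    then show ?thesis
      using that(1) unfolding eventually_at_filter
      by eventually_elim (use that(2) in auto)
  qed
  show "nu t0 (s t0) < k \<Longrightarrow> \<forall>\<^sub>F u in nhds t0. u \<in> X \<longrightarrow> nu u (s u) < k"
    by (rule *) (use order_tendstoD(2) [OF lim] in auto)
  show "k < nu t0 (s t0) \<Longrightarrow> \<forall>\<^sub>F u in nhds t0. u \<in> X \<longrightarrow> k < nu u (s u)"
    by (rule *) (use order_tendstoD(1) [OF lim] in auto)
qed

text \<open>This turns the open condition of norm below 1 into an equation; orthogonality and
  completeness of lifted projections spread from t0 in this way.\<close>

lemma proj_small: "\<lbrakk>t \<in> X; is_proj p; nu t p < 1\<rbrakk> \<Longrightarrow> p = 0"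
  using nu_proj [of t p] by fastforce

end

lemma eventually_nhds_ballE:
  fixes t0 :: "'a::metric_space"
  assumes "\<forall>\<^sub>F u in nhds t0. P u" "d > 0"
  obtains d' where "d' > 0" "d' \<le> d" "\<And>u. u \<in> ball t0 d' \<Longrightarrow> P u"
proof -
  obtain e where "e > 0" "\<And>u. dist u t0 < e \<Longrightarrow> P u" using assms(1) unfolding eventually_nhds_metric by blast
  then show ?thesis using assms(2) by (intro that [of "min d e"]) (auto simp: dist_commute)
qed

context cartan_field
begin

definition local_partition :: "'v \<Rightarrow> real \<Rightarrow> 'n cmat set \<Rightarrow> ('n cmat \<Rightarrow> 'v \<Rightarrow> 'n cmat) \<Rightarrow> bool" where
  "local_partition t0 d Q r \<longleftrightarrow> d > 0 \<and> finite Q \<and> (\<forall>q\<in>Q. sec (X \<inter> ball t0 d) (r q)) \<and>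
     (\<forall>u\<in>X \<inter> ball t0 d. (\<forall>q\<in>Q. is_proj (r q u) \<and> r q u \<in> Bt u \<and> r q u \<noteq> 0) \<and>
        (\<forall>p\<in>Q. \<forall>q\<in>Q. p \<noteq> q \<longrightarrow> r p u * r q u = 0) \<and> (\<Sum>q\<in>Q. r q u) = 1)"

lemma local_partition_mono:
  assumes "local_partition t0 d Q r" "d' > 0" "d' \<le> d" shows "local_partition t0 d' Q r"
proof -
  have sub: "X \<inter> ball t0 d' \<subseteq> X \<inter> ball t0 d" using assms by auto
  show ?thesis
    using assms sub sec_mono [OF _ sub] unfolding local_partition_def by (meson subsetD)
qed

lemma local_partitionD:
  assumes "local_partition t0 d Q r"
  shows "d > 0" "finite Q" "\<And>q. q \<in> Q \<Longrightarrow> sec (X \<inter> ball t0 d) (r q)"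
    "\<And>u q. \<lbrakk>u \<in> X; u \<in> ball t0 d; q \<in> Q\<rbrakk> \<Longrightarrow> is_proj (r q u)"
    "\<And>u q. \<lbrakk>u \<in> X; u \<in> ball t0 d; q \<in> Q\<rbrakk> \<Longrightarrow> r q u \<in> Bt u"
    "\<And>u q. \<lbrakk>u \<in> X; u \<in> ball t0 d; q \<in> Q\<rbrakk> \<Longrightarrow> r q u \<noteq> 0"
    "\<And>u p q. \<lbrakk>u \<in> X; u \<in> ball t0 d; p \<in> Q; q \<in> Q; p \<noteq> q\<rbrakk> \<Longrightarrow> r p u * r q u = 0"
    "\<And>u. \<lbrakk>u \<in> X; u \<in> ball t0 d\<rbrakk> \<Longrightarrow> (\<Sum>q\<in>Q. r q u) = 1"
  using assms unfolding local_partition_def by simp_all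

text \<open>The spectral projections at t0 are lifted one by one. Products of lifts are projections
  because \<open>Bt u\<close> is commutative, and they vanish once their norm is below 1; after that
  the sum of the lifts is a projection too, and the same argument applies to 1 minus this
  sum.\<close>

lemma local_partition_exists:
  assumes t0: "t0 \<in> X"
  obtains d Q r where "local_partition t0 d Q r" "spectral_projs (Bt t0) Q" "\<And>q. q \<in> Q \<Longrightarrow> r q t0 = q"
proof -
  obtain Q where Q: "spectral_projs (Bt t0) Q" using spectral_projs_exist [OF Bt_alg [OF t0]] .
  have fin: "finite Q" and QB: "Q \<subseteq> Bt t0" and Q0: "0 \<notin> Q" and sum1: "\<Sum>Q = 1"
    and prj: "\<And>q. q \<in> Q \<Longrightarrow> is_proj q" and orth: "\<And>p q. \<lbrakk>p \<in> Q; q \<in> Q; p \<noteq> q\<rbrakk> \<Longrightarrow> p * q = 0"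
    using Q unfolding spectral_projs_def partition_in_def by auto
  have "\<exists>d r. d > 0 \<and> sec (X \<inter> ball t0 d) r \<and> r t0 = q \<and> (\<forall>u\<in>X \<inter> ball t0 d. is_proj (r u) \<and> r u \<in> Bt u)"
    if q: "q \<in> Q" for q
  proof -
    obtain b where b: "b \<in> B" "b t0 = q" using QB q by (auto simp: Bt_def)
    show ?thesis
      by (rule lift_proj [OF t0 b(1)]) (use b prj q in \<open>simp, blast\<close>)
  qed
  then obtain d r where dr: "\<And>q. q \<in> Q \<Longrightarrow> d q > 0" "\<And>q. q \<in> Q \<Longrightarrow> sec (X \<inter> ball t0 (d q)) (r q)"
    "\<And>q. q \<in> Q \<Longrightarrow> r q t0 = q"
    "\<And>q u. \<lbrakk>q \<in> Q; u \<in> X \<inter> ball t0 (d q)\<rbrakk> \<Longrightarrow> is_proj (r q u) \<and> r q u \<in> Bt u"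
    by metis
  define D where "D = Min (insert 1 (d ` Q))"
  have D: "D > 0" "\<And>q. q \<in> Q \<Longrightarrow> D \<le> d q" using fin dr(1) by (auto simp: D_def)
  have sub: "X \<inter> ball t0 D \<subseteq> X \<inter> ball t0 (d q)" if "q \<in> Q" for q using D(2) [OF that] by auto
  have rs: "sec (X \<inter> ball t0 D) (r q)" if "q \<in> Q" for q using sec_mono [OF dr(2) [OF that] sub [OF that]] .
  have rp: "is_proj (r q u)" "r q u \<in> Bt u" if "q \<in> Q" "u \<in> X" "u \<in> ball t0 D" for q u
    using dr(4) [OF that(1)] sub [OF that(1)] that by blast+
  have "\<forall>\<^sub>F u in nhds t0. u \<in> X \<longrightarrow> nu u (r p u * r q u) < 1" if "p \<in> Q" "q \<in> Q" "p \<noteq> q" for p q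
    by (rule sec_eventually(1) [OF sec_mult [OF rs rs] D(1) t0]) (use that dr(3) orth t0 in auto)
  then have ev1: "\<forall>\<^sub>F u in nhds t0. \<forall>p\<in>Q. \<forall>q\<in>Q. p \<noteq> q \<longrightarrow> u \<in> X \<longrightarrow> nu u (r p u * r q u) < 1"
    using fin by (intro eventually_ball_finite ballI) auto
  have ev2: "\<forall>\<^sub>F u in nhds t0. u \<in> X \<longrightarrow> nu u (1 - (\<Sum>q\<in>Q. r q u)) < 1"
  proof (rule sec_eventually(1) [OF sec_diff [OF sec_one sec_sum] D(1) t0])
    have "(\<Sum>q\<in>Q. r q t0) = \<Sum>Q" by (rule sum.cong) (auto simp: dr(3))
    then show "nu t0 (1 - (\<Sum>q\<in>Q. r q t0)) < 1" using sum1 t0 by simp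
  qed (use rs in auto)
  have "\<forall>\<^sub>F u in nhds t0. u \<in> X \<longrightarrow> 0 < nu u (r q u)" if "q \<in> Q" for q
  proof (rule sec_eventually(2) [OF rs [OF that] D(1) t0])
    have "q \<noteq> 0" using that Q0 by blast
    then show "0 < nu t0 (r q t0)" using nu_proj [OF t0 prj [OF that]] dr(3) [OF that] by simp
  qed
  then have ev3: "\<forall>\<^sub>F u in nhds t0. \<forall>q\<in>Q. u \<in> X \<longrightarrow> 0 < nu u (r q u)"
    using fin by (intro eventually_ball_finite ballI) auto
  obtain e where e: "e > 0" "e \<le> D" "\<And>u. u \<in> ball t0 e \<Longrightarrow>
      (\<forall>p\<in>Q. \<forall>q\<in>Q. p \<noteq> q \<longrightarrow> u \<in> X \<longrightarrow> nu u (r p u * r q u) < 1) \<and>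
      (u \<in> X \<longrightarrow> nu u (1 - (\<Sum>q\<in>Q. r q u)) < 1) \<and> (\<forall>q\<in>Q. u \<in> X \<longrightarrow> 0 < nu u (r q u))"
    using eventually_nhds_ballE [OF eventually_conj [OF ev1 eventually_conj [OF ev2 ev3]] D(1)] by blast
  have inD: "u \<in> ball t0 D" if "u \<in> ball t0 e" for u using e(2) that by auto
  have orthu: "r p u * r q u = 0" if "p \<in> Q" "q \<in> Q" "p \<noteq> q" "u \<in> X" "u \<in> ball t0 e" for p q u
  proof (rule proj_small [OF that(4)])
    have u: "u \<in> ball t0 D" using inD that by blast
    show "is_proj (r p u * r q u)"
      using rp [OF that(1,4) u] rp [OF that(2,4) u] Bt_comm [OF that(4)] by (intro is_proj_mult) auto
    show "nu u (r p u * r q u) < 1" using e(3) [OF that(5)] that by blast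
  qed
  have sumu: "(\<Sum>q\<in>Q. r q u) = 1" if "u \<in> X" "u \<in> ball t0 e" for u
  proof -
    have "1 - (\<Sum>q\<in>Q. r q u) = 0"
    proof (rule proj_small [OF that(1)])
      show "is_proj (1 - (\<Sum>q\<in>Q. r q u))"
        by (intro is_proj_one_minus is_proj_sum fin) (use rp orthu that inD in auto)
      show "nu u (1 - (\<Sum>q\<in>Q. r q u)) < 1" using e(3) that by blast
    qed
    then show ?thesis by simp
  qed
  have "local_partition t0 e Q r"
    unfolding local_partition_def
  proof (intro conjI ballI)
    show "sec (X \<inter> ball t0 e) (r q)" if "q \<in> Q" for q
      by (rule sec_mono [OF rs [OF that]]) (use e in auto)
    fix u assume u: "u \<in> X \<inter> ball t0 e"
    fix q assume q: "q \<in> Q"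
    show "is_proj (r q u)" "r q u \<in> Bt u" using rp [OF q] u inD by auto
    show "r q u \<noteq> 0"
    proof
      assume "r q u = 0"
      then show False using e(3) [of u] u q nu_0 [of u] by (metis IntE less_irrefl)
    qed
  next
    fix u p q assume "u \<in> X \<inter> ball t0 e" "p \<in> Q" "q \<in> Q"
    then show "p \<noteq> q \<longrightarrow> r p u * r q u = 0" using orthu by auto
  next
    fix u assume "u \<in> X \<inter> ball t0 e"
    then show "(\<Sum>q\<in>Q. r q u) = 1" using sumu by auto
  qed (use e fin in auto)
  then show ?thesis using that Q dr(3) by blast
qed

text \<open>A local form of \<open>B_max\<close>: the cutoff of a section that commutes with
  \<open>B\<close> near t0 commutes with \<open>B\<close> everywhere.\<close>

lemma partition_section_in_B:
  assumes r: "sec (X \<inter> ball t0 d) r" and rB: "\<And>u. u \<in> X \<inter> ball t0 d \<Longrightarrow> (\<And>x. x \<in> Bt u \<Longrightarrow> x * r u = r u * x)" and d: "d > 0"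
  obtains g where "g \<in> B" "\<And>u. \<lbrakk>u \<in> X; dist u t0 \<le> d/3\<rbrakk> \<Longrightarrow> g u = r u"
proof -
  obtain f g where g: "g \<in> G" "\<And>u. u \<in> X \<Longrightarrow> g u = cc (f u) * r u" "\<And>u. dist u t0 \<le> d/3 \<Longrightarrow> f u = 1"
      "\<And>u. u \<notin> ball t0 d \<Longrightarrow> f u = 0"
    by (rule bump_extension [OF r d]) blast
  have "g \<in> B"
  proof (rule B_max [OF g(1)])
    fix b u assume b: "b \<in> B" and u: "u \<in> X"
    show "g u * b u = b u * g u"
    proof (cases "u \<in> ball t0 d")
      case True
      then have "b u * r u = r u * b u" using rB Bt_I [OF b] u by blast
      then show ?thesis unfolding g(2) [OF u] by (metis cc_left_comm mult.assoc)
    qed (simp add: g(2) [OF u] g(4))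
  qed
  then show ?thesis using that g(2,3) by (metis cc_hom(2) mult_1)
qed

text \<open>The dimension of the fibres of \<open>B\<close> is lower semicontinuous, and so is that of the kernels of the
  fibres of \<open>E\<close>. As the two dimensions add up to the constant \<open>n\<^sup>2\<close>, both are locally constant, and the
  lifted projections span the nearby fibres of \<open>B\<close>.\<close>

lemma local_partition_spans:
  assumes t0: "t0 \<in> X" and P: "local_partition t0 d Q r" and Q: "spectral_projs (Bt t0) Q"
    and r0: "\<And>q. q \<in> Q \<Longrightarrow> r q t0 = q"
  obtains d' where "d' > 0" "d' \<le> d"
    "\<And>u x q. \<lbrakk>u \<in> X; u \<in> ball t0 d'; x \<in> Bt u; q \<in> Q\<rbrakk> \<Longrightarrow> \<exists>c. x * r q u = cc c * r q u"
proof -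
  note P = local_partitionD [OF P]
  have ne: "X \<noteq> {}" using t0 by auto
  have sum1: "\<Sum>Q = 1" using Q unfolding spectral_projs_def partition_in_def by blast
  have "\<exists>g. g \<in> B \<and> (\<forall>u\<in>X. dist u t0 \<le> d/3 \<longrightarrow> g u = r q u)" if q: "q \<in> Q" for q
  proof -
    have "x * r q u = r q u * x" if "u \<in> X \<inter> ball t0 d" "x \<in> Bt u" for u x
      using P(5) [of u q] Bt_comm [of u x "r q u"] that q by auto
    then show ?thesis by (rule partition_section_in_B [OF P(3) [OF q] _ P(1)]) blast+
  qed
  then obtain g where g: "\<And>q. q \<in> Q \<Longrightarrow> g q \<in> B" "\<And>q u. \<lbrakk>q \<in> Q; u \<in> X; dist u t0 \<le> d/3\<rbrakk> \<Longrightarrow> g q u = r q u"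
    by metis
  have "\<forall>i j. \<exists>a\<in>G. a t0 = unit_mat i j" using full [OF t0] by blast
  then obtain a where a: "\<And>i j. a i j \<in> G" "\<And>i j. a i j t0 = unit_mat i j" by metis
  have "\<forall>i j. \<forall>q\<in>Q. \<exists>c. E (a i j) t0 * q = cc c * q"
    using Q Bt_I [OF E_B [OF a(1)]] unfolding spectral_projs_def by blast
  then obtain \<gamma> where \<gamma>: "\<And>i j q. q \<in> Q \<Longrightarrow> E (a i j) t0 * q = cc (\<gamma> i j q) * q" by metis
  define h where "h = (\<lambda>i j u. \<Sum>q\<in>Q. cc (\<gamma> i j q) * g q u)"
  have hB: "h i j \<in> B" for i j
  proof (rule B_max)
    show "h i j \<in> G" unfolding h_def by (intro G_sum ne G_scale B_G g)
    fix b u assume b: "b \<in> B" and u: "u \<in> X"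
    have "h i j u \<in> Bt u" unfolding h_def by (intro Bt_sum u Bt_scale Bt_I g)
    then show "h i j u * b u = b u * h i j u" by (rule Bt_comm [OF u _ Bt_I [OF b]])
  qed
  \<comment> \<open>A combination of lifted projections plus an element of the kernel of E. At t0
    these are the matrix units, so they form a basis nearby; applying E to the expansion of an
    element of \<open>Bt u\<close> retains only the parts h, which act as scalars on each lifted
    projection.\<close>
  define k where "k = (\<lambda>i j u. h i j u + (a i j u - E (a i j) u))"
  have kG: "k i j \<in> G" for i j unfolding k_def by (intro G_add G_diff B_G hB a E_B)
  have h0: "h i j t0 = E (a i j) t0" for i j
  proof -
    have "h i j t0 = (\<Sum>q\<in>Q. E (a i j) t0 * q)"
      unfolding h_def by (rule sum.cong [OF refl]) (use g(2) t0 r0 \<gamma> P(1) in simp)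
    also have "\<dots> = E (a i j) t0 * \<Sum>Q" by (simp only: sum_distrib_left)
    finally show ?thesis by (simp add: sum1)
  qed
  have k0: "k i j t0 = unit_mat i j" for i j by (simp add: k_def h0 a)
  obtain M e where e: "e > 0" "\<And>u x. \<lbrakk>u \<in> X; dist u t0 < e\<rbrakk> \<Longrightarrow>
    \<exists>c. x = (\<Sum>i\<in>UNIV. \<Sum>j\<in>UNIV. cc (c i j) * k i j u) \<and> (\<forall>i j. cmod (c i j) \<le> M * nu u x)"
    by (rule local_basis [OF t0 kG k0]) blast
  have Ek: "E (k i j) u = h i j u" if "u \<in> X" for i j u
  proof -
    have "E (k i j) u = E (h i j) u + (E (a i j) u - E (E (a i j)) u)"
      unfolding k_def using that
      by (simp add: E_add [OF B_G [OF hB] G_diff [OF a(1) B_G [OF E_B [OF a(1)]]]] E_diff [OF a(1) B_G [OF E_B [OF a(1)]]])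
    then show ?thesis using that E_id [OF hB] E_id [OF E_B [OF a(1)]] by simp
  qed
  show ?thesis
  proof (rule that [of "min e (d/3)"])
    fix u x q assume u: "u \<in> X" "u \<in> ball t0 (min e (d/3))" and x: "x \<in> Bt u" and q: "q \<in> Q"
    have u1: "dist u t0 < e" "dist u t0 \<le> d/3" and u2: "u \<in> ball t0 d" using u P(1) by (auto simp: dist_commute)
    obtain b where b: "b \<in> B" "x = b u" using x by (auto simp: Bt_def)
    obtain c where c: "x = (\<Sum>i\<in>UNIV. \<Sum>j\<in>UNIV. cc (c i j) * k i j u)" using e(2) [OF u(1) u1(1)] by blast
    define K where "K = (\<lambda>v. \<Sum>i\<in>UNIV. \<Sum>j\<in>UNIV. cc (c i j) * k i j v)"
    have kk: "(\<lambda>v. \<Sum>j\<in>UNIV. cc (c i j) * k i j v) \<in> G" for i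
      by (intro G_sum ne G_scale kG)
    have KG: "K \<in> G" unfolding K_def by (intro G_sum ne kk)
    \<comment> \<open>The coefficients c were found at the point u alone. Keeping them constant
      gives a global section K that agrees with b at u, and by \<open>E_local\<close> this suffices
      for the value of E there.\<close>
    have "E (\<lambda>v. b v - K v) u = 0"
      by (rule E_local [OF G_diff [OF B_G [OF b(1)] KG] u(1)]) (use b c in \<open>simp add: K_def\<close>)
    then have "x = E K u" using E_diff [OF B_G [OF b(1)] KG u(1)] E_id [OF b(1) u(1)] b(2) by simp
    also have "\<dots> = (\<Sum>i\<in>UNIV. E (\<lambda>v. \<Sum>j\<in>UNIV. cc (c i j) * k i j v) u)"
      unfolding K_def by (rule E_sum [OF u(1) kk])
    also have "\<dots> = (\<Sum>i\<in>UNIV. \<Sum>j\<in>UNIV. E (\<lambda>v. cc (c i j) * k i j v) u)"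
      by (intro sum.cong refl E_sum [OF u(1) G_scale [OF kG]])
    also have "\<dots> = (\<Sum>i\<in>UNIV. \<Sum>j\<in>UNIV. cc (c i j) * h i j u)"
      by (intro sum.cong refl) (simp add: E_scale [OF kG u(1)] Ek [OF u(1)])
    finally have xh: "x = (\<Sum>i\<in>UNIV. \<Sum>j\<in>UNIV. cc (c i j) * h i j u)" .
    have hq: "h i j u * r q u = cc (\<gamma> i j q) * r q u" for i j
    proof -
      have "h i j u * r q u = (\<Sum>p\<in>Q. if p = q then cc (\<gamma> i j q) * r q u else 0)"
        unfolding h_def sum_distrib_right
      proof (rule sum.cong [OF refl])
        fix p assume p: "p \<in> Q"
        have "g p u = r p u" using g(2) [OF p u(1) u1(2)] .
        then show "cc (\<gamma> i j p) * g p u * r q u = (if p = q then cc (\<gamma> i j q) * r q u else 0)"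
          using P(4) [OF u(1) u2 q] P(7) [OF u(1) u2 p q] by (simp add: mult.assoc is_proj_def)
      qed
      then show ?thesis using P(2) q by simp
    qed
    have "x * r q u = (\<Sum>i\<in>UNIV. \<Sum>j\<in>UNIV. cc (c i j) * (h i j u * r q u))"
      unfolding xh by (simp only: sum_distrib_right mult.assoc)
    also have "\<dots> = cc (\<Sum>i\<in>UNIV. \<Sum>j\<in>UNIV. c i j * \<gamma> i j q) * r q u"
      by (simp only: hq cc_sum sum_distrib_right cc_cc_mult)
    finally show "\<exists>c. x * r q u = cc c * r q u" by blast
  qed (use e P(1) in auto)
qed

text \<open>Nearby elements of \<open>Bt v\<close> act as scalars on \<open>r q v\<close>, so every
  section of the corner commutes with them and, cut off, lies in \<open>B\<close>. Its value at u
  therefore lies in \<open>Bt u\<close> and acts on \<open>r q u\<close> as a scalar, which is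
  minimality in the whole matrix algebra.\<close>

lemma local_minimal_partition:
  assumes t0: "t0 \<in> X"
  obtains d Q r where "local_partition t0 d Q r" "\<And>u q. \<lbrakk>u \<in> X; u \<in> ball t0 d; q \<in> Q\<rbrakk> \<Longrightarrow> minimal_proj (r q u)"
proof -
  obtain d0 Q r where P0: "local_partition t0 d0 Q r" and Q: "spectral_projs (Bt t0) Q" and r0: "\<And>q. q \<in> Q \<Longrightarrow> r q t0 = q"
    using local_partition_exists [OF t0] by blast
  obtain d where d: "d > 0" "d \<le> d0"
    and sp: "\<And>u x q. \<lbrakk>u \<in> X; u \<in> ball t0 d; x \<in> Bt u; q \<in> Q\<rbrakk> \<Longrightarrow> \<exists>c. x * r q u = cc c * r q u"
    by (rule local_partition_spans [OF t0 P0 Q r0]) blast+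
  have P: "local_partition t0 d Q r" by (rule local_partition_mono [OF P0 d])
  note PD = local_partitionD [OF P]
  have min: "minimal_proj (r q u)" if u: "u \<in> X" "dist u t0 \<le> d/3" and q: "q \<in> Q" for u q
    unfolding minimal_proj_def
  proof (intro conjI allI)
    have ub: "u \<in> ball t0 d" using u d by (simp add: dist_commute)
    show "is_proj (r q u)" "r q u \<noteq> 0" using PD u ub q by auto
    fix x
    obtain a where a: "a \<in> G" "a u = x" using full [OF u(1)] by blast
    define s where "s = (\<lambda>v. r q v * a v * r q v)"
    have ss: "sec (X \<inter> ball t0 d) s"
      unfolding s_def by (rule sec_mult [OF sec_mult [OF PD(3) [OF q] G_sec [OF a(1)]] PD(3) [OF q]]) auto
    have comm: "y * s v = s v * y" if v: "v \<in> X \<inter> ball t0 d" and y: "y \<in> Bt v" for v y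
    proof -
      obtain c where c: "y * r q v = cc c * r q v" using sp v y q by blast
      have c': "r q v * y = cc c * r q v" using Bt_comm [of v y "r q v"] PD(5) [of v q] v y q c by auto
      have "y * s v = cc c * r q v * a v * r q v" unfolding s_def by (simp only: mult.assoc [symmetric] c)
      also have "\<dots> = r q v * a v * (cc c * r q v)" by (simp only: mult.assoc cc_comm) (metis cc_left_comm mult.assoc)
      also have "\<dots> = s v * y" unfolding s_def by (simp only: mult.assoc c')
      finally show ?thesis .
    qed
    obtain g where g: "g \<in> B" "\<And>u. \<lbrakk>u \<in> X; dist u t0 \<le> d/3\<rbrakk> \<Longrightarrow> g u = s u"
      by (rule partition_section_in_B [OF ss comm d(1)]) blast+
    have "s u \<in> Bt u" using Bt_I [OF g(1), of u] g(2) [OF u] by simp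
    then obtain c where "s u * r q u = cc c * r q u" using sp [OF u(1) ub _ q] by blast
    moreover have "s u * r q u = s u" using PD(4) [OF u(1) ub q] by (simp add: s_def mult.assoc is_proj_def)
    ultimately have "s u = cc c * r q u" by simp
    then show "\<exists>c. r q u * x * r q u = cc c * r q u" unfolding s_def a(2) by blast
  qed
  \<comment> \<open>The cutoff agrees with s only within distance d/3.\<close>
  have P': "local_partition t0 (d/3) Q r" by (rule local_partition_mono [OF P]) (use d in auto)
  show ?thesis by (rule that [OF P']) (use min in \<open>simp add: dist_commute\<close>)
qed

end

text \<open>Minimality of the diagonal units makes the system full: it yields the scalar
  coefficients of an arbitrary matrix.\<close>

definition mat_units :: "('n::finite \<Rightarrow> 'n \<Rightarrow> 'n cmat) \<Rightarrow> bool" where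
  "mat_units e \<longleftrightarrow> (\<forall>i j k l. e i j * e k l = (if j = k then e i l else 0)) \<and> (\<forall>i j. adj (e i j) = e j i) \<and>
     (\<Sum>i\<in>UNIV. e i i) = 1 \<and> (\<forall>i. minimal_proj (e i i))"

lemma mat_unitsD:
  assumes "mat_units e"
  shows "e i j * e j l = e i l" "j \<noteq> k \<Longrightarrow> e i j * e k l = 0" "adj (e i j) = e j i" "(\<Sum>i\<in>UNIV. e i i) = 1"
    "minimal_proj (e i i)" "is_proj (e i i)"
  using assms unfolding mat_units_def minimal_proj_def by auto

lemma mat_units_nonzero: assumes "mat_units e" shows "e i j \<noteq> 0"
proof
  assume "e i j = 0"
  then have "e i i = 0" using mat_unitsD(1) [OF assms, of i j i] by simp
  then show False using mat_unitsD(5) [OF assms, of i] by (simp add: minimal_proj_def)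
qed

text \<open>Multiplication by \<open>e j i\<close> moves the element into the corner of the minimal
  projection \<open>e j j\<close>.\<close>

lemma mat_units_corner: assumes "mat_units e" shows "\<exists>c. e i i * x * e j j = cc c * e i j"
proof -
  obtain c where c: "e j j * (e j i * x) * e j j = cc c * e j j" using mat_unitsD(5) [OF assms, of j] unfolding minimal_proj_def by blast
  have "e i i * x * e j j = e i j * (e j j * (e j i * x) * e j j)"
    using mat_unitsD(1) [OF assms] by (metis mult.assoc)
  also have "\<dots> = cc c * e i j" unfolding c by (subst cc_left_comm) (simp add: mat_unitsD(1) [OF assms])
  finally show ?thesis by blast
qed

context cartan_field
begin

definition frame :: "'v set \<Rightarrow> ('n \<Rightarrow> 'n \<Rightarrow> 'v \<Rightarrow> 'n cmat) \<Rightarrow> bool" where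
  "frame K e \<longleftrightarrow> (\<forall>i j. sec K (e i j)) \<and> (\<forall>t\<in>K. mat_units (\<lambda>i j. e i j t) \<and> (\<forall>i. e i i t \<in> Bt t))"

lemma frame_mono: "\<lbrakk>frame K e; L \<subseteq> K\<rbrakk> \<Longrightarrow> frame L e"
  unfolding frame_def using sec_mono by blast

lemma nu_mat_unit: assumes "t \<in> X" "mat_units e" shows "nu t (e i j) = 1"
proof -
  have "(nu t (e i j))\<^sup>2 = nu t (e j j)"
    using nu_cstar [OF assms(1), of "e i j"] mat_unitsD(1,3) [OF assms(2)] by simp
  also have "\<dots> = 1" using mat_unitsD(6) [OF assms(2)] mat_units_nonzero [OF assms(2)] by (intro nu_proj assms)
  finally show ?thesis using nu_nonneg [OF assms(1), of "e i j"] by (simp add: power2_eq_1_iff)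
qed

text \<open>Off-diagonal matrix units: for a section \<open>v\<close> of \<open>r\<^sub>i A r\<^sub>o\<close> without zeros, \<open>v\<^sup>*v\<close> is a positive
  multiple of the minimal projection \<open>r\<^sub>o\<close>, so dividing \<open>v\<close> by its norm gives a partial isometry.\<close>

lemma corner_isometry:
  assumes t: "t \<in> X" and p: "minimal_proj p" and q: "minimal_proj q" and v: "v = p * a * q" "v \<noteq> 0"
  defines "w \<equiv> cc (of_real (inverse (nu t v))) * v"
  shows "adj w * w = q" "w * adj w = p" "p * w = w" "w * q = w"
proof -
  have pq: "p * p = p" "adj p = p" "q * q = q" "adj q = q" "p \<noteq> 0" "q \<noteq> 0" using p q by (auto simp: minimal_proj_def is_proj_def)
  have npos: "nu t v > 0" using v(2) nu_nonneg [OF t, of v] nu_eq_0 [OF t, of v] by linarith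
  have pv: "p * v = v" "v * q = v" unfolding v by (metis pq mult.assoc)+
  then show pw: "p * w = w" "w * q = w" unfolding w_def by (metis cc_left_comm, metis mult.assoc)
  have "adj v * v = q * (adj a * p * v) * q"
    unfolding v(1) by (simp add: adj_mult pq mult.assoc)
  then obtain c where c: "adj v * v = cc c * q" using q unfolding minimal_proj_def by metis
  \<comment> \<open>The trace shows that c is real and nonnegative; the C*-identity then identifies
    it with the squared norm of v.\<close>
  have "trc (adj v * v) = c" unfolding c by (simp add: minimal_proj_trc [OF q])
  then obtain r where r: "c = of_real r" "r \<ge> 0"
    unfolding trc_adj_mult by (metis (no_types, lifting) sum_nonneg zero_le_power2)
  have "(nu t v)\<^sup>2 = cmod c * nu t q" using nu_cstar [OF t, of v] nu_scale [OF t] c by simp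
  also have "nu t q = 1" using q by (intro nu_proj [OF t]) (auto simp: minimal_proj_def)
  finally have cr: "c = of_real ((nu t v)\<^sup>2)" using r by simp
  define z where "z = complex_of_real (inverse (nu t v))"
  have aw: "adj w = cc z * adj v" unfolding w_def z_def by (simp add: adj_mult cc_comm)
  have "adj w * w = cc z * (adj v * (cc z * v))" unfolding aw by (simp add: w_def z_def mult.assoc)
  also have "\<dots> = cc (of_real (inverse (nu t v) * inverse (nu t v))) * (adj v * v)"
    unfolding cc_left_comm [of "adj v"] cc_cc_mult by (simp add: z_def)
  also have "\<dots> = q" unfolding c cc_cc_mult cr using npos by (simp add: power2_eq_square field_simps flip: of_real_mult)
  finally show ww: "adj w * w = q" .
  have "w * adj w = p * (w * adj w) * p"
    using pw(1) pq(2) by (metis adj_mult mult.assoc)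
  then obtain c' where c': "w * adj w = cc c' * p" using p unfolding minimal_proj_def by metis
  \<comment> \<open>The multiple of p is idempotent and nonzero, so its coefficient is 1.\<close>
  have "w * adj w * (w * adj w) = w * adj w" by (metis ww pw(2) mult.assoc)
  then have "cc (c' * c') * p = cc c' * p" unfolding c' by (metis cc_cc_mult cc_left_comm mult.assoc pq(1))
  then have "c' * c' = c'" using cc_mult_cancel [OF pq(5)] by blast
  moreover have "c' \<noteq> 0"
  proof
    assume "c' = 0"
    then have "adj w = 0" using c' adj_mult_eq_0 [of "adj w"] by simp
    then show False using ww pq(6) by (simp add: adj_eq_0)
  qed
  ultimately show "w * adj w = p" using c' by simp
qed

text \<open>All the partial isometries have the same initial projection \<open>q\<close>, so the
  inner product \<open>adj (w j) * w k\<close> is \<open>q\<close> or 0.\<close>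

lemma mat_unitsI:
  assumes w: "\<And>i. adj (w i) * w i = q" "\<And>i. w i * adj (w i) = p i" "\<And>i. w i * q = w i" "\<And>i. p i * w i = w i"
    and p: "\<And>i. minimal_proj (p i)" "\<And>i j. i \<noteq> j \<Longrightarrow> p i * p j = 0" "(\<Sum>i\<in>UNIV. p i) = 1"
  shows "mat_units (\<lambda>i j. w i * adj (w j))"
  unfolding mat_units_def
proof (intro conjI allI)
  fix i j k l
  have adjp: "adj (p i) = p i" for i using p(1) by (simp add: minimal_proj_def is_proj_def)
  have a: "adj (w j) * w k = (if j = k then q else 0)"
  proof (cases "j = k")
    case False
    have "adj (w j) * w k = adj (w j) * (p j * p k) * w k" by (metis w(4) adj_mult adjp mult.assoc)
    then show ?thesis using p(2) [OF False] False by simp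
  qed (use w in simp)
  have "w i * adj (w j) * (w k * adj (w l)) = w i * (adj (w j) * w k) * adj (w l)" by (simp only: mult.assoc)
  also have "\<dots> = (if j = k then w i * adj (w l) else 0)" by (simp add: a w)
  finally show "w i * adj (w j) * (w k * adj (w l)) = (if j = k then w i * adj (w l) else 0)" .
qed (use w p in \<open>simp_all add: adj_mult\<close>)

lemma local_frame:
  assumes t0: "t0 \<in> X"
  obtains d e where "d > 0" "frame (X \<inter> ball t0 d) e"
proof -
  obtain d Q r where P: "local_partition t0 d Q r" and min: "\<And>u q. \<lbrakk>u \<in> X; u \<in> ball t0 d; q \<in> Q\<rbrakk> \<Longrightarrow> minimal_proj (r q u)"
    using local_minimal_partition [OF t0] by blast
  note PD = local_partitionD [OF P]
  have t0b: "t0 \<in> ball t0 d" using PD(1) by simp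
  have inj: "inj_on (\<lambda>q. r q t0) Q"
  proof (rule inj_onI, rule ccontr)
    fix p q assume pq: "p \<in> Q" "q \<in> Q" "r p t0 = r q t0" "p \<noteq> q"
    have "r p t0 * r p t0 = 0" using PD(7) [OF t0 t0b pq(1,2,4)] pq(3) by simp
    then show False using PD(4,6) [OF t0 t0b pq(1)] by (simp add: is_proj_def)
  qed
  \<comment> \<open>Counting traces at the single point t0 fixes the number of projections, hence a
    bijection h with the index type.\<close>
  have "card ((\<lambda>q. r q t0) ` Q) = CARD('n)"
  proof (rule card_minimal_proj)
    show "\<Sum>((\<lambda>q. r q t0) ` Q) = 1" using PD(8) [OF t0 t0b] by (simp add: sum.reindex [OF inj])
  qed (use min t0 t0b in auto)
  then have "card Q = CARD('n)" by (simp add: card_image [OF inj])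
  then obtain h where h: "bij_betw h (UNIV :: 'n set) Q"
    using finite_same_card_bij [of "UNIV :: 'n set" Q] PD(2) by auto
  have hQ: "h i \<in> Q" for i using h by (auto simp: bij_betw_def)
  have hinj: "h i \<noteq> h j" if "i \<noteq> j" for i j using h that by (auto simp: bij_betw_def inj_on_def)
  \<comment> \<open>An arbitrary base index. Primeness connects every projection with this one at
    t0, and the connecting section stays nonzero nearby.\<close>
  define o1 :: 'n where "o1 = undefined"
  have "\<exists>a\<in>G. r (h i) t0 * a t0 * r (h o1) t0 \<noteq> 0" for i
  proof -
    obtain x where "r (h i) t0 * x * r (h o1) t0 \<noteq> 0"
      using prime_cmat [OF PD(6) [OF t0 t0b hQ] PD(6) [OF t0 t0b hQ]] .
    then show ?thesis using full [OF t0, of x] by blast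
  qed
  then obtain a where a: "\<And>i. a i \<in> G" "\<And>i. r (h i) t0 * a i t0 * r (h o1) t0 \<noteq> 0" by metis
  define v where "v = (\<lambda>i u. r (h i) u * a i u * r (h o1) u)"
  have vs: "sec (X \<inter> ball t0 d) (v i)" for i
    unfolding v_def by (rule sec_mult [OF sec_mult [OF PD(3) [OF hQ] G_sec [OF a(1)]] PD(3) [OF hQ]]) auto
  have "\<forall>\<^sub>F u in nhds t0. u \<in> X \<longrightarrow> 0 < nu u (v i u)" for i
  proof (rule sec_eventually(2) [OF vs PD(1) t0])
    have "v i t0 \<noteq> 0" using a(2) by (simp add: v_def)
    then show "0 < nu t0 (v i t0)" using nu_nonneg [OF t0, of "v i t0"] nu_eq_0 [OF t0, of "v i t0"] by linarith
  qed
  then have "\<forall>\<^sub>F u in nhds t0. \<forall>i\<in>UNIV. u \<in> X \<longrightarrow> 0 < nu u (v i u)" by (intro eventually_ball_finite) auto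
  then obtain d' where d': "d' > 0" "d' \<le> d" "\<And>u. u \<in> ball t0 d' \<Longrightarrow> \<forall>i\<in>UNIV. u \<in> X \<longrightarrow> 0 < nu u (v i u)"
    using eventually_nhds_ballE PD(1) by blast
  define K where "K = X \<inter> ball t0 d'"
  have K: "K \<subseteq> X" "K \<subseteq> X \<inter> ball t0 d" using d' by (auto simp: K_def)
  define w where "w = (\<lambda>i u. cc (of_real (inverse (nu u (v i u)))) * v i u)"
  have pos: "nu u (v i u) > 0" if "u \<in> K" for i u using d'(3) that by (auto simp: K_def)
  have vK: "sec K (v i)" for i using sec_mono [OF vs K(2)] .
  have wK: "sec K (w i)" for i
    unfolding w_def
  proof (rule sec_scale [OF vK K(1)])
    have "continuous_on K (\<lambda>u. inverse (nu u (v i u)))"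
      by (intro continuous_on_inverse sec_nu_cont vK K(1)) (metis pos less_irrefl)
    then show "continuous_on K (\<lambda>u. complex_of_real (inverse (nu u (v i u))))" by (rule continuous_on_of_real)
  qed
  have wu: "adj (w i u) * w i u = r (h o1) u" "w i u * adj (w i u) = r (h i) u" "r (h i) u * w i u = w i u"
    "w i u * r (h o1) u = w i u" if u: "u \<in> K" for i u
  proof -
    have uX: "u \<in> X" and ub: "u \<in> ball t0 d" using K u by auto
    have vu: "v i u = r (h i) u * a i u * r (h o1) u" by (simp add: v_def)
    have v0: "v i u \<noteq> 0" using pos [OF u, of i] nu_0 [OF uX] by auto
    show "adj (w i u) * w i u = r (h o1) u" "w i u * adj (w i u) = r (h i) u" "r (h i) u * w i u = w i u"
      "w i u * r (h o1) u = w i u"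
      using corner_isometry [OF uX min [OF uX ub hQ] min [OF uX ub hQ] vu v0] unfolding w_def by blast+
  qed
  define e where "e = (\<lambda>i j u. w i u * adj (w j u))"
  have "frame K e"
    unfolding frame_def
  proof (intro conjI allI ballI)
    show "sec K (e i j)" for i j unfolding e_def by (rule sec_mult [OF wK sec_adj [OF wK K(1)] K(1)])
    fix u assume u: "u \<in> K"
    have uX: "u \<in> X" and ub: "u \<in> ball t0 d" using K u by auto
    show "e i i u \<in> Bt u" for i using PD(5) [OF uX ub hQ] wu(2) [OF u] by (simp add: e_def)
    show "mat_units (\<lambda>i j. e i j u)"
      unfolding e_def
    proof (rule mat_unitsI [where w = "\<lambda>i. w i u" and p = "\<lambda>i. r (h i) u" and q = "r (h o1) u"])
      have "(\<Sum>i\<in>UNIV. r (h i) u) = (\<Sum>q\<in>Q. r q u)"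
        using sum.reindex_bij_betw [OF h, of "\<lambda>q. r q u"] by simp
      then show "(\<Sum>i\<in>UNIV. r (h i) u) = 1" using PD(8) [OF uX ub] by simp
      show "r (h i) u * r (h j) u = 0" if "i \<noteq> j" for i j using PD(7) [OF uX ub hQ hQ hinj [OF that]] .
      show "minimal_proj (r (h i) u)" for i using min [OF uX ub hQ] .
    qed (use wu [OF u] in auto)
  qed
  then show ?thesis using that d'(1) unfolding K_def by blast
qed

end

section \<open>Global frames\<close>

text \<open>Connectedness keeps the permutation between two frames constant; the real-valued
  argument is what Tietze's theorem can extend.\<close>

definition circle_lifts :: "'v::euclidean_space set \<Rightarrow> bool" where
  "circle_lifts S \<longleftrightarrow> connected S \<and> (\<forall>f::'v \<Rightarrow> complex. continuous_on S f \<longrightarrow> (\<forall>t\<in>S. cmod (f t) = 1) \<longrightarrow>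
     (\<exists>\<theta>::'v \<Rightarrow> real. continuous_on S \<theta> \<and> (\<forall>t\<in>S. f t = cis (\<theta> t))))"

lemma circle_lifts_from_log:
  assumes "connected S" and log: "\<And>f :: 'v::euclidean_space \<Rightarrow> complex. \<lbrakk>continuous_on S f; \<And>t. t \<in> S \<Longrightarrow> f t \<noteq> 0\<rbrakk> \<Longrightarrow>
      \<exists>g. continuous_on S g \<and> (\<forall>t\<in>S. f t = exp (g t))"
  shows "circle_lifts S"
  unfolding circle_lifts_def
proof (intro conjI allI impI)
  fix f :: "'v \<Rightarrow> complex" assume f: "continuous_on S f" "\<forall>t\<in>S. cmod (f t) = 1"
  have "f t \<noteq> 0" if "t \<in> S" for t using f(2) that by force
  then obtain g where g: "continuous_on S g" "\<And>t. t \<in> S \<Longrightarrow> f t = exp (g t)" using log [OF f(1)] by blast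
  have "f t = cis (Im (g t))" if t: "t \<in> S" for t
  proof -
    have "cmod (exp (g t)) = 1" using f(2) t g(2) [OF t] by metis
    then have "g t = \<i> * of_real (Im (g t))" by (simp add: complex_eq_iff)
    then show ?thesis using g(2) [OF t] by (metis cis_conv_exp)
  qed
  moreover have "continuous_on S (\<lambda>t. Im (g t))" by (intro continuous_intros g)
  ultimately show "\<exists>\<theta>::'v \<Rightarrow> real. continuous_on S \<theta> \<and> (\<forall>t\<in>S. f t = cis (\<theta> t))" by blast
qed (rule assms)

lemma circle_lifts_simply_connected:
  fixes S :: "'v::euclidean_space set"
  assumes "simply_connected S" "locally path_connected S" shows "circle_lifts S"
proof (rule circle_lifts_from_log)
  show "connected S" by (rule simply_connected_imp_connected [OF assms(1)])
  show "\<exists>g. continuous_on S g \<and> (\<forall>t\<in>S. f t = exp (g t))"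
    if "continuous_on S f" "\<And>t. t \<in> S \<Longrightarrow> f t \<noteq> 0" for f :: "'v \<Rightarrow> complex"
    by (rule continuous_logarithm_on_simply_connected [OF that(1) assms that(2)]) blast+
qed

text \<open>The pieces of a hemisphere arise as injective continuous images of flat compact convex
  sets, and these are contractible.\<close>

lemma circle_lifts_image_convex:
  fixes C :: "'v::euclidean_space set" and \<psi> :: "'v \<Rightarrow> 'v"
  assumes "convex C" "compact C" "continuous_on C \<psi>" "inj_on \<psi> C"
  shows "circle_lifts (\<psi> ` C)"
proof (rule circle_lifts_from_log)
  show "connected (\<psi> ` C)" by (intro connected_continuous_image convex_connected assms)
  have "C homeomorphic (\<psi> ` C)" using homeomorphic_compact assms by blast
  then have con: "contractible (\<psi> ` C)"
    using homeomorphic_contractible convex_imp_contractible [OF assms(1)] by blast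
  show "\<exists>g. continuous_on (\<psi> ` C) g \<and> (\<forall>t\<in>\<psi> ` C. f t = exp (g t))"
    if "continuous_on (\<psi> ` C) f" "\<And>t. t \<in> \<psi> ` C \<Longrightarrow> f t \<noteq> 0" for f :: "'v \<Rightarrow> complex"
    by (rule continuous_logarithm_on_contractible [OF that(1) con that(2)]) blast+
qed

text \<open>By minimality and commutation p q is a multiple k p. As p q is idempotent and nonzero, k
  = 1; by symmetry p q is also q.\<close>

lemma minimal_proj_comm_eq:
  assumes p: "minimal_proj p" and q: "minimal_proj q" and c: "p * q = q * p" and nz: "p * q \<noteq> 0"
  shows "p = q"
proof -
  have *: "p * q = p" if p: "minimal_proj p" and q: "minimal_proj q" and c: "p * q = q * p" and nz: "p * q \<noteq> 0" for p q
  proof -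
    have pp: "p * p = p" "q * q = q" "p \<noteq> 0" using p q by (auto simp: minimal_proj_def is_proj_def)
    obtain k where "p * q * p = cc k * p" using p unfolding minimal_proj_def by blast
    moreover have "p * q * p = p * q" by (metis c pp(1) mult.assoc)
    ultimately have k: "p * q = cc k * p" by simp
    have "p * q * q = p * q" by (simp add: mult.assoc pp)
    then have "cc k * (cc k * p) = cc k * p" by (metis k mult.assoc)
    then have "k * k = k" unfolding cc_cc_mult cc_mult_cancel [OF pp(3)] .
    moreover have "k \<noteq> 0" using nz k by auto
    ultimately show ?thesis using k by simp
  qed
  have "p * q = p" by (rule * [OF p q c nz])
  moreover have "q * p = q" by (rule * [OF q p c [symmetric]]) (use nz c in simp)
  ultimately show ?thesis using c by simp
qed

lemma mat_units_twist:
  assumes e: "mat_units e" and \<tau>: "bij \<tau>" and z: "\<And>i. cmod (z i) = 1"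
  shows "mat_units (\<lambda>a b. cc (cnj (z a) * z b) * e (\<tau> a) (\<tau> b))"
proof -
  have zz: "cnj (z a) * z a = 1" "z a * cnj (z a) = 1" for a
    using complex_norm_square [of "z a"] z [of a] by (simp_all add: mult.commute)
  have m: "cc x * e i j * (cc y * e k l) = cc (x * y) * (e i j * e k l)" for x y i j k l
    by (simp only: mult.assoc cc_left_comm [of "e i j"] cc_cc_mult)
  show ?thesis
    unfolding mat_units_def
  proof (intro conjI allI)
    fix a b c d
    show "cc (cnj (z a) * z b) * e (\<tau> a) (\<tau> b) * (cc (cnj (z c) * z d) * e (\<tau> c) (\<tau> d)) =
        (if b = c then cc (cnj (z a) * z d) * e (\<tau> a) (\<tau> d) else 0)"
    proof (cases "b = c")
      case True
      have "cnj (z a) * z c * (cnj (z c) * z d) = cnj (z a) * z d" using zz(2) [of c] by (metis mult.assoc mult_1)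
      then show ?thesis unfolding m True by (simp only: mat_unitsD(1) [OF e] if_True refl)
    next
      case False
      then have "\<tau> b \<noteq> \<tau> c" using \<tau> by (metis bij_def injD)
      then show ?thesis unfolding m using False mat_unitsD(2) [OF e] by simp
    qed
    show "adj (cc (cnj (z a) * z b) * e (\<tau> a) (\<tau> b)) = cc (cnj (z b) * z a) * e (\<tau> b) (\<tau> a)"
      by (simp add: adj_mult mat_unitsD(3) [OF e] cc_comm mult.commute)
    show "minimal_proj (cc (cnj (z a) * z a) * e (\<tau> a) (\<tau> a))" using mat_unitsD(5) [OF e] by (simp add: zz)
  next
    have "(\<Sum>i\<in>UNIV. cc (cnj (z i) * z i) * e (\<tau> i) (\<tau> i)) = (\<Sum>i\<in>UNIV. e (\<tau> i) (\<tau> i))" by (simp add: zz)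
    also have "\<dots> = (\<Sum>i\<in>UNIV. e i i)" using sum.reindex_bij_betw [OF \<tau>, of "\<lambda>i. e i i"] by simp
    finally show "(\<Sum>i\<in>UNIV. cc (cnj (z i) * z i) * e (\<tau> i) (\<tau> i)) = 1" using mat_unitsD(4) [OF e] by simp
  qed
qed

section \<open>Comparison and gluing of frames\<close>

context cartan_field
begin

lemma frameD:
  assumes "frame K e"
  shows "sec K (e i j)" "t \<in> K \<Longrightarrow> mat_units (\<lambda>i j. e i j t)" "t \<in> K \<Longrightarrow> e i i t \<in> Bt t"
  using assms unfolding frame_def by blast+

text \<open>At a point, two commuting families of minimal projections with sum 1 agree up to order.
  The permutation found at t0 persists: by \<open>proj_close_eq\<close> the distance D between
  corresponding projections is 0 or at least 1, and it is continuous on a connected set.\<close>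

lemma frame_permutation:
  assumes K: "K \<subseteq> X" "connected K" "K \<noteq> {}" and e: "frame K e" and e': "frame K e'"
  obtains \<sigma> where "bij \<sigma>" "\<And>t j. t \<in> K \<Longrightarrow> e (\<sigma> j) (\<sigma> j) t = e' j j t"
proof -
  have ex: "\<exists>i. e i i t = e' j j t" if t: "t \<in> K" for t j
  proof -
    note m = frameD(2) [OF e t] and m' = frameD(2) [OF e' t]
    have "\<exists>i. e i i t * e' j j t \<noteq> 0"
    proof (rule ccontr)
      assume "\<not> ?thesis"
      then have "(\<Sum>i\<in>UNIV. e i i t) * e' j j t = 0" unfolding sum_distrib_right by simp
      then show False using mat_unitsD(4) [OF m] mat_units_nonzero [OF m', of j j] by simp
    qed
    then obtain i where i: "e i i t * e' j j t \<noteq> 0" by blast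
    have "t \<in> X" using t K by blast
    then have "e i i t * e' j j t = e' j j t * e i i t"
      using Bt_comm frameD(3) [OF e t] frameD(3) [OF e' t] by blast
    then have "e i i t = e' j j t"
      by (rule minimal_proj_comm_eq [OF mat_unitsD(5) [OF m] mat_unitsD(5) [OF m'] _ i])
    then show ?thesis by blast
  qed
  obtain t0 where t0: "t0 \<in> K" using K by blast
  have "\<forall>j. \<exists>i. e i i t0 = e' j j t0" using ex [OF t0] by blast
  then obtain \<sigma> where \<sigma>: "\<And>j. e (\<sigma> j) (\<sigma> j) t0 = e' j j t0" by metis
  have "inj \<sigma>"
  proof (rule injI, rule ccontr)
    fix i j assume ij: "\<sigma> i = \<sigma> j" "i \<noteq> j"
    note m' = frameD(2) [OF e' t0]
    have "e' i i t0 = e' j j t0" using \<sigma> [of i] \<sigma> [of j] ij(1) by simp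
    moreover have "e' i i t0 * e' j j t0 = 0" by (rule mat_unitsD(2) [OF m' ij(2)])
    ultimately have "e' i i t0 * e' i i t0 = 0" by simp
    then show False using mat_unitsD(1) [OF m', of i i i] mat_units_nonzero [OF m', of i i] by simp
  qed
  then have "bij \<sigma>" by (simp add: bij_def finite_UNIV_inj_surj)
  moreover have "e (\<sigma> j) (\<sigma> j) t = e' j j t" if t: "t \<in> K" for t j
  proof -
    define D where "D = (\<lambda>u. nu u (e (\<sigma> j) (\<sigma> j) u - e' j j u))"
    have Dcont: "continuous_on K D"
      unfolding D_def by (rule sec_nu_cont [OF sec_diff [OF frameD(1) [OF e] frameD(1) [OF e'] K(1)] K(1)])
    have conn: "connected (D ` K)" by (rule connected_continuous_image [OF Dcont K(2)])
    have D0: "D u = 0" if u: "u \<in> K" "D u < 1" for u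
    proof -
      have uX: "u \<in> X" using u K by blast
      note m = frameD(2) [OF e u(1)] and m' = frameD(2) [OF e' u(1)]
      have "e (\<sigma> j) (\<sigma> j) u = e' j j u"
        by (rule proj_close_eq [OF uX mat_unitsD(6) [OF m] mat_unitsD(6) [OF m']
            Bt_comm [OF uX frameD(3) [OF e u(1)] frameD(3) [OF e' u(1)]]])
          (use u(2) in \<open>simp add: D_def\<close>)
      then show ?thesis using uX by (simp add: D_def)
    qed
    have tX: "t \<in> X" "t0 \<in> X" using t t0 K by auto
    have Dt0: "D t0 = 0" using \<sigma> [of j] tX by (simp add: D_def)
    have "D t < 1"
    proof (rule ccontr)
      assume "\<not> D t < 1"
      then have "1/2 \<in> {D t0..D t}" using Dt0 by simp
      moreover have "{D t0..D t} \<subseteq> D ` K"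
        by (rule connected_contains_Icc [OF conn]) (use t t0 in auto)
      ultimately obtain u where "u \<in> K" "D u = 1/2" by (metis imageE subsetD)
      then show False using D0 [of u] by simp
    qed
    then have "D t = 0" by (rule D0 [OF t])
    then show ?thesis using nu_eq_0 [OF tX(1)] by (simp add: D_def)
  qed
  ultimately show ?thesis using that by blast
qed

text \<open>The transition data, a permutation and phases, are known on K only; once extended to the
  whole space they can be used to twist \<open>e'\<close> over all of L.\<close>

lemma frame_adjust:
  assumes K: "K \<subseteq> X" "compact K" "circle_lifts K" and L: "K \<subseteq> L" "L \<subseteq> X" and e: "frame K e" and e': "frame L e'"
  obtains f where "frame L f" "\<And>i j t. t \<in> K \<Longrightarrow> f i j t = e i j t"
proof (cases "K = {}")
  case True
  then show ?thesis using that [OF e'] by blast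
next
  case False
  have e'K: "frame K e'" by (rule frame_mono [OF e' L(1)])
  have conn: "connected K" using K(3) by (simp add: circle_lifts_def)
  obtain \<sigma> where \<sigma>: "bij \<sigma>" "\<And>t j. t \<in> K \<Longrightarrow> e (\<sigma> j) (\<sigma> j) t = e' j j t"
    by (rule frame_permutation [OF K(1) conn False e e'K]) blast
  define o1 :: 'n where "o1 = undefined"
  \<comment> \<open>One column determines a frame, since \<open>e' i j\<close> is
    \<open>e' i o1\<close> times the adjoint of \<open>e' j o1\<close>. So one phase for each index
    is enough.\<close>
  define l where "l = (\<lambda>j t. SOME c. e' j o1 t = cc c * e (\<sigma> j) (\<sigma> o1) t)"
  have l: "e' j o1 t = cc (l j t) * e (\<sigma> j) (\<sigma> o1) t" if t: "t \<in> K" for t j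
  proof -
    note m = frameD(2) [OF e t] and m' = frameD(2) [OF e'K t]
    have "e' j o1 t = e' j j t * e' j o1 t * e' o1 o1 t" by (simp add: mat_unitsD(1) [OF m'])
    also have "\<dots> = e (\<sigma> j) (\<sigma> j) t * e' j o1 t * e (\<sigma> o1) (\<sigma> o1) t" by (simp add: \<sigma>(2) [OF t])
    finally have "\<exists>c. e' j o1 t = cc c * e (\<sigma> j) (\<sigma> o1) t"
      using mat_units_corner [OF m, of "\<sigma> j" "e' j o1 t" "\<sigma> o1"] by simp
    then show ?thesis unfolding l_def by (rule someI_ex)
  qed
  have l1: "cmod (l j t) = 1" if t: "t \<in> K" for t j
  proof -
    have tX: "t \<in> X" using t K by blast
    have "nu t (e' j o1 t) = cmod (l j t) * nu t (e (\<sigma> j) (\<sigma> o1) t)" unfolding l [OF t] by (rule nu_scale [OF tX])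
    then show ?thesis using nu_mat_unit [OF tX frameD(2) [OF e t]] nu_mat_unit [OF tX frameD(2) [OF e'K t]] by simp
  qed
  have lc: "continuous_on K (l j)" for j
  proof (rule sec_coefficient_cont [OF _ frameD(1) [OF e, of "\<sigma> j" "\<sigma> o1"] K(1)])
    show "sec K (\<lambda>t. cc (l j t) * e (\<sigma> j) (\<sigma> o1) t)"
      by (rule sec_cong [OF frameD(1) [OF e'K, of j o1] l])
    show "nu t (e (\<sigma> j) (\<sigma> o1) t) = 1" if "t \<in> K" for t
      using nu_mat_unit [OF _ frameD(2) [OF e that]] that K by blast
  qed
  have "\<exists>\<eta>. continuous_on UNIV \<eta> \<and> (\<forall>t\<in>K. l j t = cis (\<eta> t))" for j
  proof -
    obtain \<theta> :: "'v \<Rightarrow> real" where \<theta>: "continuous_on K \<theta>" "\<And>t. t \<in> K \<Longrightarrow> l j t = cis (\<theta> t)"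
      using K(3) lc [of j] l1 unfolding circle_lifts_def by blast
    have "bounded (\<theta> ` K)" by (intro compact_imp_bounded compact_continuous_image \<theta> K)
    then obtain M where M: "\<And>t. t \<in> K \<Longrightarrow> norm (\<theta> t) \<le> M" unfolding bounded_iff by blast
    have "0 \<le> M" using False M norm_ge_zero order_trans by blast
    moreover have "closedin (top_of_set UNIV) K" using compact_imp_closed [OF K(2)] by simp
    \<comment> \<open>Extending the real argument and exponentiating afterwards keeps the extended
      phases of modulus 1.\<close>
    ultimately obtain \<eta> where "continuous_on UNIV \<eta>" "\<And>t. t \<in> K \<Longrightarrow> \<eta> t = \<theta> t"
      using Tietze [OF \<theta>(1)] M by metis
    then show ?thesis using \<theta>(2) by (intro exI [of _ \<eta>]) auto
  qed
  then obtain \<eta> where \<eta>: "\<And>j. continuous_on UNIV (\<eta> j)" "\<And>t j. t \<in> K \<Longrightarrow> l j t = cis (\<eta> j t)" by metis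
  define \<tau> where "\<tau> = inv \<sigma>"
  have \<tau>: "bij \<tau>" "\<sigma> (\<tau> a) = a" for a
    using \<sigma>(1) bij_imp_bij_inv by (auto simp: \<tau>_def bij_is_surj surj_f_inv_f)
  \<comment> \<open>The phases are indexed through the inverse permutation, so that f carries the
    labels of e.\<close>
  define z where "z = (\<lambda>a t. cis (\<eta> (\<tau> a) t))"
  have zc: "continuous_on A (z a)" for a A
    unfolding z_def by (intro continuous_intros continuous_on_subset [OF \<eta>(1)]) auto
  define f where "f = (\<lambda>a b t. cc (cnj (z a t) * z b t) * e' (\<tau> a) (\<tau> b) t)"
  have "frame L f"
    unfolding frame_def
  proof (intro conjI allI ballI)
    show "sec L (f a b)" for a b
      unfolding f_def by (rule sec_scale [OF frameD(1) [OF e'] L(2)]) (intro continuous_intros zc)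
    fix t assume t: "t \<in> L"
    show "mat_units (\<lambda>i j. f i j t)"
      unfolding f_def by (rule mat_units_twist [OF frameD(2) [OF e' t] \<tau>(1)]) (simp add: z_def)
    show "f i i t \<in> Bt t" for i
      unfolding f_def by (rule Bt_scale [OF _ frameD(3) [OF e' t]]) (use t L in auto)
  qed
  moreover have "f a b t = e a b t" if t: "t \<in> K" for a b t
  proof -
    note m = frameD(2) [OF e t] and m' = frameD(2) [OF e'K t]
    have lz: "l (\<tau> a) t = z a t" for a by (simp add: z_def \<eta>(2) [OF t])
    have "e' (\<tau> a) (\<tau> b) t = e' (\<tau> a) o1 t * adj (e' (\<tau> b) o1 t)" by (simp add: mat_unitsD(1,3) [OF m'])
    also have "\<dots> = (cc (z a t) * e a (\<sigma> o1) t) * adj (cc (z b t) * e b (\<sigma> o1) t)"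
      unfolding l [OF t] lz \<tau>(2) ..
    also have "\<dots> = cc (z a t * cnj (z b t)) * e a b t"
      by (simp add: adj_mult mat_unitsD(3) [OF m] mult.assoc cc_comm)
         (simp only: cc_left_comm [of "e a (\<sigma> o1) t"] mat_unitsD(1) [OF m] cc_cc_mult)
    finally have "f a b t = cc (cnj (z a t) * z b t * (z a t * cnj (z b t))) * e a b t"
      by (simp add: f_def cc_cc_mult)
    also have "cnj (z a t) * z b t * (z a t * cnj (z b t)) = (z a t * cnj (z a t)) * (z b t * cnj (z b t))" by simp
    also have "\<dots> = 1" by (simp add: z_def cis_cnj cis_mult)
    finally show ?thesis by simp
  qed
  ultimately show ?thesis using that by blast
qed

lemma frame_glue:
  assumes K: "K \<subseteq> X" "compact K" and L: "L \<subseteq> X" "compact L" and KL: "circle_lifts (K \<inter> L)"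
    and e: "frame K e" and e': "frame L e'"
  shows "\<exists>f. frame (K \<union> L) f"
proof -
  obtain f where f: "frame L f" "\<And>i j t. t \<in> K \<inter> L \<Longrightarrow> f i j t = e i j t"
    by (rule frame_adjust [OF _ compact_Int [OF K(2) L(2)] KL Int_lower2 L(1) frame_mono [OF e Int_lower1] e'])
      (use K in auto)
  define g where "g = (\<lambda>i j t. if t \<in> K then e i j t else f i j t)"
  have gL: "g i j t = f i j t" if "t \<in> L" for i j t using f(2) that by (simp add: g_def)
  have gK: "g i j t = e i j t" if "t \<in> K" for i j t using that by (simp add: g_def)
  have "frame (K \<union> L) g"
    unfolding frame_def
  proof (intro conjI allI ballI)
    fix i j
    have "sec K (g i j)" by (rule sec_cong [OF frameD(1) [OF e]]) (simp add: gK)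
    moreover have "sec L (g i j)" by (rule sec_cong [OF frameD(1) [OF f(1)]]) (simp add: gL)
    ultimately show "sec (K \<union> L) (g i j)"
      by (rule sec_glue_closed) (use K L compact_imp_closed in auto)
  next
    fix t assume t: "t \<in> K \<union> L"
    show "mat_units (\<lambda>i j. g i j t)" "g i i t \<in> Bt t" for i
      using t frameD(2,3) [OF e] frameD(2,3) [OF f(1)] by (cases "t \<in> K"; simp add: gK gL)+
  qed
  then show ?thesis by blast
qed

section \<open>Frames over images of compact convex sets\<close>

lemma uniform_local_frames:
  obtains \<delta> where "\<delta> > 0" "\<And>t. t \<in> X \<Longrightarrow> \<exists>e. frame (X \<inter> ball t \<delta>) e"
proof -
  define \<G> where "\<G> = {ball t d |t d. \<exists>e. frame (X \<inter> ball t d) e}"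
  have "X \<subseteq> \<Union>\<G>"
  proof
    fix t assume "t \<in> X"
    then obtain d e where "d > 0" "frame (X \<inter> ball t d) e" using local_frame by blast
    then show "t \<in> \<Union>\<G>" unfolding \<G>_def by (intro UnionI [of "ball t d"]) auto
  qed
  \<comment> \<open>A Lebesgue number of the cover by balls that carry frames.\<close>
  then obtain \<epsilon> where \<epsilon>: "0 < \<epsilon>" "\<And>x. x \<in> X \<Longrightarrow> \<exists>G \<in> \<G>. ball x \<epsilon> \<subseteq> G"
    by (rule Heine_Borel_lemma [OF compact_X]) (auto simp: \<G>_def)
  show ?thesis
  proof (rule that [OF \<epsilon>(1)])
    fix t assume "t \<in> X"
    then obtain s d e where "frame (X \<inter> ball s d) e" "ball t \<epsilon> \<subseteq> ball s d" using \<epsilon>(2) unfolding \<G>_def by blast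
    then show "\<exists>e. frame (X \<inter> ball t \<epsilon>) e" using frame_mono [of "X \<inter> ball s d" e "X \<inter> ball t \<epsilon>"] by blast
  qed
qed

text \<open>A compact convex set is cut by hyperplanes into small pieces; two pieces meet in a convex set,
  where frames can be adjusted to agree.\<close>

lemma frame_image_convex:
  fixes \<psi> :: "'v \<Rightarrow> 'v"
  assumes D: "compact D" "convex D" and \<psi>: "continuous_on D \<psi>" "inj_on \<psi> D" "\<psi> ` D \<subseteq> X"
  shows "\<exists>e. frame (\<psi> ` D) e"
proof -
  obtain \<delta> where \<delta>: "\<delta> > 0" "\<And>t. t \<in> X \<Longrightarrow> \<exists>e. frame (X \<inter> ball t \<delta>) e" using uniform_local_frames by blast
  have "uniformly_continuous_on D \<psi>" by (rule compact_uniformly_continuous [OF \<psi>(1) D(1)])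
  then obtain \<eta> where \<eta>: "\<eta> > 0" "\<And>x y. \<lbrakk>x \<in> D; y \<in> D; dist x y < \<eta>\<rbrakk> \<Longrightarrow> dist (\<psi> x) (\<psi> y) < \<delta>"
    using \<delta>(1) unfolding uniformly_continuous_on_def by metis
  \<comment> \<open>A cell whose width is at most w in every coordinate has diameter at most
    \<eta>/2, by the sum norm; its image then lies in a ball that carries a frame.\<close>
  define w where "w = \<eta> / (2 * real DIM('v))"
  have w: "w > 0" using \<eta>(1) by (simp add: w_def)
  have glue: "\<exists>e. frame (\<psi> ` (C1 \<union> C2)) e"
    if C: "C1 \<subseteq> D" "C2 \<subseteq> D" "compact C1" "compact C2" "convex (C1 \<inter> C2)"
      and fr: "\<exists>e. frame (\<psi> ` C1) e" "\<exists>e. frame (\<psi> ` C2) e" for C1 C2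
  proof -
    have cpt: "compact (\<psi> ` C1)" "compact (\<psi> ` C2)"
      by (intro compact_continuous_image continuous_on_subset [OF \<psi>(1)] C)+
    have sub: "\<psi> ` C1 \<subseteq> X" "\<psi> ` C2 \<subseteq> X" using C \<psi>(3) by auto
    have int: "\<psi> ` C1 \<inter> \<psi> ` C2 = \<psi> ` (C1 \<inter> C2)" using inj_on_image_Int [OF \<psi>(2) C(1,2)] by simp
    have "circle_lifts (\<psi> ` (C1 \<inter> C2))"
      by (intro circle_lifts_image_convex C compact_Int continuous_on_subset [OF \<psi>(1)] inj_on_subset [OF \<psi>(2)])
        (use C in auto)
    then have lift: "circle_lifts (\<psi> ` C1 \<inter> \<psi> ` C2)" unfolding int .
    obtain e1 e2 where "frame (\<psi> ` C1) e1" "frame (\<psi> ` C2) e2" using fr by blast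
    then show ?thesis using frame_glue [OF sub(1) cpt(1) sub(2) cpt(2) lift] by (simp add: image_Un)
  qed
  \<comment> \<open>\<open>A\<close> collects the coordinates in which \<open>C\<close> may still be
    wide. The induction adds one such coordinate at a time.\<close>
  have claim: "\<exists>e. frame (\<psi> ` C) e"
    if "finite A" "A \<subseteq> Basis" "C \<subseteq> D" "compact C" "convex C"
      "\<And>b x y. \<lbrakk>b \<in> Basis - A; x \<in> C; y \<in> C\<rbrakk> \<Longrightarrow> \<bar>x \<bullet> b - y \<bullet> b\<bar> \<le> w" for A C
    using that
  proof (induction A arbitrary: C rule: finite_induct)
    case empty
    show ?case
    proof (cases "C = {}")
      case True
      then show ?thesis by (simp add: frame_def sec_def)
    next
      case False
      then obtain c where c: "c \<in> C" by blast
      have "\<psi> x \<in> X \<inter> ball (\<psi> c) \<delta>" if x: "x \<in> C" for x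
      proof -
        have "dist c x \<le> (\<Sum>b\<in>Basis. \<bar>(c - x) \<bullet> b\<bar>)" unfolding dist_norm by (rule norm_le_l1)
        also have "\<dots> \<le> (\<Sum>b\<in>(Basis::'v set). w)"
          by (rule sum_mono) (use empty.prems(5) c x in \<open>simp add: inner_diff_left\<close>)
        also have "\<dots> = \<eta> / 2" by (simp add: w_def)
        finally have "dist c x < \<eta>" using \<eta>(1) by simp
        then show ?thesis using \<eta>(2) [of c x] c x empty.prems(2) \<psi>(3) by auto
      qed
      then have "\<psi> ` C \<subseteq> X \<inter> ball (\<psi> c) \<delta>" by blast
      moreover have "\<psi> c \<in> X" using c empty.prems(2) \<psi>(3) by blast
      ultimately show ?thesis using \<delta>(2) frame_mono by metis
    qed
  next
    case (insert b A)
    have A: "A \<subseteq> Basis" and b: "b \<in> Basis" using insert.prems by auto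
    have thin: "\<exists>e. frame (\<psi> ` C) e"
      if C: "C \<subseteq> D" "compact C" "convex C" and wd: "\<And>c x y. \<lbrakk>c \<in> Basis - insert b A; x \<in> C; y \<in> C\<rbrakk> \<Longrightarrow> \<bar>x \<bullet> c - y \<bullet> c\<bar> \<le> w"
        and wb: "\<And>x y. \<lbrakk>x \<in> C; y \<in> C\<rbrakk> \<Longrightarrow> \<bar>x \<bullet> b - y \<bullet> b\<bar> \<le> w" for C
    proof (rule insert.IH [OF A C])
      fix c x y assume "c \<in> Basis - A" "x \<in> C" "y \<in> C"
      then show "\<bar>x \<bullet> c - y \<bullet> c\<bar> \<le> w" using wd [of c x y] wb [of x y] by (cases "c = b") auto
    qed
    \<comment> \<open>An inner induction on the number m of slices in the direction b.\<close>
    have slab: "\<exists>e. frame (\<psi> ` C) e"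
      if "C \<subseteq> D" "compact C" "convex C" "\<And>c x y. \<lbrakk>c \<in> Basis - insert b A; x \<in> C; y \<in> C\<rbrakk> \<Longrightarrow> \<bar>x \<bullet> c - y \<bullet> c\<bar> \<le> w"
        "\<And>x y. \<lbrakk>x \<in> C; y \<in> C\<rbrakk> \<Longrightarrow> \<bar>x \<bullet> b - y \<bullet> b\<bar> \<le> real m * w" for m C
      using that
    proof (induction m arbitrary: C)
      case 0
      show ?case
      proof (rule thin [OF 0(1-3)])
        show "\<bar>x \<bullet> b - y \<bullet> b\<bar> \<le> w" if "x \<in> C" "y \<in> C" for x y using 0(5) [OF that] w by simp
      qed (use 0(4) in blast)
    next
      case (Suc m)
      show ?case
      proof (cases "C = {}")
        case True
        then show ?thesis by (simp add: frame_def sec_def)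
      next
        case False
        have "continuous_on C (\<lambda>x. x \<bullet> b)" by (intro continuous_intros)
        then obtain x0 where x0: "x0 \<in> C" "\<And>x. x \<in> C \<Longrightarrow> x0 \<bullet> b \<le> x \<bullet> b"
          using continuous_attains_inf [OF Suc.prems(2) False] by blast
        \<comment> \<open>Cutting at height w above the lowest point leaves one slice of width at
          most w and a remainder of width at most m w.\<close>
        define l where "l = x0 \<bullet> b + w"
        define C1 where "C1 = C \<inter> {x. b \<bullet> x \<le> l}"
        define C2 where "C2 = C \<inter> {x. b \<bullet> x \<ge> l}"
        have cpt: "compact C1" "compact C2"
          unfolding C1_def C2_def by (intro compact_Int_closed closed_halfspace_le closed_halfspace_ge Suc.prems)+
        have cvx: "convex C1" "convex C2"
          unfolding C1_def C2_def by (intro convex_Int convex_halfspace_le convex_halfspace_ge Suc.prems)+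
        have sub: "C1 \<subseteq> C" "C2 \<subseteq> C" by (auto simp: C1_def C2_def)
        have f1: "\<exists>e. frame (\<psi> ` C1) e"
        proof (rule thin [OF _ cpt(1) cvx(1)])
          show "C1 \<subseteq> D" using sub Suc.prems by blast
          show "\<bar>x \<bullet> c - y \<bullet> c\<bar> \<le> w" if "c \<in> Basis - insert b A" "x \<in> C1" "y \<in> C1" for c x y
            using Suc.prems(4) that sub by blast
          show "\<bar>x \<bullet> b - y \<bullet> b\<bar> \<le> w" if "x \<in> C1" "y \<in> C1" for x y
            using that x0(2) [of x] x0(2) [of y] by (auto simp: C1_def l_def inner_commute abs_le_iff)
        qed
        have f2: "\<exists>e. frame (\<psi> ` C2) e"
        proof (rule Suc.IH [OF _ cpt(2) cvx(2)])
          show "C2 \<subseteq> D" using sub Suc.prems by blast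
          show "\<bar>x \<bullet> c - y \<bullet> c\<bar> \<le> w" if "c \<in> Basis - insert b A" "x \<in> C2" "y \<in> C2" for c x y
            using Suc.prems(4) that sub by blast
          show "\<bar>x \<bullet> b - y \<bullet> b\<bar> \<le> real m * w" if "x \<in> C2" "y \<in> C2" for x y
          proof -
            have "x \<bullet> b - x0 \<bullet> b \<le> real (Suc m) * w" "y \<bullet> b - x0 \<bullet> b \<le> real (Suc m) * w"
              using Suc.prems(5) [OF _ x0(1), of x] Suc.prems(5) [OF _ x0(1), of y] that sub by (auto simp: abs_le_iff)
            moreover have "x \<bullet> b \<ge> x0 \<bullet> b + w" "y \<bullet> b \<ge> x0 \<bullet> b + w" using that by (auto simp: C2_def l_def inner_commute)
            ultimately show ?thesis by (simp add: abs_le_iff algebra_simps)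
          qed
        qed
        have "\<exists>e. frame (\<psi> ` (C1 \<union> C2)) e"
          by (rule glue [OF _ _ cpt convex_Int [OF cvx] f1 f2]) (use sub Suc.prems in auto)
        moreover have "C1 \<union> C2 = C" by (auto simp: C1_def C2_def)
        ultimately show ?thesis by simp
      qed
    qed
    have "bounded C" using insert.prems compact_imp_bounded by blast
    then obtain M where M: "\<And>x. x \<in> C \<Longrightarrow> norm x \<le> M" unfolding bounded_iff by blast
    obtain m where m: "2 * M < real m * w" using reals_Archimedean3 [OF w] by blast
    show ?case
    proof (rule slab [of C m])
      show "\<bar>x \<bullet> b - y \<bullet> b\<bar> \<le> real m * w" if "x \<in> C" "y \<in> C" for x y
      proof -
        have "\<bar>x \<bullet> b\<bar> \<le> M" "\<bar>y \<bullet> b\<bar> \<le> M" using M that Basis_le_norm [OF b] by (meson order_trans)+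
        then show ?thesis using m by linarith
      qed
    qed (use insert.prems in auto)
  qed
  show ?thesis by (rule claim [OF finite_Basis order_refl order_refl D]) auto
qed

end

text \<open>The equator is the relative frontier of a flat disc. In an ambient space of dimension at
  least 4 this disc has dimension at least 3, so the equator is a sphere of dimension at least 2 and
  simply connected.\<close>

lemma equator_circle_lifts:
  fixes e0 :: "'v::euclidean_space"
  assumes "DIM('v) \<ge> 4" "e0 \<in> Basis"
  shows "circle_lifts (sphere 0 1 \<inter> {x. e0 \<bullet> x = 0})"
proof -
  have e0: "e0 \<noteq> 0" using assms(2) nonzero_Basis by blast
  have int: "interior (cball 0 1) \<inter> {x. e0 \<bullet> x = 0} \<noteq> {}"
  proof -
    have "0 \<in> interior (cball 0 1) \<inter> {x. e0 \<bullet> x = 0}" by simp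
    then show ?thesis by blast
  qed
  have fr: "rel_frontier (cball 0 1 \<inter> {x. e0 \<bullet> x = 0}) = sphere 0 1 \<inter> {x. e0 \<bullet> x = 0}"
    using convex_affine_rel_frontier_Int [OF convex_cball affine_hyperplane int] by simp
  have "aff_dim ({x. e0 \<bullet> x = 0} \<inter> cball 0 1) = aff_dim {x. e0 \<bullet> x = 0}"
    by (rule aff_dim_convex_Int_nonempty_interior) (use int in \<open>auto simp: convex_hyperplane\<close>)
  also have "\<dots> = int DIM('v) - 1" by (simp add: aff_dim_hyperplane [OF e0])
  finally have dim: "3 \<le> aff_dim (cball 0 1 \<inter> {x. e0 \<bullet> x = 0})" using assms(1) by (simp add: Int_commute)
  have cb: "convex (cball 0 1 \<inter> {x. e0 \<bullet> x = 0})" "bounded (cball 0 1 \<inter> {x. e0 \<bullet> x = 0})"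
    by (auto intro: convex_Int convex_hyperplane bounded_Int)
  show ?thesis
    using circle_lifts_simply_connected [OF simply_connected_sphere_gen [OF cb dim] locally_path_connected_sphere_gen [OF cb(2,1)]]
    unfolding fr .
qed

context cartan_field
begin

lemma sphere_frame:
  assumes X: "X = sphere 0 1" and dim: "DIM('v) \<ge> 4"
  shows "\<exists>e. frame X e"
proof -
  obtain e0 :: 'v where e0: "e0 \<in> Basis" using nonempty_Basis by blast
  define D where "D = cball 0 1 \<inter> {x. e0 \<bullet> x = 0}"
  have D: "compact D" "convex D"
    unfolding D_def by (auto intro!: compact_Int_closed convex_Int closed_hyperplane convex_hyperplane)
  have ee: "e0 \<bullet> e0 = 1" using e0 by simp
  have hemi: "\<exists>e. frame {x \<in> X. s * (e0 \<bullet> x) \<ge> 0} e" if s: "s = 1 \<or> s = -1" for s :: real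
  proof -
    \<comment> \<open>The graph map of the hemisphere on the side of s e0 over the flat equatorial
      disc; removing the e0 component inverts it.\<close>
    define \<psi> where "\<psi> = (\<lambda>x. x + (s * sqrt (1 - (norm x)\<^sup>2)) *\<^sub>R e0)"
    have ss: "s * s = 1" using s by auto
    have norm: "(norm (x + r *\<^sub>R e0))\<^sup>2 = (norm x)\<^sup>2 + r\<^sup>2" if "e0 \<bullet> x = 0" for x r
    proof -
      have "x \<bullet> e0 = 0" using that by (simp add: inner_commute)
      then show ?thesis unfolding power2_norm_eq_inner
        using that ee by (simp add: inner_add_left inner_add_right power2_eq_square)
    qed
    have pos: "1 - (norm x)\<^sup>2 \<ge> 0" if "x \<in> D" for x using that by (auto simp: D_def abs_square_le_1)
    have im: "\<psi> ` D = {x \<in> X. s * (e0 \<bullet> x) \<ge> 0}"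
    proof (intro subset_antisym subsetI)
      fix y assume "y \<in> \<psi> ` D"
      then obtain x where x: "x \<in> D" "y = \<psi> x" by blast
      then have ex: "e0 \<bullet> x = 0" by (simp add: D_def)
      have "(s * sqrt (1 - (norm x)\<^sup>2))\<^sup>2 = 1 - (norm x)\<^sup>2"
        using pos [OF x(1)] ss by (simp add: power_mult_distrib power2_eq_square [of s])
      then have "(norm y)\<^sup>2 = 1" unfolding x(2) \<psi>_def norm [OF ex] by simp
      then have "norm y = 1" using norm_ge_zero [of y] by (auto simp: power2_eq_1_iff)
      moreover have "e0 \<bullet> y = s * sqrt (1 - (norm x)\<^sup>2)" unfolding x(2) \<psi>_def using ex ee by (simp add: inner_add_right)
      then have "s * (e0 \<bullet> y) = sqrt (1 - (norm x)\<^sup>2)" using ss by (simp add: mult.assoc [symmetric])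
      ultimately show "y \<in> {x \<in> X. s * (e0 \<bullet> x) \<ge> 0}" using pos [OF x(1)] X by simp
    next
      fix y assume y: "y \<in> {x \<in> X. s * (e0 \<bullet> x) \<ge> 0}"
      define x where "x = y - (e0 \<bullet> y) *\<^sub>R e0"
      have ex: "e0 \<bullet> x = 0" using ee by (simp add: x_def inner_diff_right)
      have yx: "y = x + (e0 \<bullet> y) *\<^sub>R e0" by (simp add: x_def)
      have "(norm y)\<^sup>2 = 1" using y X by simp
      then have n: "(norm x)\<^sup>2 + (e0 \<bullet> y)\<^sup>2 = 1" using norm [OF ex, of "e0 \<bullet> y"] yx by simp
      then have "(norm x)\<^sup>2 \<le> 1" by (metis le_add_same_cancel1 zero_le_power2)
      then have "x \<in> D" using ex by (simp add: D_def abs_square_le_1)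
      moreover have "s * sqrt (1 - (norm x)\<^sup>2) = e0 \<bullet> y"
      proof -
        have "1 - (norm x)\<^sup>2 = (s * (e0 \<bullet> y))\<^sup>2" using n ss by (simp add: power_mult_distrib power2_eq_square [of s])
        then have "sqrt (1 - (norm x)\<^sup>2) = s * (e0 \<bullet> y)" using y by (simp add: real_sqrt_abs)
        then show ?thesis using ss by (simp add: mult.assoc [symmetric])
      qed
      then have "y = \<psi> x" using yx by (simp add: \<psi>_def)
      ultimately show "y \<in> \<psi> ` D" by blast
    qed
    have "inj_on \<psi> D"
    proof (rule inj_onI)
      fix x y assume xy: "x \<in> D" "y \<in> D" "\<psi> x = \<psi> y"
      have p: "\<psi> x - (e0 \<bullet> \<psi> x) *\<^sub>R e0 = x" if "x \<in> D" for x
        using that ee by (simp add: D_def \<psi>_def inner_add_right)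
      show "x = y" using p [OF xy(1)] p [OF xy(2)] xy(3) by metis
    qed
    moreover have "continuous_on D \<psi>" unfolding \<psi>_def by (intro continuous_intros)
    ultimately have "\<exists>e. frame (\<psi> ` D) e" using im by (intro frame_image_convex D) auto
    then show ?thesis unfolding im .
  qed
  define K where "K = {x \<in> X. e0 \<bullet> x \<ge> 0}"
  define L where "L = {x \<in> X. e0 \<bullet> x \<le> 0}"
  have KL: "K = X \<inter> {x. e0 \<bullet> x \<ge> 0}" "L = X \<inter> {x. e0 \<bullet> x \<le> 0}" by (auto simp: K_def L_def)
  have cpt: "compact K" "compact L"
    unfolding KL by (intro compact_Int_closed compact_X closed_halfspace_ge closed_halfspace_le)+
  have "K \<inter> L = sphere 0 1 \<inter> {x. e0 \<bullet> x = 0}" unfolding KL X by auto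
  then have lift: "circle_lifts (K \<inter> L)" using equator_circle_lifts [OF dim e0] by simp
  obtain e where e: "frame K e" using hemi [of 1] by (auto simp: K_def)
  obtain e' where e': "frame L e'" using hemi [of "-1"] by (auto simp: L_def)
  have "K \<union> L = X" by (auto simp: K_def L_def)
  then show ?thesis using frame_glue [OF _ cpt(1) _ cpt(2) lift e e'] by (auto simp: K_def L_def)
qed

end

section \<open>Continuous sections of C*-bundles\<close>

text \<open>A C*-bundle whose fibres have been identified (discontinuously) with \<open>M\<^sub>n\<close>: \<open>Op\<close> is the topology
  of the total space, transported to \<open>X \<times> M\<^sub>n\<close>.\<close>

locale mat_bundle = norm_field X nu
  for X :: "'v::euclidean_space set" and nu :: "'v \<Rightarrow> 'n::finite cmat \<Rightarrow> real" +
  fixes Op :: "('v \<times> 'n cmat) set set"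
  assumes Op_Int: "\<lbrakk>U \<in> Op; V \<in> Op\<rbrakk> \<Longrightarrow> U \<inter> V \<in> Op"
    and Op_proj: "\<lbrakk>U \<in> Op; (t, x) \<in> U; t \<in> X\<rbrakk> \<Longrightarrow> \<forall>\<^sub>F u in at t within X. \<exists>y. (u, y) \<in> U"
    and Op_base: "\<lbrakk>t \<in> X; d > 0\<rbrakk> \<Longrightarrow> {(u, x). u \<in> X \<and> dist u t < d} \<in> Op"
    and Op_norm: "open R \<Longrightarrow> {(u, x). u \<in> X \<and> nu u x \<in> R} \<in> Op"
    and Op_zero: "\<lbrakk>U \<in> Op; (t, 0) \<in> U; t \<in> X\<rbrakk> \<Longrightarrow>
      \<exists>d>0. \<exists>e>0. \<forall>u\<in>X. dist u t < d \<longrightarrow> (\<forall>x. nu u x < e \<longrightarrow> (u, x) \<in> U)"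
    and Op_add: "\<lbrakk>U \<in> Op; (t, x + y) \<in> U; t \<in> X\<rbrakk> \<Longrightarrow>
      \<exists>V\<in>Op. \<exists>W\<in>Op. (t, x) \<in> V \<and> (t, y) \<in> W \<and> (\<forall>u\<in>X. \<forall>x' y'. (u, x') \<in> V \<longrightarrow> (u, y') \<in> W \<longrightarrow> (u, x' + y') \<in> U)"
    and Op_mult: "\<lbrakk>U \<in> Op; (t, x * y) \<in> U; t \<in> X\<rbrakk> \<Longrightarrow>
      \<exists>V\<in>Op. \<exists>W\<in>Op. (t, x) \<in> V \<and> (t, y) \<in> W \<and> (\<forall>u\<in>X. \<forall>x' y'. (u, x') \<in> V \<longrightarrow> (u, y') \<in> W \<longrightarrow> (u, x' * y') \<in> U)"
    and Op_scale: "U \<in> Op \<Longrightarrow> {(u, x). u \<in> X \<and> (u, cc c * x) \<in> U} \<in> Op"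
    and Op_adj: "U \<in> Op \<Longrightarrow> {(u, x). u \<in> X \<and> (u, adj x) \<in> U} \<in> Op"
    and fibre_complete: "\<lbrakk>t \<in> X; \<And>e. e > 0 \<Longrightarrow> \<exists>N. \<forall>i\<ge>N. \<forall>j\<ge>N. nu t (s i - s j) < e\<rbrakk> \<Longrightarrow>
      \<exists>x. (\<lambda>i::nat. nu t (s i - x)) \<longlonglongrightarrow> 0"
begin

definition cont_at :: "'v \<Rightarrow> ('v \<Rightarrow> 'n cmat) \<Rightarrow> bool" where
  "cont_at t s \<longleftrightarrow> (\<forall>U\<in>Op. (t, s t) \<in> U \<longrightarrow> (\<forall>\<^sub>F u in at t within X. (u, s u) \<in> U))"

definition sections :: "('v \<Rightarrow> 'n cmat) set" where
  "sections = {s. \<forall>t\<in>X. cont_at t s}"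

lemma ev_X: "\<forall>\<^sub>F u in at t within X. u \<in> X"
  by (simp add: eventually_at_filter)

text \<open>Continuity of addition at (x, 0) together with the neighbourhoods of zero: an open set
  absorbs small perturbations of the points of a smaller open set, uniformly over the base points
  near t.\<close>

lemma thick:
  assumes U: "U \<in> Op" "(t, x) \<in> U" and t: "t \<in> X"
  obtains V \<epsilon> where "V \<in> Op" "(t, x) \<in> V" "\<epsilon> > 0"
    "\<And>u y z. \<lbrakk>u \<in> X; (u, y) \<in> V; nu u (z - y) < \<epsilon>\<rbrakk> \<Longrightarrow> (u, z) \<in> U"
proof -
  have "(t, x + 0) \<in> U" using U by simp
  then obtain V W where VW: "V \<in> Op" "W \<in> Op" "(t, x) \<in> V" "(t, 0) \<in> W"
    "\<And>u x' y'. \<lbrakk>u \<in> X; (u, x') \<in> V; (u, y') \<in> W\<rbrakk> \<Longrightarrow> (u, x' + y') \<in> U"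
    using Op_add [OF U(1) _ t] by metis
  obtain d e where de: "d > 0" "e > 0" "\<And>u x. \<lbrakk>u \<in> X; dist u t < d; nu u x < e\<rbrakk> \<Longrightarrow> (u, x) \<in> W"
    using Op_zero [OF VW(2,4) t] by blast
  show ?thesis
  proof (rule that [OF Op_Int [OF VW(1) Op_base [OF t de(1)]] _ de(2)])
    show "(t, x) \<in> V \<inter> {(u, x). u \<in> X \<and> dist u t < d}" using VW t de by simp
    fix u y z assume u: "u \<in> X" "(u, y) \<in> V \<inter> {(u, x). u \<in> X \<and> dist u t < d}" "nu u (z - y) < e"
    have "(u, y + (z - y)) \<in> U" by (rule VW(5)) (use u de in auto)
    then show "(u, z) \<in> U" by simp
  qed
qed

text \<open>\<open>tol t s \<alpha>\<close> says that \<open>s\<close> is continuous at \<open>t\<close> up to an error \<open>\<alpha>\<close> in norm.\<close>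

definition tol :: "'v \<Rightarrow> ('v \<Rightarrow> 'n cmat) \<Rightarrow> real \<Rightarrow> bool" where
  "tol t s \<alpha> \<longleftrightarrow> (\<forall>U\<in>Op. (t, s t) \<in> U \<longrightarrow> (\<forall>\<eta>>0. \<forall>\<^sub>F u in at t within X. \<exists>x. (u, x) \<in> U \<and> nu u (s u - x) < \<alpha> + \<eta>))"

lemma tolD:
  "\<lbrakk>tol t s \<alpha>; U \<in> Op; (t, s t) \<in> U; \<eta> > 0\<rbrakk> \<Longrightarrow> \<forall>\<^sub>F u in at t within X. \<exists>x. (u, x) \<in> U \<and> nu u (s u - x) < \<alpha> + \<eta>"
  unfolding tol_def by blast

lemma tol_add:
  assumes t: "t \<in> X" and s: "tol t s \<alpha>" and s': "tol t s' \<beta>"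
  shows "tol t (\<lambda>u. s u + s' u) (\<alpha> + \<beta>)"
  unfolding tol_def
proof (intro ballI impI allI)
  fix U and \<eta> :: real assume U: "U \<in> Op" "(t, s t + s' t) \<in> U" and \<eta>: "\<eta> > 0"
  obtain V W where VW: "V \<in> Op" "W \<in> Op" "(t, s t) \<in> V" "(t, s' t) \<in> W"
    "\<And>u x' y'. \<lbrakk>u \<in> X; (u, x') \<in> V; (u, y') \<in> W\<rbrakk> \<Longrightarrow> (u, x' + y') \<in> U"
    using Op_add [OF U t] by metis
  have \<eta>2: "\<eta> / 2 > 0" using \<eta> by simp
  from tolD [OF s VW(1,3) \<eta>2] tolD [OF s' VW(2,4) \<eta>2] ev_X
  show "\<forall>\<^sub>F u in at t within X. \<exists>x. (u, x) \<in> U \<and> nu u (s u + s' u - x) < \<alpha> + \<beta> + \<eta>"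
  proof eventually_elim
    case (elim u)
    then obtain x y where xy: "(u, x) \<in> V" "nu u (s u - x) < \<alpha> + \<eta>/2" "(u, y) \<in> W" "nu u (s' u - y) < \<beta> + \<eta>/2" by blast
    have "nu u (s u + s' u - (x + y)) \<le> nu u (s u - x) + nu u (s' u - y)"
      using nu_triangle [OF elim(3), of "s u - x" "s' u - y"] by (simp add: algebra_simps)
    also have "\<dots> < \<alpha> + \<beta> + \<eta>" using xy by simp
    finally show ?case using VW(5) [OF elim(3) xy(1,3)] by blast
  qed
qed

lemma tol_scale:
  assumes t: "t \<in> X" and s: "tol t s \<alpha>"
  shows "tol t (\<lambda>u. cc c * s u) (cmod c * \<alpha>)"
  unfolding tol_def
proof (intro ballI impI allI)
  fix U and \<eta> :: real assume U: "U \<in> Op" "(t, cc c * s t) \<in> U" and \<eta>: "\<eta> > 0"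
  define V where "V = {(u, x). u \<in> X \<and> (u, cc c * x) \<in> U}"
  define \<kappa> where "\<kappa> = \<eta> / (cmod c + 1)"
  have c1: "cmod c + 1 > 0" using norm_ge_zero [of c] by linarith
  have \<kappa>: "\<kappa> > 0" using \<eta> c1 by (simp add: \<kappa>_def)
  have "cmod c * \<kappa> < (cmod c + 1) * \<kappa>" using \<kappa> by simp
  also have "\<dots> = \<eta>" using c1 by (simp add: \<kappa>_def)
  finally have \<kappa>\<eta>: "cmod c * \<kappa> < \<eta>" .
  have V: "V \<in> Op" "(t, s t) \<in> V" using Op_scale [OF U(1)] U t by (auto simp: V_def)
  from tolD [OF s V \<kappa>] ev_X
  show "\<forall>\<^sub>F u in at t within X. \<exists>x. (u, x) \<in> U \<and> nu u (cc c * s u - x) < cmod c * \<alpha> + \<eta>"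
  proof eventually_elim
    case (elim u)
    then obtain x where x: "(u, x) \<in> V" "nu u (s u - x) < \<alpha> + \<kappa>" by blast
    have "nu u (cc c * s u - cc c * x) = cmod c * nu u (s u - x)"
      using nu_scale [OF elim(2), of c "s u - x"] by (simp add: right_diff_distrib)
    also have "\<dots> \<le> cmod c * (\<alpha> + \<kappa>)" using x by (intro mult_left_mono) auto
    also have "\<dots> < cmod c * \<alpha> + \<eta>" using \<kappa>\<eta> by (simp add: distrib_left)
    finally show ?case using x(1) by (auto simp: V_def)
  qed
qed

lemma tol_perturb:
  assumes t: "t \<in> X" and s: "tol t s \<alpha>" and lim: "((\<lambda>u. nu u (s' u - s u)) \<longlongrightarrow> 0) (at t within X)" and eq: "s' t = s t"
  shows "tol t s' \<alpha>"
  unfolding tol_def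
proof (intro ballI impI allI)
  fix U and \<eta> :: real assume U: "U \<in> Op" "(t, s' t) \<in> U" and \<eta>: "\<eta> > 0"
  have \<eta>2: "\<eta> / 2 > 0" using \<eta> by simp
  have U': "(t, s t) \<in> U" using U eq by simp
  from tolD [OF s U(1) U' \<eta>2] order_tendstoD(2) [OF lim \<eta>2] ev_X
  show "\<forall>\<^sub>F u in at t within X. \<exists>x. (u, x) \<in> U \<and> nu u (s' u - x) < \<alpha> + \<eta>"
  proof eventually_elim
    case (elim u)
    then obtain x where x: "(u, x) \<in> U" "nu u (s u - x) < \<alpha> + \<eta>/2" by blast
    have "nu u (s' u - x) < \<alpha> + \<eta>" using nu_diff_triangle [OF elim(3), of "s' u" x "s u"] x elim(2) by simp
    then show ?case using x by blast
  qed
qed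

lemma tol_zero: assumes t: "t \<in> X" shows "tol t (\<lambda>u. 0) 0"
  unfolding tol_def
proof (intro ballI impI allI)
  fix U and \<eta> :: real assume U: "U \<in> Op" "(t, 0) \<in> U" and \<eta>: "\<eta> > 0"
  obtain d e where de: "d > 0" "e > 0" "\<And>u x. \<lbrakk>u \<in> X; dist u t < d; nu u x < e\<rbrakk> \<Longrightarrow> (u, x) \<in> U"
    using Op_zero [OF U t] by blast
  show "\<forall>\<^sub>F u in at t within X. \<exists>x. (u, x) \<in> U \<and> nu u (0 - x) < 0 + \<eta>"
    unfolding eventually_at
    by (intro exI [of _ d] conjI de(1) ballI impI exI [of _ 0]) (use de \<eta> in auto)
qed

text \<open>One unit of slack comes from the norm neighbourhood, the other from taking \<eta> =
  1.\<close>

lemma tol_norm_bound: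
  assumes t: "t \<in> X" and s: "tol t s \<alpha>"
  shows "\<forall>\<^sub>F u in at t within X. nu u (s u) < nu t (s t) + \<alpha> + 2"
proof -
  define U where "U = {(u, x). u \<in> X \<and> nu u x \<in> {..<nu t (s t) + 1}}"
  have U: "U \<in> Op" "(t, s t) \<in> U" unfolding U_def using Op_norm [OF open_lessThan] t by auto
  from tolD [OF s U zero_less_one] ev_X show ?thesis
  proof eventually_elim
    case (elim u)
    then obtain x where x: "(u, x) \<in> U" "nu u (s u - x) < \<alpha> + 1" by blast
    then show ?case using nu_triangle [OF elim(2), of "s u - x" x] by (simp add: U_def)
  qed
qed

lemma tol_scalar:
  assumes t: "t \<in> X" and s: "tol t s \<alpha>" and f: "(f \<longlongrightarrow> f t) (at t within X)"
  shows "tol t (\<lambda>u. cc (f u) * s u) (cmod (f t) * \<alpha>)"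
proof (rule tol_perturb [OF t tol_scale [OF t s, of "f t"]])
  define M where "M = nu t (s t) + \<alpha> + 2"
  have "((\<lambda>u. cmod (f u - f t) * M) \<longlongrightarrow> cmod (f t - f t) * M) (at t within X)"
    by (intro tendsto_intros f)
  then have lim: "((\<lambda>u. cmod (f u - f t) * M) \<longlongrightarrow> 0) (at t within X)" by simp
  show "((\<lambda>u. nu u (cc (f u) * s u - cc (f t) * s u)) \<longlongrightarrow> 0) (at t within X)"
  proof (rule tendsto_sandwich [OF _ _ tendsto_const lim])
    show "\<forall>\<^sub>F u in at t within X. 0 \<le> nu u (cc (f u) * s u - cc (f t) * s u)"
      using ev_X by eventually_elim (rule nu_nonneg)
    from tol_norm_bound [OF t s] ev_X
    show "\<forall>\<^sub>F u in at t within X. nu u (cc (f u) * s u - cc (f t) * s u) \<le> cmod (f u - f t) * M"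
    proof eventually_elim
      case (elim u)
      have "nu u (cc (f u) * s u - cc (f t) * s u) = cmod (f u - f t) * nu u (s u)"
        using nu_scale [OF elim(2), of "f u - f t" "s u"] by (simp add: cc_diff left_diff_distrib)
      then show ?case using elim(1) by (simp add: M_def mult_left_mono)
    qed
  qed
qed simp

lemma tol_sum:
  assumes t: "t \<in> X" and "\<And>i. i \<in> I \<Longrightarrow> tol t (s i) (\<alpha> i)"
  shows "tol t (\<lambda>u. \<Sum>i\<in>I. s i u) (\<Sum>i\<in>I. \<alpha> i)"
  using assms(2) by (induction I rule: infinite_finite_induct) (simp_all add: tol_zero [OF t] tol_add [OF t])

lemma cont_at_uniform_limit:
  assumes t: "t \<in> X" and s: "\<And>n. tol t (s n) (\<alpha> n)" and \<alpha>: "\<alpha> \<longlonglongrightarrow> 0" and \<delta>: "\<delta> \<longlonglongrightarrow> 0"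
    and close: "\<And>n u. u \<in> X \<Longrightarrow> nu u (f u - s n u) \<le> \<delta> n"
  shows "cont_at t f"
  unfolding cont_at_def
proof (intro ballI impI)
  fix U assume U: "U \<in> Op" "(t, f t) \<in> U"
  obtain V \<epsilon> where V: "V \<in> Op" "(t, f t) \<in> V" "\<epsilon> > 0"
    "\<And>u y z. \<lbrakk>u \<in> X; (u, y) \<in> V; nu u (z - y) < \<epsilon>\<rbrakk> \<Longrightarrow> (u, z) \<in> U" using thick [OF U t] by blast
  \<comment> \<open>The second thickening places \<open>s n t\<close> itself in V, where its
    tolerance can be used; the first absorbs the distance from f u to the approximating
    point.\<close>
  obtain V' \<epsilon>' where V': "(t, f t) \<in> V'" "\<epsilon>' > 0"
    "\<And>u y z. \<lbrakk>u \<in> X; (u, y) \<in> V'; nu u (z - y) < \<epsilon>'\<rbrakk> \<Longrightarrow> (u, z) \<in> V" using thick [OF V(1,2) t] by metis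
  have e3: "\<epsilon>/3 > 0" "min \<epsilon>' (\<epsilon>/3) > 0" using V V' by auto
  have "\<forall>\<^sub>F n in sequentially. \<alpha> n < \<epsilon>/3 \<and> \<delta> n < min \<epsilon>' (\<epsilon>/3)"
    by (intro eventually_conj order_tendstoD(2) [OF \<alpha> e3(1)] order_tendstoD(2) [OF \<delta> e3(2)])
  then obtain n where n: "\<alpha> n < \<epsilon>/3" "\<delta> n < \<epsilon>'" "\<delta> n < \<epsilon>/3" unfolding eventually_sequentially by auto
  have "(t, s n t) \<in> V"
    by (rule V'(3) [OF t V'(1)]) (use close [OF t, of n] n nu_diff_comm [OF t, of "f t" "s n t"] in linarith)
  from tolD [OF s V(1) this e3(1)] ev_X show "\<forall>\<^sub>F u in at t within X. (u, f u) \<in> U"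
  proof eventually_elim
    case (elim u)
    then obtain x where x: "(u, x) \<in> V" "nu u (s n u - x) < \<alpha> n + \<epsilon>/3" by blast
    have "nu u (f u - x) < \<epsilon>"
      using nu_diff_triangle [OF elim(2), of "f u" x "s n u"] close [OF elim(2), of n] x n by linarith
    then show ?case by (rule V(4) [OF elim(2) x(1)])
  qed
qed

text \<open>Continuity of subtraction at (x, x), written as addition of x and its negative: nearby
  points over the same base point are close in norm.\<close>

lemma thin_nhd:
  assumes t: "t \<in> X" and \<beta>: "\<beta> > 0"
  obtains W where "W \<in> Op" "(t, x) \<in> W" "\<And>u y z. \<lbrakk>u \<in> X; (u, y) \<in> W; (u, z) \<in> W\<rbrakk> \<Longrightarrow> nu u (y - z) < \<beta>"
proof -
  define U where "U = {(u, x). u \<in> X \<and> nu u x \<in> {..<\<beta>}}"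
  have U: "U \<in> Op" "(t, x + (- x)) \<in> U" unfolding U_def using Op_norm [OF open_lessThan] t \<beta> by auto
  obtain V W where VW: "V \<in> Op" "W \<in> Op" "(t, x) \<in> V" "(t, - x) \<in> W"
    "\<And>u x' y'. \<lbrakk>u \<in> X; (u, x') \<in> V; (u, y') \<in> W\<rbrakk> \<Longrightarrow> (u, x' + y') \<in> U"
    using Op_add [OF U t] by metis
  define W' where "W' = {(u, x). u \<in> X \<and> (u, cc (-1) * x) \<in> W}"
  show ?thesis
  proof (rule that)
    show "V \<inter> W' \<in> Op" unfolding W'_def by (rule Op_Int [OF VW(1) Op_scale [OF VW(2)]])
    show "(t, x) \<in> V \<inter> W'" using VW t by (simp add: W'_def cc_minus)
    fix u y z assume u: "u \<in> X" "(u, y) \<in> V \<inter> W'" "(u, z) \<in> V \<inter> W'"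
    have "(u, y + (- z)) \<in> U" by (rule VW(5)) (use u in \<open>auto simp: W'_def cc_minus\<close>)
    then show "nu u (y - z) < \<beta>" by (simp add: U_def)
  qed
qed

text \<open>One step of the construction of Douady and dal Soglio-Herault: choose values in thin open sets
  near those of \<open>s\<close> and average them with a partition of unity.\<close>

lemma improve:
  assumes s: "\<And>t. t \<in> X \<Longrightarrow> tol t s \<alpha>" and \<alpha>: "\<alpha> > 0" and \<beta>: "\<beta> > 0" and t0: "t0 \<in> X"
  obtains s' where "\<And>t. t \<in> X \<Longrightarrow> tol t s' \<beta>" "\<And>t. t \<in> X \<Longrightarrow> nu t (s' t - s t) \<le> 2 * \<alpha>" "s' t0 = s t0"
proof -
  \<comment> \<open>The condition \<open>d \<le> dist p t0\<close> keeps t0 out of the patches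
    centred elsewhere. Only the patch of t0 then carries weight at t0, which yields
    \<open>s' t0 = s t0\<close>. The bound 2 \<alpha> is the tolerance \<alpha> with slack \<eta> =
    \<alpha>.\<close>
  define R where "R = (\<lambda>p d g W. d > 0 \<and> (p \<noteq> t0 \<longrightarrow> d \<le> dist p t0) \<and> W \<in> Op \<and> g p = s p \<and>
      (\<forall>u\<in>X. dist u p < d \<longrightarrow> (u, g u) \<in> W \<and> nu u (g u - s u) \<le> 2 * \<alpha>) \<and>
      (\<forall>u\<in>X. \<forall>y z. (u, y) \<in> W \<longrightarrow> (u, z) \<in> W \<longrightarrow> nu u (y - z) < \<beta>))"
  have "\<exists>d g W. R p d g W" if p: "p \<in> X" for p
  proof -
    obtain W where W: "W \<in> Op" "(p, s p) \<in> W" "\<And>u y z. \<lbrakk>u \<in> X; (u, y) \<in> W; (u, z) \<in> W\<rbrakk> \<Longrightarrow> nu u (y - z) < \<beta>"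
      using thin_nhd [OF p \<beta>, of "s p"] by metis
    obtain d where d: "d > 0" "\<And>u. \<lbrakk>u \<in> X; u \<noteq> p; dist u p < d\<rbrakk> \<Longrightarrow> \<exists>x. (u, x) \<in> W \<and> nu u (s u - x) < \<alpha> + \<alpha>"
      using tolD [OF s [OF p] W(1,2) \<alpha>] unfolding eventually_at by blast
    define g where "g = (\<lambda>u. if u = p then s p else SOME x. (u, x) \<in> W \<and> nu u (s u - x) < \<alpha> + \<alpha>)"
    have g: "(u, g u) \<in> W \<and> nu u (g u - s u) \<le> 2 * \<alpha>" if u: "u \<in> X" "dist u p < d" for u
    proof (cases "u = p")
      case True
      then show ?thesis using W(2) p \<alpha> by (simp add: g_def)
    next
      case False
      then have "(u, g u) \<in> W \<and> nu u (s u - g u) < \<alpha> + \<alpha>"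
        using someI_ex [OF d(2) [OF u(1) False u(2)]] by (simp add: g_def)
      then show ?thesis using nu_diff_comm [OF u(1), of "s u" "g u"] by simp
    qed
    define d' where "d' = (if p = t0 then d else min d (dist p t0))"
    have d': "d' > 0" "p \<noteq> t0 \<longrightarrow> d' \<le> dist p t0" "d' \<le> d" using d(1) by (auto simp: d'_def)
    have "g p = s p" by (simp add: g_def)
    then have "R p d' g W" unfolding R_def using d' g W(1,3) by auto
    then show ?thesis by blast
  qed
  then obtain d g W where dgW0: "\<And>p. p \<in> X \<Longrightarrow> R p (d p) (g p) (W p)" by metis
  have dgW: "\<And>p. p \<in> X \<Longrightarrow> d p > 0" "\<And>p. \<lbrakk>p \<in> X; p \<noteq> t0\<rbrakk> \<Longrightarrow> d p \<le> dist p t0"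
    "\<And>p. p \<in> X \<Longrightarrow> W p \<in> Op" "\<And>p. p \<in> X \<Longrightarrow> g p p = s p"
    "\<And>p u. \<lbrakk>p \<in> X; u \<in> X; dist u p < d p\<rbrakk> \<Longrightarrow> (u, g p u) \<in> W p"
    "\<And>p u. \<lbrakk>p \<in> X; u \<in> X; dist u p < d p\<rbrakk> \<Longrightarrow> nu u (g p u - s u) \<le> 2 * \<alpha>"
    "\<And>p u y z. \<lbrakk>p \<in> X; u \<in> X; (u, y) \<in> W p; (u, z) \<in> W p\<rbrakk> \<Longrightarrow> nu u (y - z) < \<beta>"
    using dgW0 unfolding R_def by blast+
  have "X \<subseteq> (\<Union>p\<in>X. ball p (d p / 2))" using dgW(1) by force
  then obtain F where F: "F \<subseteq> X" "finite F" "X \<subseteq> (\<Union>p\<in>F. ball p (d p / 2))"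
    using compactE_image [OF compact_X, of X "\<lambda>p. ball p (d p / 2)"] by auto
  have dF: "d p > 0" if "p \<in> F" for p using dgW(1) F(1) that by blast
  \<comment> \<open>The weights are supported in half the radius, so each one already vanishes near
    points where the values of g p are uncontrolled.\<close>
  define \<psi> where "\<psi> = (\<lambda>p u. max 0 (d p / 2 - dist u p))"
  define \<Psi> where "\<Psi> = (\<lambda>u. \<Sum>p\<in>F. \<psi> p u)"
  have \<psi>0: "\<psi> p u \<ge> 0" for p u by (simp add: \<psi>_def)
  have \<psi>c: "continuous_on A (\<psi> p)" for p A unfolding \<psi>_def by (intro continuous_intros)
  have \<Psi>: "\<Psi> u > 0" if u: "u \<in> X" for u
  proof -
    obtain p where p: "p \<in> F" "dist u p < d p / 2" using F(3) u by (auto simp: dist_commute)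
    then have "0 < \<psi> p u" by (simp add: \<psi>_def)
    also have "\<dots> \<le> \<Psi> u" unfolding \<Psi>_def by (rule member_le_sum) (use p F \<psi>0 in auto)
    finally show ?thesis .
  qed
  define \<phi> where "\<phi> = (\<lambda>p u. \<psi> p u / \<Psi> u)"
  have \<phi>c: "continuous_on X (\<phi> p)" for p
    unfolding \<phi>_def \<Psi>_def using \<Psi> by (intro continuous_intros \<psi>c) (auto simp: \<Psi>_def, fastforce)
  have \<phi>0: "\<phi> p u \<ge> 0" if "u \<in> X" for p u using \<psi>0 \<Psi> [OF that] by (simp add: \<phi>_def)
  have \<phi>1: "(\<Sum>p\<in>F. \<phi> p u) = 1" if "u \<in> X" for u
    using \<Psi> [OF that] by (simp add: \<phi>_def \<Psi>_def sum_divide_distrib [symmetric])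
  have \<phi>far: "\<phi> p u = 0" if "dist u p \<ge> d p / 2" for p u using that by (simp add: \<phi>_def \<psi>_def)
  define s' where "s' = (\<lambda>u. \<Sum>p\<in>F. cc (of_real (\<phi> p u)) * g p u)"
  have tol_term: "tol t (\<lambda>u. cc (of_real (\<phi> p u)) * g p u) (\<phi> p t * \<beta>)" if t: "t \<in> X" and p: "p \<in> F" for t p
  proof (cases "dist t p < d p")
    case True
    have pX: "p \<in> X" using p F by blast
    \<comment> \<open>The values of g p vary discontinuously, but inside the thin set W p. Every
      point of \<open>U \<inter> W p\<close> over u is within \<beta> of g p u, and openness of the
      projection provides such points.\<close>
    have "tol t (g p) \<beta>"
      unfolding tol_def
    proof (intro ballI impI allI)
      fix U and \<eta> :: real assume U: "U \<in> Op" "(t, g p t) \<in> U" and \<eta>: "\<eta> > 0"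
      have "U \<inter> W p \<in> Op" "(t, g p t) \<in> U \<inter> W p" using Op_Int [OF U(1) dgW(3) [OF pX]] U dgW(5) [OF pX t True] by auto
      then have ev1: "\<forall>\<^sub>F u in at t within X. \<exists>y. (u, y) \<in> U \<inter> W p" by (rule Op_proj [OF _ _ t])
      have "((\<lambda>u. dist u p) \<longlongrightarrow> dist t p) (at t within X)" by (intro tendsto_intros)
      then have ev2: "\<forall>\<^sub>F u in at t within X. dist u p < d p" using True by (rule order_tendstoD)
      from ev1 ev2 ev_X show "\<forall>\<^sub>F u in at t within X. \<exists>x. (u, x) \<in> U \<and> nu u (g p u - x) < \<beta> + \<eta>"
      proof eventually_elim
        case (elim u)
        then obtain y where y: "(u, y) \<in> U" "(u, y) \<in> W p" by blast
        have "nu u (g p u - y) < \<beta>" by (rule dgW(7) [OF pX elim(3) dgW(5) [OF pX elim(3,2)] y(2)])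
        then show ?case using y \<eta> by (intro exI [of _ y]) auto
      qed
    qed
    moreover have "((\<lambda>u. complex_of_real (\<phi> p u)) \<longlongrightarrow> complex_of_real (\<phi> p t)) (at t within X)"
      using \<phi>c [of p] t by (intro tendsto_of_real) (simp add: continuous_on_def)
    ultimately have "tol t (\<lambda>u. cc (of_real (\<phi> p u)) * g p u) (cmod (of_real (\<phi> p t)) * \<beta>)"
      by (rule tol_scalar [OF t])
    then show ?thesis using \<phi>0 [OF t] by simp
  next
    case False
    then have z: "\<phi> p t = 0" using dF [OF p] by (intro \<phi>far) simp
    have lt: "d p / 2 < dist t p" using False dF [OF p] by simp
    have "((\<lambda>u. dist u p) \<longlongrightarrow> dist t p) (at t within X)" by (intro tendsto_intros)
    then have "\<forall>\<^sub>F u in at t within X. d p / 2 < dist u p" using lt by (rule order_tendstoD)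
    then have "\<forall>\<^sub>F u in at t within X. nu u (cc (of_real (\<phi> p u)) * g p u - 0) = 0"
      using ev_X by eventually_elim (simp add: \<phi>far)
    then have "((\<lambda>u. nu u (cc (of_real (\<phi> p u)) * g p u - 0)) \<longlongrightarrow> 0) (at t within X)"
      by (rule tendsto_eventually)
    then have "tol t (\<lambda>u. cc (of_real (\<phi> p u)) * g p u) 0"
      by (rule tol_perturb [OF t tol_zero [OF t]]) (simp add: z)
    then show ?thesis by (simp add: z)
  qed
  show ?thesis
  proof (rule that [of s'])
    fix t assume t: "t \<in> X"
    have "tol t s' (\<Sum>p\<in>F. \<phi> p t * \<beta>)" unfolding s'_def by (rule tol_sum [OF t tol_term [OF t]])
    then show "tol t s' \<beta>" using \<phi>1 [OF t] by (simp add: sum_distrib_right [symmetric])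
    have "s t = cc (\<Sum>p\<in>F. of_real (\<phi> p t)) * s t" using \<phi>1 [OF t] by (simp flip: of_real_sum)
    then have "s' t - s t = (\<Sum>p\<in>F. cc (of_real (\<phi> p t)) * (g p t - s t))"
      by (simp add: s'_def cc_sum sum_distrib_right sum_subtractf right_diff_distrib)
    then have "nu t (s' t - s t) \<le> (\<Sum>p\<in>F. nu t (cc (of_real (\<phi> p t)) * (g p t - s t)))"
      using nu_sum [OF t] by simp
    also have "\<dots> \<le> (\<Sum>p\<in>F. \<phi> p t * (2 * \<alpha>))"
    proof (rule sum_mono)
      fix p assume p: "p \<in> F"
      show "nu t (cc (of_real (\<phi> p t)) * (g p t - s t)) \<le> \<phi> p t * (2 * \<alpha>)"
      proof (cases "dist t p < d p")
        case True
        have "nu t (g p t - s t) \<le> 2 * \<alpha>" using dgW(6) [OF _ t True] p F by blast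
        then show ?thesis using \<phi>0 [OF t, of p] by (simp add: nu_scale [OF t] mult_left_mono)
      next
        case False
        then have "\<phi> p t = 0" using dF [OF p] by (intro \<phi>far) simp
        then show ?thesis using t by simp
      qed
    qed
    also have "\<dots> = 2 * \<alpha>" using \<phi>1 [OF t] by (simp add: sum_distrib_right [symmetric])
    finally show "nu t (s' t - s t) \<le> 2 * \<alpha>" .
  next
    have van: "\<phi> p t0 = 0" if "p \<in> F" "p \<noteq> t0" for p
    proof (rule \<phi>far)
      have "d p \<le> dist p t0" using dgW(2) that F by blast
      then show "d p / 2 \<le> dist t0 p" using dF [OF that(1)] by (simp add: dist_commute)
    qed
    have "t0 \<in> F"
    proof (rule ccontr)
      assume "t0 \<notin> F"
      then have "(\<Sum>p\<in>F. \<phi> p t0) = 0" using van by (intro sum.neutral) auto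
      then show False using \<phi>1 [OF t0] by simp
    qed
    moreover from this have "\<phi> t0 t0 = 1" using \<phi>1 [OF t0] sum.remove [OF F(2), of t0 "\<lambda>p. \<phi> p t0"] van by simp
    ultimately show "s' t0 = s t0"
      using sum.remove [OF F(2), of t0 "\<lambda>p. cc (of_real (\<phi> p t0)) * g p t0"] van dgW(4) [OF t0] by (simp add: s'_def)
  qed
qed

text \<open>The existence theorem for sections: a function with a rough tolerance is improved
  repeatedly with its value at t0 kept, and the geometric bounds give a uniform limit with tolerance
  0.\<close>

lemma sections_full: assumes t0: "t0 \<in> X" shows "\<exists>f\<in>sections. f t0 = x"
proof -
  define A where "A = nu t0 x + 1"
  have A: "A > 0" using nu_nonneg [OF t0, of x] by (simp add: A_def)
  \<comment> \<open>The starting function jumps at t0, but its tolerance is A: over points other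
    than t0 any element of norm below A is that close to 0.\<close>
  define s0 where "s0 = (\<lambda>u. if u = t0 then x else 0)"
  have tol0: "tol t s0 A" if t: "t \<in> X" for t
    unfolding tol_def
  proof (intro ballI impI allI)
    fix U and \<eta> :: real assume U: "U \<in> Op" "(t, s0 t) \<in> U" and \<eta>: "\<eta> > 0"
    define V where "V = U \<inter> {(u, x). u \<in> X \<and> nu u x \<in> {..<A}}"
    have "nu t (s0 t) < A" using t A by (simp add: s0_def A_def)
    then have V: "V \<in> Op" "(t, s0 t) \<in> V" unfolding V_def using Op_Int [OF U(1) Op_norm [OF open_lessThan]] U t by auto
    have "\<forall>\<^sub>F u in at t within X. u \<noteq> t0"
    proof (cases "t = t0")
      case False
      have "\<forall>\<^sub>F u in nhds t. u \<noteq> t0" using False by (intro t1_space_nhds)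
      then show ?thesis by (simp add: eventually_at_filter eventually_mono)
    qed (simp add: eventually_at_filter)
    with Op_proj [OF V t] ev_X show "\<forall>\<^sub>F u in at t within X. \<exists>x. (u, x) \<in> U \<and> nu u (s0 u - x) < A + \<eta>"
    proof eventually_elim
      case (elim u)
      then obtain y where "(u, y) \<in> V" by blast
      then show ?case using elim(2,3) \<eta> by (intro exI [of _ y]) (auto simp: V_def s0_def)
    qed
  qed
  have "\<exists>s. \<forall>n. ((\<forall>t\<in>X. tol t (s n) (A / 2^n)) \<and> s n t0 = x) \<and> (\<forall>t\<in>X. nu t (s (Suc n) t - s n t) \<le> 2 * (A / 2^n))"
  proof (rule dependent_nat_choice)
    show "\<exists>s. (\<forall>t\<in>X. tol t s (A / 2^0)) \<and> s t0 = x" using tol0 by (intro exI [of _ s0]) (simp add: s0_def)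
    fix s n assume s: "(\<forall>t\<in>X. tol t s (A / 2^n)) \<and> s t0 = x"
    have "A / 2^n > 0" "A / 2^Suc n > 0" using A by auto
    then obtain s' where "\<And>t. t \<in> X \<Longrightarrow> tol t s' (A / 2^Suc n)" "\<And>t. t \<in> X \<Longrightarrow> nu t (s' t - s t) \<le> 2 * (A / 2^n)" "s' t0 = s t0"
      using improve [of s "A / 2^n" "A / 2^Suc n" t0] s t0 by blast
    then show "\<exists>s'. ((\<forall>t\<in>X. tol t s' (A / 2^Suc n)) \<and> s' t0 = x) \<and> (\<forall>t\<in>X. nu t (s' t - s t) \<le> 2 * (A / 2^n))"
      using s by (intro exI [of _ s']) auto
  qed
  then obtain s where s: "\<And>n t. t \<in> X \<Longrightarrow> tol t (s n) (A / 2^n)" "\<And>n. s n t0 = x"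
    "\<And>n t. t \<in> X \<Longrightarrow> nu t (s (Suc n) t - s n t) \<le> 2 * (A / 2^n)" by blast
  \<comment> \<open>The exact difference of geometric terms, not merely the bound 4 (A / 2^n), is
    what carries the induction on k.\<close>
  have tail: "nu t (s (n + k) t - s n t) \<le> 4 * (A / 2^n) - 4 * (A / 2^(n+k))" if t: "t \<in> X" for t n k
  proof (induction k)
    case (Suc k)
    have "nu t (s (n + Suc k) t - s n t) \<le> nu t (s (Suc (n + k)) t - s (n + k) t) + nu t (s (n + k) t - s n t)"
      using nu_diff_triangle [OF t] by simp
    also have "\<dots> \<le> 2 * (A / 2^(n+k)) + (4 * (A / 2^n) - 4 * (A / 2^(n+k)))" by (intro add_mono s(3) t Suc)
    also have "\<dots> = 4 * (A / 2^n) - 4 * (A / 2^(n + Suc k))" by simp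
    finally show ?case .
  qed (use t in simp)
  have tail': "nu t (s m t - s n t) \<le> 4 * (A / 2^n)" if t: "t \<in> X" and "m \<ge> n" for t m n
    using tail [OF t, of n "m - n"] that A by (smt (verit) divide_nonneg_pos le_add_diff_inverse zero_less_power)
  have lim4: "(\<lambda>n. c * (A / 2^n)) \<longlonglongrightarrow> 0" for c
  proof -
    have "(\<lambda>n. c * A * (1/2)^n) \<longlonglongrightarrow> c * A * 0" by (intro tendsto_intros LIMSEQ_power_zero) simp
    then show ?thesis by (simp add: power_one_over field_simps)
  qed
  have "\<exists>y. (\<lambda>i. nu t (s i t - y)) \<longlonglongrightarrow> 0" if t: "t \<in> X" for t
  proof (rule fibre_complete [OF t])
    fix e :: real assume e: "e > 0"
    obtain N where N: "8 * (A / 2^N) < e" using order_tendstoD(2) [OF lim4 e, of 8] unfolding eventually_sequentially by blast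
    have "nu t (s i t - s j t) < e" if "i \<ge> N" "j \<ge> N" for i j
      using nu_diff_triangle [OF t, of "s i t" "s j t" "s N t"] nu_diff_comm [OF t, of "s N t" "s j t"]
        tail' [OF t that(1)] tail' [OF t that(2)] N by linarith
    then show "\<exists>N. \<forall>i\<ge>N. \<forall>j\<ge>N. nu t (s i t - s j t) < e" by blast
  qed
  then obtain f where f: "\<And>t. t \<in> X \<Longrightarrow> (\<lambda>i. nu t (s i t - f t)) \<longlonglongrightarrow> 0" by metis
  have close: "nu t (f t - s n t) \<le> 4 * (A / 2^n)" if t: "t \<in> X" for t n
  proof (rule LIMSEQ_le_const)
    show "(\<lambda>i. nu t (s i t - f t) + 4 * (A / 2^n)) \<longlonglongrightarrow> 4 * (A / 2^n)"
      using tendsto_add [OF f [OF t] tendsto_const] by simp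
    have "nu t (f t - s n t) \<le> nu t (s i t - f t) + 4 * (A / 2^n)" if "i \<ge> n" for i
      using nu_diff_triangle [OF t, of "f t" "s n t" "s i t"] nu_diff_comm [OF t, of "f t" "s i t"] tail' [OF t that] by linarith
    then show "\<exists>N. \<forall>i\<ge>N. nu t (f t - s n t) \<le> nu t (s i t - f t) + 4 * (A / 2^n)" by blast
  qed
  have "cont_at t f" if t: "t \<in> X" for t
    by (rule cont_at_uniform_limit [OF t s(1) [OF t] _ lim4 [of 4]]) (use lim4 [of 1] close in simp_all)
  then have "f \<in> sections" by (simp add: sections_def)
  moreover have "f t0 = x"
  proof -
    have "nu t0 (x - f t0) = 0" using f [OF t0] LIMSEQ_unique [OF tendsto_const] by (simp add: s(2))
    then show ?thesis using nu_eq_0 [OF t0] by simp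
  qed
  ultimately show ?thesis by blast
qed

lemma cont_at_binop:
  assumes t: "t \<in> X" and s: "cont_at t s" and s': "cont_at t s'"
    and op: "\<And>U. \<lbrakk>U \<in> Op; (t, f (s t) (s' t)) \<in> U\<rbrakk> \<Longrightarrow>
      \<exists>V\<in>Op. \<exists>W\<in>Op. (t, s t) \<in> V \<and> (t, s' t) \<in> W \<and> (\<forall>u\<in>X. \<forall>x' y'. (u, x') \<in> V \<longrightarrow> (u, y') \<in> W \<longrightarrow> (u, f x' y') \<in> U)"
  shows "cont_at t (\<lambda>u. f (s u) (s' u))"
  unfolding cont_at_def
proof (intro ballI impI)
  fix U assume "U \<in> Op" "(t, f (s t) (s' t)) \<in> U"
  then obtain V W where VW: "V \<in> Op" "W \<in> Op" "(t, s t) \<in> V" "(t, s' t) \<in> W"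
    "\<And>u x' y'. \<lbrakk>u \<in> X; (u, x') \<in> V; (u, y') \<in> W\<rbrakk> \<Longrightarrow> (u, f x' y') \<in> U" using op by metis
  have "\<forall>\<^sub>F u in at t within X. (u, s u) \<in> V" "\<forall>\<^sub>F u in at t within X. (u, s' u) \<in> W"
    using s s' VW unfolding cont_at_def by blast+
  then show "\<forall>\<^sub>F u in at t within X. (u, f (s u) (s' u)) \<in> U"
    using ev_X by eventually_elim (rule VW(5))
qed

section \<open>The continuous sections form a continuous field\<close>

lemma sectionsD:
  "\<lbrakk>a \<in> sections; t \<in> X; U \<in> Op; (t, a t) \<in> U\<rbrakk> \<Longrightarrow> \<forall>\<^sub>F u in at t within X. (u, a u) \<in> U"
  unfolding sections_def cont_at_def by blast

lemma cfield_sections: "cfield X nu sections"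
proof (unfold_locales)
  show "(\<lambda>t. a t + b t) \<in> sections" if "a \<in> sections" "b \<in> sections" for a b
    using that cont_at_binop [of _ a b "(+)", OF _ _ _ Op_add] by (auto simp: sections_def)
  show "(\<lambda>t. a t * b t) \<in> sections" if "a \<in> sections" "b \<in> sections" for a b
    using that cont_at_binop [of _ a b "(*)", OF _ _ _ Op_mult] by (auto simp: sections_def)
  show "(\<lambda>t. cc c * a t) \<in> sections" if a: "a \<in> sections" for a c
    unfolding sections_def cont_at_def
  proof (intro CollectI ballI impI)
    fix t U assume t: "t \<in> X" and U: "U \<in> Op" "(t, cc c * a t) \<in> U"
    then have "\<forall>\<^sub>F u in at t within X. (u, a u) \<in> {(u, x). u \<in> X \<and> (u, cc c * x) \<in> U}"
      by (intro sectionsD [OF a t Op_scale [OF U(1)]]) (use U t in simp)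
    then show "\<forall>\<^sub>F u in at t within X. (u, cc c * a u) \<in> U" by (rule eventually_mono) auto
  qed
  show "(\<lambda>t. adj (a t)) \<in> sections" if a: "a \<in> sections" for a
    unfolding sections_def cont_at_def
  proof (intro CollectI ballI impI)
    fix t U assume t: "t \<in> X" and U: "U \<in> Op" "(t, adj (a t)) \<in> U"
    then have "\<forall>\<^sub>F u in at t within X. (u, a u) \<in> {(u, x). u \<in> X \<and> (u, adj x) \<in> U}"
      by (intro sectionsD [OF a t Op_adj [OF U(1)]]) (use U t in simp)
    then show "\<forall>\<^sub>F u in at t within X. (u, adj (a u)) \<in> U" by (rule eventually_mono) auto
  qed
  show "continuous_on X (\<lambda>t. nu t (a t))" if a: "a \<in> sections" for a
    unfolding continuous_on_def
  proof (intro ballI topological_tendstoI)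
    fix t R assume t: "t \<in> X" and R: "open R" "nu t (a t) \<in> R"
    then have "\<forall>\<^sub>F u in at t within X. (u, a u) \<in> {(u, x). u \<in> X \<and> nu u x \<in> R}"
      by (intro sectionsD [OF a t Op_norm [OF R(1)]]) (use R t in simp)
    then show "\<forall>\<^sub>F u in at t within X. nu u (a u) \<in> R" by (rule eventually_mono) auto
  qed
  show "\<exists>a\<in>sections. a t = x" if "t \<in> X" for t x by (rule sections_full [OF that])
  show "s \<in> sections"
    if *: "\<And>t. t \<in> X \<Longrightarrow> \<exists>a\<in>sections. a t = s t \<and> ((\<lambda>u. nu u (s u - a u)) \<longlongrightarrow> 0) (at t within X)" for s
    unfolding sections_def cont_at_def
  proof (intro CollectI ballI impI)
    fix t U assume t: "t \<in> X" and U: "U \<in> Op" "(t, s t) \<in> U"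
    obtain a where a: "a \<in> sections" "a t = s t" "((\<lambda>u. nu u (s u - a u)) \<longlongrightarrow> 0) (at t within X)" using * [OF t] by blast
    obtain V \<epsilon> where V: "V \<in> Op" "(t, s t) \<in> V" "\<epsilon> > 0"
      "\<And>u y z. \<lbrakk>u \<in> X; (u, y) \<in> V; nu u (z - y) < \<epsilon>\<rbrakk> \<Longrightarrow> (u, z) \<in> U" using thick [OF U t] by blast
    have "\<forall>\<^sub>F u in at t within X. (u, a u) \<in> V" by (rule sectionsD [OF a(1) t V(1)]) (use a(2) V(2) in simp)
    then show "\<forall>\<^sub>F u in at t within X. (u, s u) \<in> U"
      using order_tendstoD(2) [OF a(3) V(3)] ev_X by eventually_elim (rule V(4))
  qed
qed

end

section \<open>Trivialization by a global frame\<close>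

text \<open>Coordinates with respect to matrix units; the chosen scalar exists by
  \<open>mat_units_corner\<close> and is unique because \<open>e i j\<close> is nonzero.\<close>

definition mcoef :: "('n::finite \<Rightarrow> 'n \<Rightarrow> 'n cmat) \<Rightarrow> 'n cmat \<Rightarrow> complex^'n^'n" where
  "mcoef e x = (\<chi> i j. SOME c. e i i * x * e j j = cc c * e i j)"

definition mcomb :: "('n::finite \<Rightarrow> 'n \<Rightarrow> 'n cmat) \<Rightarrow> complex^'n^'n \<Rightarrow> 'n cmat" where
  "mcomb e m = (\<Sum>i\<in>UNIV. \<Sum>j\<in>UNIV. cc (m $ i $ j) * e i j)"

lemma mcoef: "mat_units e \<Longrightarrow> e i i * x * e j j = cc (mcoef e x $ i $ j) * e i j"
  using someI_ex [OF mat_units_corner [of e i x j]] by (simp add: mcoef_def)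

lemma mcoefI:
  assumes "mat_units e" "\<And>i j. e i i * x * e j j = cc (m $ i $ j) * e i j" shows "mcoef e x = m"
proof -
  have "mcoef e x $ i $ j = m $ i $ j" for i j
    using mcoef [OF assms(1), of i x j] assms(2) [of i j] cc_mult_cancel [OF mat_units_nonzero [OF assms(1), of i j]] by simp
  then show ?thesis by (simp add: vec_eq_iff)
qed

lemma mcomb_mcoef: assumes e: "mat_units e" shows "mcomb e (mcoef e x) = x"
proof -
  have "mcomb e (mcoef e x) = (\<Sum>i\<in>UNIV. \<Sum>j\<in>UNIV. e i i * x * e j j)"
    by (simp add: mcomb_def mcoef [OF e])
  also have "\<dots> = (\<Sum>i\<in>UNIV. e i i) * x * (\<Sum>j\<in>UNIV. e j j)"
    by (simp only: sum_distrib_left sum_distrib_right) (rule sum.swap)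
  finally show ?thesis by (simp add: mat_unitsD(4) [OF e])
qed

lemma mcoef_mcomb: assumes e: "mat_units e" shows "mcoef e (mcomb e m) = m"
proof (rule mcoefI [OF e])
  fix i j
  have 1: "e i i * e k l * e j j = (if k = i then if l = j then e i j else 0 else 0)" for k l
    using mat_unitsD(1,2) [OF e] by auto
  have "e i i * mcomb e m * e j j = (\<Sum>k\<in>UNIV. \<Sum>l\<in>UNIV. cc (m $ k $ l) * (e i i * e k l * e j j))"
    unfolding mcomb_def sum_distrib_left sum_distrib_right
    by (intro sum.cong refl) (simp only: cc_left_comm [of "e i i"] mult.assoc)
  also have "\<dots> = (\<Sum>k\<in>UNIV. if k = i then \<Sum>l\<in>UNIV. if l = j then cc (m $ i $ j) * e i j else 0 else 0)"
  proof (rule sum.cong [OF refl])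
    fix k
    show "(\<Sum>l\<in>UNIV. cc (m $ k $ l) * (e i i * e k l * e j j)) =
        (if k = i then \<Sum>l\<in>UNIV. if l = j then cc (m $ i $ j) * e i j else 0 else 0)"
    proof (cases "k = i")
      case True
      have "cc (m $ k $ l) * (e i i * e k l * e j j) = (if l = j then cc (m $ i $ j) * e i j else 0)" for l
        unfolding 1 using True by simp
      then show ?thesis using True by simp
    qed (simp add: 1)
  qed
  also have "\<dots> = cc (m $ i $ j) * e i j" by simp
  finally show "e i i * mcomb e m * e j j = cc (m $ i $ j) * e i j" .
qed

lemma mcoef_add: "mat_units e \<Longrightarrow> mcoef e (x + y) = mcoef e x + mcoef e y"
  by (rule mcoefI) (simp_all add: distrib_left distrib_right mcoef cc_add)

lemma mcoef_scale: assumes "mat_units e" shows "mcoef e (cc c * x) = (\<chi> i j. c * mcoef e x $ i $ j)"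
proof (rule mcoefI [OF assms])
  fix i j
  have "e i i * (cc c * x) * e j j = cc c * (e i i * x * e j j)" by (simp only: cc_left_comm [of "e i i"] mult.assoc)
  then show "e i i * (cc c * x) * e j j = cc ((\<chi> i j. c * mcoef e x $ i $ j) $ i $ j) * e i j"
    by (simp add: mcoef [OF assms] cc_cc_mult)
qed

lemma mcoef_mult: assumes e: "mat_units e" shows "mcoef e (x * y) = mcoef e x ** mcoef e y"
proof (rule mcoefI [OF e])
  fix i j
  have idem: "e k k * e k k = e k k" for k by (simp add: mat_unitsD(1) [OF e])
  have "e i i * (x * y) * e j j = e i i * x * (\<Sum>k\<in>UNIV. e k k) * (y * e j j)"
    by (simp add: mat_unitsD(4) [OF e] mult.assoc)
  also have "\<dots> = (\<Sum>k\<in>UNIV. (e i i * x * e k k) * (e k k * y * e j j))"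
    unfolding sum_distrib_left sum_distrib_right
    by (intro sum.cong refl) (metis idem mult.assoc)
  also have "\<dots> = (\<Sum>k\<in>UNIV. cc (mcoef e x $ i $ k * mcoef e y $ k $ j) * e i j)"
  proof (rule sum.cong [OF refl])
    fix k
    have "cc a * e i k * (cc b * e k j) = cc (a * b) * e i j" for a b
      by (simp only: mult.assoc cc_left_comm [of "e i k"] cc_cc_mult mat_unitsD(1) [OF e])
    then show "(e i i * x * e k k) * (e k k * y * e j j) = cc (mcoef e x $ i $ k * mcoef e y $ k $ j) * e i j"
      by (simp only: mcoef [OF e])
  qed
  finally show "e i i * (x * y) * e j j = cc ((mcoef e x ** mcoef e y) $ i $ j) * e i j"
    by (simp add: matrix_matrix_mult_def cc_sum sum_distrib_right)
qed

lemma mcoef_adj: assumes e: "mat_units e" shows "mcoef e (adj x) = conj_transpose (mcoef e x)"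
proof (rule mcoefI [OF e])
  fix i j
  have "e i i * adj x * e j j = adj (e j j * x * e i i)"
    by (simp add: adj_mult mat_unitsD(3) [OF e] mult.assoc)
  also have "\<dots> = cc (cnj (mcoef e x $ j $ i)) * e i j"
    unfolding mcoef [OF e] by (simp add: adj_mult mat_unitsD(3) [OF e] cc_comm)
  finally show "e i i * adj x * e j j = cc (conj_transpose (mcoef e x) $ i $ j) * e i j"
    by (simp add: conj_transpose_def)
qed

context cartan_field
begin

text \<open>Each coordinate is the coefficient of the section \<open>e i i * a * e j j\<close> along
  the norm one section \<open>e i j\<close>.\<close>

lemma mcoef_continuous:
  assumes fr: "frame X e" and a: "a \<in> G" shows "continuous_on X (\<lambda>t. mcoef (\<lambda>i j. e i j t) (a t))"
proof -
  have "continuous_on X (\<lambda>t. mcoef (\<lambda>i j. e i j t) (a t) $ i $ j)" for i j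
  proof (rule sec_coefficient_cont [OF _ frameD(1) [OF fr, of i j] order_refl])
    show "nu t (e i j t) = 1" if "t \<in> X" for t by (rule nu_mat_unit [OF that frameD(2) [OF fr that]])
    have "sec X (\<lambda>t. e i i t * a t * e j j t)"
      by (rule sec_mult [OF sec_mult [OF frameD(1) [OF fr] G_sec [OF a]] frameD(1) [OF fr]]) auto
    then show "sec X (\<lambda>t. cc (mcoef (\<lambda>i j. e i j t) (a t) $ i $ j) * e i j t)"
      by (rule sec_cong) (rule mcoef [OF frameD(2) [OF fr]])
  qed
  then have "continuous_on X (\<lambda>t. \<chi> i. \<chi> j. mcoef (\<lambda>i j. e i j t) (a t) $ i $ j)"
    by (intro continuous_on_vec_lambda)
  then show ?thesis by simp
qed

lemma mcomb_section:
  assumes fr: "frame X e" and f: "continuous_on X f" shows "(\<lambda>t. mcomb (\<lambda>i j. e i j t) (f t)) \<in> G"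
proof (rule sec_G)
  have c: "continuous_on X (\<lambda>t. f t $ i $ j)" for i j by (intro continuous_intros f)
  show "sec X (\<lambda>t. mcomb (\<lambda>i j. e i j t) (f t))"
    unfolding mcomb_def
    by (rule sec_sum [OF sec_sum [OF sec_scale [OF frameD(1) [OF fr] order_refl c] order_refl] order_refl])
qed

text \<open>Since b commutes with the diagonal units, its off-diagonal corners vanish.\<close>

lemma mcoef_diagonal:
  assumes fr: "frame X e" and b: "b \<in> B" and t: "t \<in> X"
  shows "mcoef (\<lambda>i j. e i j t) (b t) \<in> diagonal_matrices"
  unfolding diagonal_matrices_def
proof (intro CollectI allI impI)
  fix i j :: 'n assume ij: "i \<noteq> j"
  note m = frameD(2) [OF fr t]
  have "e i i t * b t * e j j t = b t * (e i i t * e j j t)"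
    using Bt_comm [OF t frameD(3) [OF fr t, of i] Bt_I [OF b]] by (simp add: mult.assoc)
  also have "\<dots> = 0" using mat_unitsD(2) [OF m ij] by simp
  finally have "cc (mcoef (\<lambda>i j. e i j t) (b t) $ i $ j) * e i j t = 0" using mcoef [OF m] by simp
  then show "mcoef (\<lambda>i j. e i j t) (b t) $ i $ j = 0" using mat_units_nonzero [OF m] cc_mult_eq_0 by blast
qed

text \<open>The values lie in the commutative fibres \<open>Bt t\<close>, so the section commutes
  with \<open>B\<close>, and \<open>B_max\<close> applies.\<close>

lemma mcomb_diagonal:
  assumes fr: "frame X e" and f: "continuous_on X f" and d: "\<And>t. t \<in> X \<Longrightarrow> f t \<in> diagonal_matrices"
  shows "(\<lambda>t. mcomb (\<lambda>i j. e i j t) (f t)) \<in> B"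
proof (rule B_max [OF mcomb_section [OF fr f]])
  fix b t assume b: "b \<in> B" and t: "t \<in> X"
  have z: "cc (f t $ i $ j) * e i j t \<in> Bt t" for i j
  proof (cases "i = j")
    case True
    then show ?thesis using Bt_scale [OF t frameD(3) [OF fr t]] by simp
  next
    case False
    then have "f t $ i $ j = 0" using d [OF t] by (simp add: diagonal_matrices_def)
    then show ?thesis using Bt_scale [OF t Bt_I [OF B_one], of 0] by simp
  qed
  have "mcomb (\<lambda>i j. e i j t) (f t) \<in> Bt t" unfolding mcomb_def by (intro Bt_sum t z)
  then show "mcomb (\<lambda>i j. e i j t) (f t) * b t = b t * mcomb (\<lambda>i j. e i j t) (f t)"
    by (rule Bt_comm [OF t _ Bt_I [OF b]])
qed

end

section \<open>Cartan subalgebras of section algebras\<close>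

text \<open>A common frame for section algebras of bundles and for algebras of matrix-valued
  functions: \<open>\<Psi> t\<close> identifies M_n with the fibre over t, and \<open>alg\<close>
  consists of the images of \<open>G\<close>.\<close>

locale cstar_rep = cfield X nu G
  for X :: "'v::euclidean_space set" and nu :: "'v \<Rightarrow> 'n::finite cmat \<Rightarrow> real" and G :: "('v \<Rightarrow> 'n cmat) set" +
  fixes F :: "'v \<Rightarrow> 'a cstar" and \<Psi> :: "'v \<Rightarrow> 'n cmat \<Rightarrow> 'a"
  assumes X_nonempty: "X \<noteq> {}"
    and \<Psi>_inj: "\<lbrakk>t \<in> X; \<Psi> t x = \<Psi> t y\<rbrakk> \<Longrightarrow> x = y"
    and \<Psi>_zero: "t \<in> X \<Longrightarrow> cs_zero (F t) = \<Psi> t 0"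
    and \<Psi>_add: "t \<in> X \<Longrightarrow> cs_add (F t) (\<Psi> t x) (\<Psi> t y) = \<Psi> t (x + y)"
    and \<Psi>_scale: "t \<in> X \<Longrightarrow> cs_scale (F t) c (\<Psi> t x) = \<Psi> t (cc c * x)"
    and \<Psi>_mult: "t \<in> X \<Longrightarrow> cs_mult (F t) (\<Psi> t x) (\<Psi> t y) = \<Psi> t (x * y)"
    and \<Psi>_star: "t \<in> X \<Longrightarrow> cs_star (F t) (\<Psi> t x) = \<Psi> t (adj x)"
    and \<Psi>_norm: "t \<in> X \<Longrightarrow> cs_norm (F t) (\<Psi> t x) = nu t x"
begin

definition Q :: "('v \<Rightarrow> 'n cmat) \<Rightarrow> 'v \<Rightarrow> 'a" where "Q g = (\<lambda>t\<in>X. \<Psi> t (g t))"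

definition alg :: "('v \<Rightarrow> 'a) cstar" where "alg = pointwise_algebra X F (Q ` G)"

lemma Q_eq: "Q g = Q h \<longleftrightarrow> (\<forall>t\<in>X. g t = h t)"
proof
  assume "Q g = Q h"
  then show "\<forall>t\<in>X. g t = h t" unfolding Q_def using \<Psi>_inj by (metis restrict_apply')
qed (auto simp: Q_def)

lemma alg_ops:
  "cs_carrier alg = Q ` G" "cs_zero alg = Q (\<lambda>t. 0)"
  "cs_add alg (Q g) (Q h) = Q (\<lambda>t. g t + h t)"
  "cs_scale alg c (Q g) = Q (\<lambda>t. cc c * g t)"
  "cs_mult alg (Q g) (Q h) = Q (\<lambda>t. g t * h t)"
  "cs_star alg (Q g) = Q (\<lambda>t. adj (g t))"
  "cs_diff alg (Q g) (Q h) = Q (\<lambda>t. g t - h t)"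
  by (auto simp: alg_def pointwise_algebra_def Q_def cs_diff_def \<Psi>_zero \<Psi>_add \<Psi>_scale \<Psi>_mult \<Psi>_star cc_minus
      intro!: restrict_ext)

lemma alg_norm: "cs_norm alg (Q g) = (SUP t\<in>X. nu t (g t))"
  by (auto simp: alg_def pointwise_algebra_def Q_def \<Psi>_norm intro!: SUP_cong)

lemma nu_le_norm: assumes "g \<in> G" "t \<in> X" shows "nu t (g t) \<le> cs_norm alg (Q g)"
proof -
  have "bdd_above ((\<lambda>t. nu t (g t)) ` X)"
    by (intro bounded_imp_bdd_above compact_imp_bounded compact_continuous_image nu_cont assms compact_X)
  then show ?thesis unfolding alg_norm by (rule cSUP_upper [OF assms(2)])
qed

lemma norm_leI: "(\<And>t. t \<in> X \<Longrightarrow> nu t (g t) \<le> k) \<Longrightarrow> cs_norm alg (Q g) \<le> k"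
  unfolding alg_norm by (rule cSUP_least [OF X_nonempty])

definition pull :: "('v \<Rightarrow> 'a) set \<Rightarrow> ('v \<Rightarrow> 'n cmat) set" where "pull C = {g \<in> G. Q g \<in> C}"

lemma pull_closed:
  assumes C: "sub_cstar_algebra alg C"
  shows "\<lbrakk>g \<in> pull C; h \<in> pull C\<rbrakk> \<Longrightarrow> (\<lambda>t. g t + h t) \<in> pull C"
    "\<lbrakk>g \<in> pull C; h \<in> pull C\<rbrakk> \<Longrightarrow> (\<lambda>t. g t * h t) \<in> pull C"
    "g \<in> pull C \<Longrightarrow> (\<lambda>t. cc c * g t) \<in> pull C"
    "g \<in> pull C \<Longrightarrow> (\<lambda>t. adj (g t)) \<in> pull C"
proof -
  show "(\<lambda>t. g t + h t) \<in> pull C" if "g \<in> pull C" "h \<in> pull C"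
    using that C G_add [of g h] unfolding sub_cstar_algebra_def pull_def by (auto simp: alg_ops(3) [symmetric])
  show "(\<lambda>t. g t * h t) \<in> pull C" if "g \<in> pull C" "h \<in> pull C"
    using that C G_mult [of g h] unfolding sub_cstar_algebra_def pull_def by (auto simp: alg_ops(5) [symmetric])
  show "(\<lambda>t. cc c * g t) \<in> pull C" if "g \<in> pull C"
    using that C G_scale [of g c] unfolding sub_cstar_algebra_def pull_def by (auto simp: alg_ops(4) [symmetric])
  show "(\<lambda>t. adj (g t)) \<in> pull C" if "g \<in> pull C"
    using that C G_adj [of g] unfolding sub_cstar_algebra_def pull_def by (auto simp: alg_ops(6) [symmetric])
qed

section \<open>Commutants and maximal abelian subalgebras\<close>

definition commutant :: "('v \<Rightarrow> 'n cmat) set \<Rightarrow> ('v \<Rightarrow> 'n cmat) set" where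
  "commutant S = {y \<in> G. \<forall>s\<in>S. \<forall>t\<in>X. y t * s t = s t * y t}"

lemma commutant_sub_algebra:
  assumes S: "\<And>s. s \<in> S \<Longrightarrow> \<exists>s'\<in>S. \<forall>t\<in>X. s' t = adj (s t)"
  shows "sub_cstar_algebra alg (Q ` commutant S)"
  unfolding sub_cstar_algebra_def
proof (intro conjI ballI allI impI)
  show "Q ` commutant S \<subseteq> cs_carrier alg" by (auto simp: commutant_def alg_ops)
  show "cs_zero alg \<in> Q ` commutant S"
    unfolding alg_ops by (rule imageI) (simp add: commutant_def G_zero [OF X_nonempty])
  fix x assume "x \<in> Q ` commutant S"
  then obtain g where g: "x = Q g" "g \<in> G" "\<And>s t. \<lbrakk>s \<in> S; t \<in> X\<rbrakk> \<Longrightarrow> g t * s t = s t * g t" by (auto simp: commutant_def)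
  show "cs_scale alg c x \<in> Q ` commutant S" for c
    unfolding g(1) alg_ops
  proof (rule imageI, unfold commutant_def, intro CollectI conjI ballI)
    show "(\<lambda>t. cc c * g t) \<in> G" by (rule G_scale [OF g(2)])
    fix s t assume "s \<in> S" "t \<in> X"
    then show "cc c * g t * s t = s t * (cc c * g t)" using g(3) by (metis cc_left_comm mult.assoc)
  qed
  show "cs_star alg x \<in> Q ` commutant S"
    unfolding g(1) alg_ops
  proof (rule imageI, unfold commutant_def, intro CollectI conjI ballI)
    show "(\<lambda>t. adj (g t)) \<in> G" by (rule G_adj [OF g(2)])
    fix s t assume s: "s \<in> S" and t: "t \<in> X"
    obtain s' where s': "s' \<in> S" "s' t = adj (s t)" using S [OF s] t by blast
    have "adj (g t) * s t = adj (s' t * g t)" by (simp add: adj_mult s'(2))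
    also have "\<dots> = adj (g t * s' t)" using g(3) [OF s'(1) t] by simp
    also have "\<dots> = s t * adj (g t)" by (simp add: adj_mult s'(2))
    finally show "adj (g t) * s t = s t * adj (g t)" .
  qed
  fix y assume "y \<in> Q ` commutant S"
  then obtain h where h: "y = Q h" "h \<in> G" "\<And>s t. \<lbrakk>s \<in> S; t \<in> X\<rbrakk> \<Longrightarrow> h t * s t = s t * h t" by (auto simp: commutant_def)
  show "cs_add alg x y \<in> Q ` commutant S"
    unfolding g(1) h(1) alg_ops
  proof (rule imageI, unfold commutant_def, intro CollectI conjI ballI)
    show "(\<lambda>t. g t + h t) \<in> G" by (rule G_add [OF g(2) h(2)])
    show "(g t + h t) * s t = s t * (g t + h t)" if "s \<in> S" "t \<in> X" for s t
      using g(3) [OF that] h(3) [OF that] by (simp only: distrib_left distrib_right)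
  qed
  show "cs_mult alg x y \<in> Q ` commutant S"
    unfolding g(1) h(1) alg_ops
  proof (rule imageI, unfold commutant_def, intro CollectI conjI ballI)
    show "(\<lambda>t. g t * h t) \<in> G" by (rule G_mult [OF g(2) h(2)])
    show "g t * h t * s t = s t * (g t * h t)" if "s \<in> S" "t \<in> X" for s t
      using g(3) [OF that] h(3) [OF that] by (metis mult.assoc)
  qed
next
  fix x assume "x \<in> cs_carrier alg" and ap: "\<forall>\<epsilon>>0. \<exists>b\<in>Q ` commutant S. cs_norm alg (cs_diff alg x b) < \<epsilon>"
  then obtain w where w: "x = Q w" "w \<in> G" by (auto simp: alg_ops)
  have "w t * s t = s t * w t" if s: "s \<in> S" and t: "t \<in> X" for s t
  proof -
    have "nu t (w t * s t - s t * w t) \<le> 0 + e" if e: "e > 0" for e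
    proof -
      \<comment> \<open>Replacing w by b in the commutator with s costs at most twice the norm of s
        times their distance; the 1 keeps k positive.\<close>
      define k where "k = 2 * nu t (s t) + 1"
      have k: "k > 0" using nu_nonneg [OF t, of "s t"] by (simp add: k_def)
      then have "e / k > 0" using e by simp
      then obtain b where b: "b \<in> commutant S" "cs_norm alg (cs_diff alg x (Q b)) < e / k" using ap by blast
      have bG: "b \<in> G" and bs: "b t * s t = s t * b t" using b(1) s t by (auto simp: commutant_def)
      have d: "nu t (w t - b t) \<le> e / k"
        using nu_le_norm [OF G_diff [OF w(2) bG] t] b(2) by (simp add: w(1) alg_ops)
      have "w t * s t - s t * w t = (w t - b t) * s t - s t * (w t - b t)" using bs by (simp add: algebra_simps)
      then have "nu t (w t * s t - s t * w t) \<le> nu t ((w t - b t) * s t) + nu t (s t * (w t - b t))"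
        using nu_diff_le [OF t] by simp
      also have "\<dots> \<le> nu t (w t - b t) * nu t (s t) + nu t (s t) * nu t (w t - b t)"
        by (intro add_mono nu_mult t)
      also have "\<dots> = nu t (w t - b t) * (2 * nu t (s t))" by simp
      also have "\<dots> \<le> (e / k) * k"
        by (rule mult_mono [OF d]) (use e k nu_nonneg [OF t] in \<open>auto simp: k_def\<close>)
      finally show ?thesis using k by simp
    qed
    then have "nu t (w t * s t - s t * w t) \<le> 0" by (rule field_le_epsilon)
    then have "nu t (w t * s t - s t * w t) = 0" using nu_nonneg [OF t, of "w t * s t - s t * w t"] by (rule antisym)
    then show ?thesis using nu_eq_0 [OF t] by simp
  qed
  then show "x \<in> Q ` commutant S" using w by (auto simp: commutant_def)
qed

text \<open>Adjoin c to the subalgebra and take the double commutant. The enlarged set S is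
  commutative, so it lies in its commutant, and hence so does its double commutant, which is
  therefore abelian. It is a sub-C*-algebra containing \<open>Bs\<close>, and maximality identifies
  the two.\<close>

lemma maximal_abelian_selfadjoint:
  assumes max: "maximal_abelian alg Bs" and c: "c \<in> G" "\<And>t. t \<in> X \<Longrightarrow> adj (c t) = c t"
    and comm: "\<And>b t. \<lbrakk>b \<in> pull Bs; t \<in> X\<rbrakk> \<Longrightarrow> c t * b t = b t * c t"
  shows "c \<in> pull Bs"
proof -
  have ab: "abelian_sub_cstar_algebra alg Bs" and mx: "\<And>C. \<lbrakk>abelian_sub_cstar_algebra alg C; Bs \<subseteq> C\<rbrakk> \<Longrightarrow> C = Bs"
    using max by (auto simp: maximal_abelian_def)
  have sub: "sub_cstar_algebra alg Bs" using ab by (simp add: abelian_sub_cstar_algebra_def)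
  define S where "S = insert c (pull Bs)"
  have SG: "S \<subseteq> G" using c by (auto simp: S_def pull_def)
  have bb: "b t * b' t = b' t * b t" if "b \<in> pull Bs" "b' \<in> pull Bs" "t \<in> X" for b b' t
  proof -
    have "cs_mult alg (Q b) (Q b') = cs_mult alg (Q b') (Q b)"
      using ab that by (auto simp: abelian_sub_cstar_algebra_def pull_def)
    then show ?thesis using that(3) by (simp add: alg_ops Q_eq)
  qed
  have SS: "s t * s' t = s' t * s t" if "s \<in> S" "s' \<in> S" "t \<in> X" for s s' t
    using that comm bb unfolding S_def by (elim insertE) simp_all
  have Sadj: "\<exists>s'\<in>S. \<forall>t\<in>X. s' t = adj (s t)" if "s \<in> S" for s
  proof (cases "s = c")
    case True
    then show ?thesis using c by (intro bexI [of _ c]) (auto simp: S_def)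
  next
    case False
    then have "(\<lambda>t. adj (s t)) \<in> pull Bs" using that pull_closed(4) [OF sub] by (auto simp: S_def)
    then show ?thesis by (intro bexI [of _ "\<lambda>t. adj (s t)"]) (auto simp: S_def)
  qed
  have S'adj: "\<exists>s'\<in>commutant S. \<forall>t\<in>X. s' t = adj (s t)" if s: "s \<in> commutant S" for s
  proof -
    have "cs_star alg (Q s) \<in> Q ` commutant S"
      using commutant_sub_algebra [OF Sadj] s unfolding sub_cstar_algebra_def by blast
    then obtain s' where "s' \<in> commutant S" "Q s' = Q (\<lambda>t. adj (s t))" by (auto simp: alg_ops)
    then show ?thesis by (auto simp: Q_eq)
  qed
  define C where "C = commutant (commutant S)"
  have S1: "S \<subseteq> commutant S" using SS SG by (auto simp: commutant_def)
  have CS: "C \<subseteq> commutant S" using S1 unfolding C_def commutant_def by blast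
  have SC: "S \<subseteq> C" using SG unfolding C_def commutant_def by force
  have "abelian_sub_cstar_algebra alg (Q ` C)"
    unfolding abelian_sub_cstar_algebra_def
  proof (intro conjI ballI)
    show "sub_cstar_algebra alg (Q ` C)" unfolding C_def by (rule commutant_sub_algebra [OF S'adj])
    fix x y assume "x \<in> Q ` C" "y \<in> Q ` C"
    then obtain g h where gh: "x = Q g" "y = Q h" "g \<in> C" "h \<in> C" by blast
    have "h \<in> commutant S" using gh CS by blast
    then have "\<forall>t\<in>X. g t * h t = h t * g t" using gh(3) unfolding C_def commutant_def by blast
    then show "cs_mult alg x y = cs_mult alg y x" unfolding gh alg_ops Q_eq .
  qed
  moreover have "Bs \<subseteq> Q ` C"
  proof
    fix x assume x: "x \<in> Bs"
    then obtain g where "x = Q g" "g \<in> G" using sub by (auto simp: sub_cstar_algebra_def alg_ops)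
    then show "x \<in> Q ` C" using x SC by (auto simp: S_def pull_def)
  qed
  ultimately have "Q ` C = Bs" by (rule mx)
  moreover have "c \<in> C" using SC by (auto simp: S_def)
  ultimately show ?thesis using c by (auto simp: pull_def)
qed

text \<open>The adjoint of c also commutes with the self-adjoint set \<open>pull Bs\<close>, so the
  self-adjoint case applies to the real and imaginary parts of c.\<close>

lemma maximal_abelian_commutant:
  assumes max: "maximal_abelian alg Bs" and c: "c \<in> G"
    and comm: "\<And>b t. \<lbrakk>b \<in> pull Bs; t \<in> X\<rbrakk> \<Longrightarrow> c t * b t = b t * c t"
  shows "c \<in> pull Bs"
proof -
  have sub: "sub_cstar_algebra alg Bs" using max by (simp add: maximal_abelian_def abelian_sub_cstar_algebra_def)
  have acomm: "adj (c t) * b t = b t * adj (c t)" if b: "b \<in> pull Bs" and t: "t \<in> X" for b t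
  proof -
    have "adj (c t) * b t = adj (adj (b t) * c t)" by (simp add: adj_mult)
    also have "\<dots> = adj (c t * adj (b t))" using comm [OF pull_closed(4) [OF sub b] t] by simp
    also have "\<dots> = b t * adj (c t)" by (simp add: adj_mult)
    finally show ?thesis .
  qed
  define c1 where "c1 = (\<lambda>t. c t + adj (c t))"
  define c2 where "c2 = (\<lambda>t. cc \<i> * (c t - adj (c t)))"
  have c1: "c1 \<in> pull Bs"
  proof (rule maximal_abelian_selfadjoint [OF max])
    show "c1 \<in> G" unfolding c1_def by (intro G_add G_adj c)
    show "adj (c1 t) = c1 t" for t by (simp add: c1_def adj_add add.commute)
    show "c1 t * b t = b t * c1 t" if "b \<in> pull Bs" "t \<in> X" for b t
      using comm [OF that] acomm [OF that] by (simp only: c1_def distrib_left distrib_right)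
  qed
  have c2: "c2 \<in> pull Bs"
  proof (rule maximal_abelian_selfadjoint [OF max])
    show "c2 \<in> G" unfolding c2_def by (rule G_scale [OF G_diff [OF c G_adj [OF c]]])
    show "adj (c2 t) = c2 t" for t by (simp add: c2_def adj_mult adj_diff cc_comm cc_minus algebra_simps)
    show "c2 t * b t = b t * c2 t" if "b \<in> pull Bs" "t \<in> X" for b t
    proof -
      have "(c t - adj (c t)) * b t = b t * (c t - adj (c t))"
        using comm [OF that] acomm [OF that] by (simp only: left_diff_distrib right_diff_distrib)
      then show ?thesis unfolding c2_def by (metis cc_left_comm mult.assoc)
    qed
  qed
  have "(\<lambda>t. cc (1/2) * c1 t + cc (- \<i>/2) * c2 t) \<in> pull Bs"
    by (rule pull_closed(1) [OF sub pull_closed(3) [OF sub c1] pull_closed(3) [OF sub c2]])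
  moreover have "(\<lambda>t. cc (1/2) * c1 t + cc (- \<i>/2) * c2 t) = c"
  proof
    fix t
    have "cc (1/2) * c1 t + cc (- \<i>/2) * c2 t = cc (1/2) * (c t + adj (c t)) + cc (1/2) * (c t - adj (c t))"
      by (simp add: c1_def c2_def cc_cc_mult)
    also have "\<dots> = cc (1/2) * c t + cc (1/2) * c t" by (simp add: distrib_left right_diff_distrib)
    also have "\<dots> = cc (1/2 + 1/2) * c t" by (simp only: cc_add distrib_right)
    finally show "cc (1/2) * c1 t + cc (- \<i>/2) * c2 t = c t" by simp
  qed
  ultimately show ?thesis by simp
qed

lemma cartan_field_pull:
  assumes Bs: "cartan_subalgebra alg Bs"
  shows "\<exists>E. cartan_field X nu G (pull Bs) E"
proof -
  have max: "maximal_abelian alg Bs" and ab: "abelian_sub_cstar_algebra alg Bs"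
    using Bs by (auto simp: cartan_subalgebra_def)
  have sub: "sub_cstar_algebra alg Bs" using ab by (simp add: abelian_sub_cstar_algebra_def)
  obtain Es where Es: "conditional_expectation alg Bs Es" using Bs by (auto simp: cartan_subalgebra_def)
  have Bsub: "Bs \<subseteq> Q ` G" using sub by (simp add: sub_cstar_algebra_def alg_ops)
  \<comment> \<open>A preimage under Q is determined on X only, so E is a choice of
    representatives.\<close>
  define E where "E = (\<lambda>g. SOME h. h \<in> G \<and> Q h = Es (Q g))"
  have EB: "Es (Q g) \<in> Bs" if "g \<in> G" for g using Es that by (auto simp: conditional_expectation_def alg_ops)
  have E: "E g \<in> G" "Q (E g) = Es (Q g)" if "g \<in> G" for g
  proof -
    have "\<exists>h. h \<in> G \<and> Q h = Es (Q g)" using EB [OF that] Bsub by force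
    from someI_ex [OF this] show "E g \<in> G" "Q (E g) = Es (Q g)" by (auto simp: E_def)
  qed
  have Eeq: "E g t = h t" if "g \<in> G" "Es (Q g) = Q h" "t \<in> X" for g h t
    using E(2) [OF that(1)] that(2,3) by (auto simp: Q_eq)
  show ?thesis
  proof (rule exI [of _ E], unfold_locales)
    show "b \<in> G" if "b \<in> pull Bs" for b using that by (simp add: pull_def)
    show "b t * b' t = b' t * b t" if "b \<in> pull Bs" "b' \<in> pull Bs" "t \<in> X" for b b' t
    proof -
      have "cs_mult alg (Q b) (Q b') = cs_mult alg (Q b') (Q b)"
        using ab that by (auto simp: abelian_sub_cstar_algebra_def pull_def)
      then show ?thesis using that(3) by (simp add: alg_ops Q_eq)
    qed
    show "(\<lambda>t. adj (b t)) \<in> pull Bs" if "b \<in> pull Bs" for b by (rule pull_closed(4) [OF sub that])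
    show "c \<in> pull Bs" if "c \<in> G" "\<And>b t. \<lbrakk>b \<in> pull Bs; t \<in> X\<rbrakk> \<Longrightarrow> c t * b t = b t * c t" for c
      by (rule maximal_abelian_commutant [OF max that(1)]) (rule that(2))
    show "E a \<in> pull Bs" if "a \<in> G" for a using E [OF that] EB [OF that] by (simp add: pull_def)
    show "E b t = b t" if "b \<in> pull Bs" "t \<in> X" for b t
      by (rule Eeq) (use that Es in \<open>auto simp: pull_def conditional_expectation_def\<close>)
    show "E (\<lambda>t. a t + a' t) t = E a t + E a' t" if "a \<in> G" "a' \<in> G" "t \<in> X" for a a' t
    proof (rule Eeq [OF G_add [OF that(1,2)] _ that(3)])
      have "Es (cs_add alg (Q a) (Q a')) = cs_add alg (Es (Q a)) (Es (Q a'))"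
        using Es that by (simp add: conditional_expectation_def alg_ops(1))
      then show "Es (Q (\<lambda>t. a t + a' t)) = Q (\<lambda>t. E a t + E a' t)"
        by (simp only: alg_ops(3) E(2) [OF that(1), symmetric] E(2) [OF that(2), symmetric])
    qed
    show "E (\<lambda>t. cc z * a t) t = cc z * E a t" if "a \<in> G" "t \<in> X" for a z t
    proof (rule Eeq [OF G_scale [OF that(1)] _ that(2)])
      have "Es (cs_scale alg z (Q a)) = cs_scale alg z (Es (Q a))"
        using Es that by (simp add: conditional_expectation_def alg_ops(1))
      then show "Es (Q (\<lambda>t. cc z * a t)) = Q (\<lambda>t. cc z * E a t)"
        by (simp only: alg_ops(4) E(2) [OF that(1), symmetric])
    qed
    show "E (\<lambda>t. b t * a t) t = b t * E a t" if "b \<in> pull Bs" "a \<in> G" "t \<in> X" for b a t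
    proof (rule Eeq [OF G_mult [OF _ that(2)] _ that(3)])
      show "b \<in> G" using that by (simp add: pull_def)
      have "Es (cs_mult alg (Q b) (Q a)) = cs_mult alg (Q b) (Es (Q a))"
        using Es that by (simp add: conditional_expectation_def alg_ops(1) pull_def)
      then show "Es (Q (\<lambda>t. b t * a t)) = Q (\<lambda>t. b t * E a t)"
        by (simp only: alg_ops(5) E(2) [OF that(2), symmetric])
    qed
    show "nu t (E a t) \<le> k" if "a \<in> G" "\<And>t. t \<in> X \<Longrightarrow> nu t (a t) \<le> k" "t \<in> X" for a k t
    proof -
      have "nu t (E a t) \<le> cs_norm alg (Q (E a))" by (rule nu_le_norm [OF E(1) [OF that(1)] that(3)])
      also have "\<dots> \<le> cs_norm alg (Q a)"
        using Es that(1) by (simp add: conditional_expectation_def alg_ops(1) E(2) [OF that(1)])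
      also have "\<dots> \<le> k" by (rule norm_leI [OF that(2)])
      finally show ?thesis .
    qed
  qed
qed

theorem cartan_trivialization:
  assumes Bs: "cartan_subalgebra alg Bs" and X: "X = sphere 0 1" and dim: "DIM('v) \<ge> 4"
  obtains \<phi> :: "('v \<Rightarrow> 'a) \<Rightarrow> 'v \<Rightarrow> complex^'n^'n" where
    "star_iso alg (matrix_functions (top_of_set X)) \<phi>" "\<phi> ` Bs = diagonal_functions (top_of_set X)"
proof -
  obtain E where "cartan_field X nu G (pull Bs) E" using cartan_field_pull [OF Bs] by blast
  then interpret cf: cartan_field X nu G "pull Bs" E .
  obtain e where fr: "cf.frame X e" using cf.sphere_frame [OF X dim] by blast
  define M where "M = (\<lambda>t. mcoef (\<lambda>i j. e i j t))"
  define N where "N = (\<lambda>t. mcomb (\<lambda>i j. e i j t))"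
  have NM: "N t (M t x) = x" and MN: "M t (N t m) = m" and M_add: "M t (x + y) = M t x + M t y"
    and M_mult: "M t (x * y) = M t x ** M t y" and M_adj: "M t (adj x) = conj_transpose (M t x)"
    if "t \<in> X" for t x y m
    using cf.frameD(2) [OF fr that]
    by (simp_all add: M_def N_def mcomb_mcoef mcoef_mcomb mcoef_add mcoef_mult mcoef_adj)
  have M_scale: "M t (cc c * x) = (\<chi> i j. c * M t x $ i $ j)" if "t \<in> X" for t x c
    unfolding M_def by (rule mcoef_scale [OF cf.frameD(2) [OF fr that]])
  \<comment> \<open>Pull the value back from the fibre over t to M_n, then take coordinates in the
    global frame.\<close>
  define \<phi> where "\<phi> = (\<lambda>f. \<lambda>t\<in>X. M t (inv_into UNIV (\<Psi> t) (f t)))"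
  have inv: "inv_into UNIV (\<Psi> t) (\<Psi> t x) = x" if "t \<in> X" for t x
    by (rule inv_into_f_f) (auto intro: injI \<Psi>_inj [OF that])
  have \<phi>Q: "\<phi> (Q g) = (\<lambda>t\<in>X. M t (g t))" for g by (auto simp: \<phi>_def Q_def inv)
  have car: "cs_carrier (matrix_functions (top_of_set X) :: ('v \<Rightarrow> complex^'n^'n) cstar) = {f \<in> extensional X. continuous_on X f}"
    by (simp add: matrix_functions_def pointwise_algebra_def)
  have Mc: "continuous_on X (\<lambda>t. M t (g t))" if "g \<in> G" for g unfolding M_def by (rule cf.mcoef_continuous [OF fr that])
  have Nc: "(\<lambda>t. N t (f t)) \<in> G" if "continuous_on X f" for f unfolding N_def by (rule cf.mcomb_section [OF fr that])
  have \<phi>N: "\<phi> (Q (\<lambda>t. N t (f t))) = f" if "f \<in> extensional X" for f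
    using that by (auto simp: \<phi>Q MN extensional_def restrict_def)
  have iso: "star_iso alg (matrix_functions (top_of_set X)) \<phi>"
    unfolding star_iso_def
  proof (intro conjI ballI allI)
    show "bij_betw \<phi> (cs_carrier alg) (cs_carrier (matrix_functions (top_of_set X)))"
      unfolding bij_betw_def
    proof
      show "inj_on \<phi> (cs_carrier alg)"
      proof (rule inj_onI)
        fix x y assume "x \<in> cs_carrier alg" "y \<in> cs_carrier alg" and eq: "\<phi> x = \<phi> y"
        then obtain g h where gh: "x = Q g" "y = Q h" by (auto simp: alg_ops)
        have "g t = h t" if t: "t \<in> X" for t
        proof -
          have "M t (g t) = M t (h t)" using fun_cong [OF eq, of t] t by (simp add: gh \<phi>Q)
          then show ?thesis using NM [OF t] by metis
        qed
        then show "x = y" by (simp add: gh Q_eq)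
      qed
      show "\<phi> ` cs_carrier alg = cs_carrier (matrix_functions (top_of_set X))"
      proof (intro subset_antisym subsetI)
        fix y assume "y \<in> \<phi> ` cs_carrier alg"
        then obtain g where "g \<in> G" "y = \<phi> (Q g)" by (auto simp: alg_ops)
        then show "y \<in> cs_carrier (matrix_functions (top_of_set X))"
          unfolding car by (auto simp: \<phi>Q intro!: continuous_on_eq [OF Mc])
      next
        fix y :: "'v \<Rightarrow> complex^'n^'n" assume "y \<in> cs_carrier (matrix_functions (top_of_set X))"
        then have y: "y \<in> extensional X" "continuous_on X y" by (auto simp: car)
        show "y \<in> \<phi> ` cs_carrier alg"
          unfolding alg_ops using \<phi>N [OF y(1)] Nc [OF y(2)] by (metis image_eqI)
      qed
    qed
  next
    fix x y assume "x \<in> cs_carrier alg" "y \<in> cs_carrier alg"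
    then obtain g h where gh: "x = Q g" "y = Q h" by (auto simp: alg_ops)
    show "\<phi> (cs_add alg x y) = cs_add (matrix_functions (top_of_set X)) (\<phi> x) (\<phi> y)"
      by (auto simp: gh alg_ops \<phi>Q matrix_functions_def pointwise_algebra_def matrix_algebra_def M_add)
    show "\<phi> (cs_mult alg x y) = cs_mult (matrix_functions (top_of_set X)) (\<phi> x) (\<phi> y)"
      by (auto simp: gh alg_ops \<phi>Q matrix_functions_def pointwise_algebra_def matrix_algebra_def M_mult)
  next
    fix x assume "x \<in> cs_carrier alg"
    then obtain g where g: "x = Q g" by (auto simp: alg_ops)
    show "\<phi> (cs_scale alg c x) = cs_scale (matrix_functions (top_of_set X)) c (\<phi> x)" for c
      by (auto simp: g alg_ops \<phi>Q matrix_functions_def pointwise_algebra_def matrix_algebra_def M_scale)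
    show "\<phi> (cs_star alg x) = cs_star (matrix_functions (top_of_set X)) (\<phi> x)"
      by (auto simp: g alg_ops \<phi>Q matrix_functions_def pointwise_algebra_def matrix_algebra_def M_adj)
  qed
  have "\<phi> ` Bs = diagonal_functions (top_of_set X)"
  proof (intro subset_antisym subsetI)
    fix y assume "y \<in> \<phi> ` Bs"
    then obtain x where x: "x \<in> Bs" "y = \<phi> x" by blast
    have "Bs \<subseteq> cs_carrier alg" using Bs by (simp add: cartan_subalgebra_def abelian_sub_cstar_algebra_def sub_cstar_algebra_def)
    then obtain g where g: "g \<in> G" "x = Q g" using x by (auto simp: alg_ops)
    have gB: "g \<in> pull Bs" using g x by (simp add: pull_def)
    have "y \<in> cs_carrier (matrix_functions (top_of_set X))"
      unfolding car x g by (auto simp: \<phi>Q intro!: continuous_on_eq [OF Mc [OF g(1)]])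
    moreover have "y t \<in> diagonal_matrices" if "t \<in> X" for t
      using cf.mcoef_diagonal [OF fr gB that] that by (simp add: x g \<phi>Q M_def)
    ultimately show "y \<in> diagonal_functions (top_of_set X)" by (simp add: diagonal_functions_def)
  next
    fix y :: "'v \<Rightarrow> complex^'n^'n" assume "y \<in> diagonal_functions (top_of_set X)"
    then have y: "y \<in> extensional X" "continuous_on X y" "\<And>t. t \<in> X \<Longrightarrow> y t \<in> diagonal_matrices"
      by (auto simp: diagonal_functions_def car)
    have "(\<lambda>t. N t (y t)) \<in> pull Bs" unfolding N_def by (rule cf.mcomb_diagonal [OF fr y(2,3)])
    then have "Q (\<lambda>t. N t (y t)) \<in> Bs" by (simp add: pull_def)
    then show "y \<in> \<phi> ` Bs" using \<phi>N [OF y(1)] by (metis image_eqI)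
  qed
  then show ?thesis using that iso by blast
qed

end

section \<open>The section algebra of a C*-bundle\<close>

text \<open>The inverse of an isomorphism of a fibre with M_n, defined on all of M_n; it plays the
  part of \<open>\<Psi> t\<close>.\<close>

definition unrep :: "'a cstar \<Rightarrow> ('a \<Rightarrow> complex^'n^'n) \<Rightarrow> 'n::finite cmat \<Rightarrow> 'a" where
  "unrep A \<phi> x = inv_into (cs_carrier A) \<phi> (rep_cmat x)"

context
  fixes A :: "'a cstar" and \<phi> :: "'a \<Rightarrow> complex^'n::finite^'n"
  assumes iso: "star_iso A matrix_algebra \<phi>" and A: "cstar_algebra A"
begin

lemma unrep_carrier: "unrep A \<phi> x \<in> cs_carrier A" and phi_unrep: "\<phi> (unrep A \<phi> x) = rep_cmat x"
proof -
  have "rep_cmat x \<in> \<phi> ` cs_carrier A"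
    using iso by (auto simp: star_iso_def bij_betw_def matrix_algebra_def)
  then show "unrep A \<phi> x \<in> cs_carrier A" "\<phi> (unrep A \<phi> x) = rep_cmat x"
    unfolding unrep_def by (auto intro: inv_into_into f_inv_into_f)
qed

lemma unrep_eqI: "\<lbrakk>y \<in> cs_carrier A; \<phi> y = rep_cmat x\<rbrakk> \<Longrightarrow> y = unrep A \<phi> x"
  using iso unrep_carrier phi_unrep by (metis star_iso_def bij_betw_def inj_onD)

lemma unrep_inj: "unrep A \<phi> x = unrep A \<phi> y \<Longrightarrow> x = y"
  by (metis phi_unrep cmat_eqI)

lemma unrep_surj: "y \<in> cs_carrier A \<Longrightarrow> unrep A \<phi> (Cmat (\<phi> y)) = y"
  by (rule unrep_eqI [symmetric]) auto

lemma unrep_add: "cs_add A (unrep A \<phi> x) (unrep A \<phi> y) = unrep A \<phi> (x + y)"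
  by (rule unrep_eqI)
    (use iso cstar_algebra.add_closed [OF A] in \<open>auto simp: star_iso_def unrep_carrier phi_unrep matrix_algebra_def\<close>)

lemma unrep_scale: "cs_scale A c (unrep A \<phi> x) = unrep A \<phi> (cc c * x)"
  by (rule unrep_eqI)
    (use iso cstar_algebra.scale_closed [OF A] in \<open>auto simp: star_iso_def unrep_carrier phi_unrep matrix_algebra_def rep_cc_mult simp del: rep_simps\<close>)

lemma unrep_mult: "cs_mult A (unrep A \<phi> x) (unrep A \<phi> y) = unrep A \<phi> (x * y)"
  by (rule unrep_eqI)
    (use iso cstar_algebra.mult_closed [OF A] in \<open>auto simp: star_iso_def unrep_carrier phi_unrep matrix_algebra_def\<close>)

lemma unrep_star: "cs_star A (unrep A \<phi> x) = unrep A \<phi> (adj x)"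
  by (rule unrep_eqI)
    (use iso cstar_algebra.star_closed [OF A] in \<open>auto simp: star_iso_def unrep_carrier phi_unrep matrix_algebra_def adj_def\<close>)

text \<open>\<open>star_iso\<close> does not mention zero; additivity applied to 0 + 0 shows that it
  is preserved.\<close>

lemma unrep_zero: "cs_zero A = unrep A \<phi> 0"
proof (rule unrep_eqI)
  show z: "cs_zero A \<in> cs_carrier A" by (rule cstar_algebra.zero_closed [OF A])
  have "\<phi> (cs_zero A) = \<phi> (cs_add A (cs_zero A) (cs_zero A))"
    by (simp add: cstar_algebra.add_zero [OF A z])
  also have "\<dots> = \<phi> (cs_zero A) + \<phi> (cs_zero A)"
    using iso z by (simp add: star_iso_def matrix_algebra_def)
  finally show "\<phi> (cs_zero A) = rep_cmat 0" by simp
qed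

lemma unrep_diff: "cs_diff A (unrep A \<phi> x) (unrep A \<phi> y) = unrep A \<phi> (x - y)"
  by (simp add: cs_diff_def unrep_scale unrep_add cc_minus)

end

lemma openin_eventually_within:
  assumes "openin (top_of_set X) V" "t \<in> V" shows "\<forall>\<^sub>F u in at t within X. u \<in> V"
proof -
  obtain T where "open T" "V = X \<inter> T" using assms(1) by (auto simp: openin_open)
  then show ?thesis using assms(2) unfolding eventually_at_topological by blast
qed

text \<open>Continuity on the fibre product, restated with open boxes of the total space.\<close>

lemma openin_bin_preimage:
  assumes f: "continuous_map (fibre_product \<xi>) (total_space \<xi>) (\<lambda>(x, y). f x y)"
    and O: "openin (total_space \<xi>) U" "f a b \<in> U" and ab: "a \<in> topspace (total_space \<xi>)" "b \<in> topspace (total_space \<xi>)" "proj \<xi> a = proj \<xi> b"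
  obtains V W where "openin (total_space \<xi>) V" "openin (total_space \<xi>) W" "a \<in> V" "b \<in> W"
    "\<And>x y. \<lbrakk>x \<in> V; y \<in> W; proj \<xi> x = proj \<xi> y\<rbrakk> \<Longrightarrow> f x y \<in> U"
proof -
  define P where "P = {p \<in> topspace (fibre_product \<xi>). (\<lambda>(x, y). f x y) p \<in> U}"
  have "openin (fibre_product \<xi>) P"
    unfolding P_def by (rule openin_continuous_map_preimage [OF f O(1)])
  then have "\<exists>T. openin (prod_topology (total_space \<xi>) (total_space \<xi>)) T \<and> P = T \<inter> {(x, y). proj \<xi> x = proj \<xi> y}"
    unfolding fibre_product_def openin_subtopology .
  then obtain T where T: "openin (prod_topology (total_space \<xi>) (total_space \<xi>)) T" "P = T \<inter> {(x, y). proj \<xi> x = proj \<xi> y}"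
    by blast
  have "(a, b) \<in> P" using ab O(2) by (simp add: P_def fibre_product_def)
  then have "(a, b) \<in> T" using T(2) by blast
  then have "\<exists>V W. openin (total_space \<xi>) V \<and> openin (total_space \<xi>) W \<and> a \<in> V \<and> b \<in> W \<and> V \<times> W \<subseteq> T"
    using T(1) [unfolded openin_prod_topology_alt, rule_format] by simp
  then obtain V W where VW: "openin (total_space \<xi>) V" "openin (total_space \<xi>) W" "a \<in> V" "b \<in> W" "V \<times> W \<subseteq> T"
    by blast
  show ?thesis
  proof (rule that [OF VW(1-4)])
    fix x y assume "x \<in> V" "y \<in> W" "proj \<xi> x = proj \<xi> y"
    then have "(x, y) \<in> P" using VW(5) T(2) by blast
    then show "f x y \<in> U" by (simp add: P_def)
  qed
qed

text \<open>The isomorphisms with M_n are chosen fibre by fibre, and all continuity is carried by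
  the transported topology \<open>Op\<close>. The axioms of a continuous field then come from the
  existence theorem for sections.\<close>

lemma bundle_cstar_rep:
  fixes X :: "'v::euclidean_space set" and \<xi> :: "('v, 'e) cbundle"
  assumes X: "compact X" "X \<noteq> {}" and \<xi>: "cstar_bundle_with_fibre (top_of_set X) \<xi> (matrix_algebra :: (complex^'n::finite^'n) cstar)"
  obtains nu and G :: "('v \<Rightarrow> 'n::finite cmat) set" and \<Psi> where "cstar_rep X nu G (fibre \<xi>) \<Psi>"
    "section_algebra (top_of_set X) \<xi> = pointwise_algebra X (fibre \<xi>) ((\<lambda>g. \<lambda>t\<in>X. \<Psi> t (g t)) ` G)"
proof -
  let ?E = "total_space \<xi>"
  interpret b: cstar_bundle "top_of_set X" \<xi> using \<xi> by (simp add: cstar_bundle_with_fibre_def)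
  have "\<forall>t\<in>X. \<exists>f :: 'e \<Rightarrow> complex^'n^'n. star_iso (fibre \<xi> t) matrix_algebra f"
    using \<xi> by (simp add: cstar_bundle_with_fibre_def star_isomorphic_def)
  then obtain \<phi> :: "'v \<Rightarrow> 'e \<Rightarrow> complex^'n^'n" where iso: "\<And>t. t \<in> X \<Longrightarrow> star_iso (fibre \<xi> t) matrix_algebra (\<phi> t)"
    by metis
  have cst: "cstar_algebra (fibre \<xi> t)" if "t \<in> X" for t using b.fibre_cstar that by simp
  define \<Psi> where "\<Psi> = (\<lambda>t. unrep (fibre \<xi> t) (\<phi> t))"
  \<comment> \<open>Transporting the norm of the bundle, instead of using the operator norm, avoids
    showing that algebraic *-isomorphisms are isometric.\<close>
  define nu where "nu = (\<lambda>t x. fib_norm \<xi> (\<Psi> t x))"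
  define Op where "Op = {{(u, x). u \<in> X \<and> \<Psi> u x \<in> W} |W. openin ?E W}"
  have fcar: "cs_carrier (fibre \<xi> t) = {e \<in> topspace ?E. proj \<xi> e = t}" for t by (simp add: fibre_def)
  have \<Psi>c: "\<Psi> t x \<in> topspace ?E" "proj \<xi> (\<Psi> t x) = t" "\<Psi> t x \<in> cs_carrier (fibre \<xi> t)" if "t \<in> X" for t x
    using unrep_carrier [OF iso [OF that] cst [OF that], of x] by (simp_all add: \<Psi>_def fcar)
  have \<Psi>inj: "x = y" if "t \<in> X" "\<Psi> t x = \<Psi> t y" for t x y
    using unrep_inj [OF iso [OF that(1)] cst [OF that(1)]] that(2) by (simp add: \<Psi>_def)
  have \<Psi>surj: "\<exists>x. e = \<Psi> (proj \<xi> e) x" "proj \<xi> e \<in> X" if e: "e \<in> topspace ?E" for e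
  proof -
    show p: "proj \<xi> e \<in> X" using b.proj_surj e by auto
    have "e \<in> cs_carrier (fibre \<xi> (proj \<xi> e))" using e by (simp add: fcar)
    then have "\<Psi> (proj \<xi> e) (Cmat (\<phi> (proj \<xi> e) e)) = e"
      unfolding \<Psi>_def by (rule unrep_surj [OF iso [OF p] cst [OF p]])
    then show "\<exists>x. e = \<Psi> (proj \<xi> e) x" by metis
  qed
  have ops: "cs_zero (fibre \<xi> t) = \<Psi> t 0" "cs_add (fibre \<xi> t) (\<Psi> t x) (\<Psi> t y) = \<Psi> t (x + y)"
    "cs_scale (fibre \<xi> t) c (\<Psi> t x) = \<Psi> t (cc c * x)" "cs_mult (fibre \<xi> t) (\<Psi> t x) (\<Psi> t y) = \<Psi> t (x * y)"
    "cs_star (fibre \<xi> t) (\<Psi> t x) = \<Psi> t (adj x)" "cs_diff (fibre \<xi> t) (\<Psi> t x) (\<Psi> t y) = \<Psi> t (x - y)"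
    if "t \<in> X" for t x y c
    unfolding \<Psi>_def using iso [OF that] cst [OF that]
    by (simp_all add: unrep_zero unrep_add unrep_scale unrep_mult unrep_star unrep_diff)
  have fops: "fib_zero \<xi> t = \<Psi> t 0" "fib_add \<xi> (\<Psi> t x) (\<Psi> t y) = \<Psi> t (x + y)"
    "fib_scale \<xi> c (\<Psi> t x) = \<Psi> t (cc c * x)" "fib_mult \<xi> (\<Psi> t x) (\<Psi> t y) = \<Psi> t (x * y)"
    "fib_star \<xi> (\<Psi> t x) = \<Psi> t (adj x)" if "t \<in> X" for t x y c
    using ops [OF that] by (simp_all add: fibre_def)
  have nrm: "cs_norm (fibre \<xi> t) (\<Psi> t x) = nu t x" for t x by (simp add: nu_def fibre_def)
  have nf: "norm_field X nu"
  proof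
    fix t x y c assume t: "t \<in> X"
    interpret a: cstar_algebra "fibre \<xi> t" by (rule cst [OF t])
    note c = \<Psi>c(3) [OF t]
    show "0 \<le> nu t x" using a.norm_nonneg [OF c] by (simp add: nrm)
    show "(nu t x = 0) = (x = 0)" using a.norm_eq_zero [OF c] \<Psi>inj [OF t] by (auto simp: nrm ops [OF t])
    show "nu t (x + y) \<le> nu t x + nu t y" using a.norm_triangle [OF c c] by (simp add: nrm ops [OF t])
    show "nu t (cc c * x) = cmod c * nu t x" using a.norm_scale [OF c] by (simp add: nrm ops [OF t])
    show "nu t (x * y) \<le> nu t x * nu t y" using a.norm_mult [OF c c] by (simp add: nrm ops [OF t])
    show "nu t (adj x * x) = (nu t x)\<^sup>2" using a.cstar_identity [OF c] by (simp add: nrm ops [OF t])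
  qed (rule X)
  have OpI: "{(u, x). u \<in> X \<and> \<Psi> u x \<in> W} \<in> Op" if "openin ?E W" for W using that by (auto simp: Op_def)
  have OpE: "\<exists>W. openin ?E W \<and> U = {(u, x). u \<in> X \<and> \<Psi> u x \<in> W}" if "U \<in> Op" for U using that by (auto simp: Op_def)
  have bin: "\<exists>V\<in>Op. \<exists>W\<in>Op. (t, x) \<in> V \<and> (t, y) \<in> W \<and> (\<forall>u\<in>X. \<forall>x' y'. (u, x') \<in> V \<longrightarrow> (u, y') \<in> W \<longrightarrow> (u, h x' y') \<in> U)"
    if f: "continuous_map (fibre_product \<xi>) ?E (\<lambda>(x, y). f x y)" and fh: "\<And>t x y. t \<in> X \<Longrightarrow> f (\<Psi> t x) (\<Psi> t y) = \<Psi> t (h x y)"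
      and U: "U \<in> Op" "(t, h x y) \<in> U" and t: "t \<in> X" for f h U t x y
  proof -
    obtain R where R: "openin ?E R" "U = {(u, x). u \<in> X \<and> \<Psi> u x \<in> R}" using OpE [OF U(1)] by blast
    have "f (\<Psi> t x) (\<Psi> t y) \<in> R" using U(2) R(2) fh [OF t] by simp
    moreover have "proj \<xi> (\<Psi> t x) = proj \<xi> (\<Psi> t y)" using \<Psi>c t by simp
    ultimately obtain V W where VW: "openin ?E V" "openin ?E W" "\<Psi> t x \<in> V" "\<Psi> t y \<in> W"
      "\<And>x y. \<lbrakk>x \<in> V; y \<in> W; proj \<xi> x = proj \<xi> y\<rbrakk> \<Longrightarrow> f x y \<in> R"
      by (rule openin_bin_preimage [OF f R(1) _ \<Psi>c(1) [OF t] \<Psi>c(1) [OF t]]) blast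
    show ?thesis
    proof (intro bexI conjI ballI allI impI)
      show "(t, x) \<in> {(u, x). u \<in> X \<and> \<Psi> u x \<in> V}" "(t, y) \<in> {(u, x). u \<in> X \<and> \<Psi> u x \<in> W}" using VW t by auto
      fix u x' y' assume u: "u \<in> X" "(u, x') \<in> {(u, x). u \<in> X \<and> \<Psi> u x \<in> V}" "(u, y') \<in> {(u, x). u \<in> X \<and> \<Psi> u x \<in> W}"
      have "f (\<Psi> u x') (\<Psi> u y') \<in> R" by (rule VW(5)) (use u \<Psi>c in auto)
      then show "(u, h x' y') \<in> U" using u(1) fh R(2) by simp
    qed (use VW in \<open>auto intro: OpI\<close>)
  qed
  have una: "{(u, x). u \<in> X \<and> (u, h x) \<in> U} \<in> Op"
    if f: "continuous_map ?E ?E f" and fh: "\<And>t x. t \<in> X \<Longrightarrow> f (\<Psi> t x) = \<Psi> t (h x)" and U: "U \<in> Op" for f h U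
  proof -
    obtain R where R: "openin ?E R" "U = {(u, x). u \<in> X \<and> \<Psi> u x \<in> R}" using OpE [OF U] by blast
    have "{(u, x). u \<in> X \<and> (u, h x) \<in> U} = {(u, x). u \<in> X \<and> \<Psi> u x \<in> {e \<in> topspace ?E. f e \<in> R}}"
      using R(2) \<Psi>c(1) fh by auto
    then show ?thesis using OpI [OF openin_continuous_map_preimage [OF f R(1)]] by simp
  qed
  have mb: "mat_bundle X nu Op"
  proof (intro mat_bundle.intro nf mat_bundle_axioms.intro)
    fix U V assume UV: "U \<in> Op" "V \<in> Op"
    obtain R R' where R: "openin ?E R" "U = {(u, x). u \<in> X \<and> \<Psi> u x \<in> R}" "openin ?E R'" "V = {(u, x). u \<in> X \<and> \<Psi> u x \<in> R'}"
      using OpE [OF UV(1)] OpE [OF UV(2)] by blast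
    have "U \<inter> V = {(u, x). u \<in> X \<and> \<Psi> u x \<in> R \<inter> R'}" using R by auto
    then show "U \<inter> V \<in> Op" using OpI [OF openin_Int [OF R(1,3)]] by simp
  next
    fix U t x assume U: "U \<in> Op" "(t, x) \<in> U" and t: "t \<in> X"
    obtain R where R: "openin ?E R" "U = {(u, x). u \<in> X \<and> \<Psi> u x \<in> R}" using OpE [OF U(1)] by blast
    have "openin (top_of_set X) (proj \<xi> ` R)" using b.proj_open R(1) by (simp add: open_map_def)
    moreover have "t \<in> proj \<xi> ` R" using U(2) R(2) \<Psi>c(2) [OF t] by (metis (no_types, lifting) case_prodD image_eqI mem_Collect_eq)
    ultimately have "\<forall>\<^sub>F u in at t within X. u \<in> proj \<xi> ` R" by (rule openin_eventually_within)
    then show "\<forall>\<^sub>F u in at t within X. \<exists>y. (u, y) \<in> U"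
    proof (rule eventually_mono)
      fix u assume "u \<in> proj \<xi> ` R"
      then obtain e where e: "e \<in> R" "u = proj \<xi> e" by blast
      then have "e \<in> topspace ?E" using openin_subset [OF R(1)] by blast
      then obtain y where "e = \<Psi> u y" "u \<in> X" using \<Psi>surj [of e] e(2) by blast
      then show "\<exists>y. (u, y) \<in> U" using e(1) R(2) by (intro exI [of _ y]) simp
    qed
  next
    fix t and d :: real assume "t \<in> X" "d > 0"
    have "openin (top_of_set X) (X \<inter> ball t d)" by (intro openin_open_Int open_ball)
    then have op: "openin ?E {e \<in> topspace ?E. proj \<xi> e \<in> X \<inter> ball t d}"
      by (rule openin_continuous_map_preimage [OF b.proj_continuous])
    have eq: "{(u, x). u \<in> X \<and> dist u t < d} = {(u, x). u \<in> X \<and> \<Psi> u x \<in> {e \<in> topspace ?E. proj \<xi> e \<in> X \<inter> ball t d}}"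
      using \<Psi>c by (auto simp: dist_commute)
    show "{(u, x). u \<in> X \<and> dist u t < d} \<in> Op" unfolding eq by (rule OpI [OF op])
  next
    fix R :: "real set" assume "open R"
    then have op: "openin ?E {e \<in> topspace ?E. fib_norm \<xi> e \<in> R}"
      using openin_continuous_map_preimage [OF b.norm_continuous] by simp
    have eq: "{(u, x). u \<in> X \<and> nu u x \<in> R} = {(u, x). u \<in> X \<and> \<Psi> u x \<in> {e \<in> topspace ?E. fib_norm \<xi> e \<in> R}}"
      using \<Psi>c by (auto simp: nu_def)
    show "{(u, x). u \<in> X \<and> nu u x \<in> R} \<in> Op" unfolding eq by (rule OpI [OF op])
  next
    fix U t assume U: "U \<in> Op" "(t, 0) \<in> U" and t: "t \<in> X"
    obtain R where R: "openin ?E R" "U = {(u, x). u \<in> X \<and> \<Psi> u x \<in> R}" using OpE [OF U(1)] by blast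
    have "fib_zero \<xi> t \<in> R" using U(2) R(2) fops(1) [OF t] by simp
    then obtain V \<epsilon> where V: "openin (top_of_set X) V" "t \<in> V" "\<epsilon> > 0" "{x \<in> topspace ?E. proj \<xi> x \<in> V \<and> fib_norm \<xi> x < \<epsilon>} \<subseteq> R"
      using b.zero_nhds [of t R] t R(1) by auto
    obtain d where d: "d > 0" "\<And>u. \<lbrakk>u \<in> X; dist u t < d\<rbrakk> \<Longrightarrow> u \<in> V"
      using V(1,2) unfolding openin_euclidean_subtopology_iff by metis
    have "(u, x) \<in> U" if "u \<in> X" "dist u t < d" "nu u x < \<epsilon>" for u x
    proof -
      have "\<Psi> u x \<in> {x \<in> topspace ?E. proj \<xi> x \<in> V \<and> fib_norm \<xi> x < \<epsilon>}" using that d(2) \<Psi>c by (simp add: nu_def)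
      then show ?thesis using V(4) R(2) that(1) by blast
    qed
    then show "\<exists>d>0. \<exists>e>0. \<forall>u\<in>X. dist u t < d \<longrightarrow> (\<forall>x. nu u x < e \<longrightarrow> (u, x) \<in> U)" using d(1) V(3) by blast
  next
    fix U t x y assume a: "U \<in> Op" "(t, x + y) \<in> U" "t \<in> X"
    show "\<exists>V\<in>Op. \<exists>W\<in>Op. (t, x) \<in> V \<and> (t, y) \<in> W \<and> (\<forall>u\<in>X. \<forall>x' y'. (u, x') \<in> V \<longrightarrow> (u, y') \<in> W \<longrightarrow> (u, x' + y') \<in> U)"
      by (rule bin [where f = "fib_add \<xi>" and h = "(+)", OF b.add_continuous _ a]) (rule fops(2))
  next
    fix U t x y assume a: "U \<in> Op" "(t, x * y) \<in> U" "t \<in> X"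
    show "\<exists>V\<in>Op. \<exists>W\<in>Op. (t, x) \<in> V \<and> (t, y) \<in> W \<and> (\<forall>u\<in>X. \<forall>x' y'. (u, x') \<in> V \<longrightarrow> (u, y') \<in> W \<longrightarrow> (u, x' * y') \<in> U)"
      by (rule bin [where f = "fib_mult \<xi>" and h = "(*)", OF b.mult_continuous _ a]) (rule fops(4))
  next
    fix U c assume a: "U \<in> Op"
    show "{(u, x). u \<in> X \<and> (u, cc c * x) \<in> U} \<in> Op" by (rule una [where f = "fib_scale \<xi> c" and h = "\<lambda>x. cc c * x", OF b.scale_continuous _ a]) (rule fops(3))
  next
    fix U assume a: "U \<in> Op"
    show "{(u, x). u \<in> X \<and> (u, adj x) \<in> U} \<in> Op" by (rule una [where f = "fib_star \<xi>" and h = adj, OF b.star_continuous _ a]) (rule fops(5))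
  next
    fix t and s :: "nat \<Rightarrow> 'n cmat" assume t: "t \<in> X" and ca: "\<And>e. e > 0 \<Longrightarrow> \<exists>N. \<forall>i\<ge>N. \<forall>j\<ge>N. nu t (s i - s j) < e"
    have "\<exists>x\<in>cs_carrier (fibre \<xi> t). (\<lambda>i. cs_norm (fibre \<xi> t) (cs_diff (fibre \<xi> t) (\<Psi> t (s i)) x)) \<longlonglongrightarrow> 0"
      by (rule cstar_algebra.complete [OF cst [OF t]]) (use ca in \<open>simp_all add: \<Psi>c(3) [OF t] ops [OF t] nrm\<close>)
    then obtain x where x: "x \<in> cs_carrier (fibre \<xi> t)" "(\<lambda>i. cs_norm (fibre \<xi> t) (cs_diff (fibre \<xi> t) (\<Psi> t (s i)) x)) \<longlonglongrightarrow> 0" by blast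
    then obtain y where "x = \<Psi> t y" using \<Psi>surj [of x] by (auto simp: fcar)
    then show "\<exists>x. (\<lambda>i. nu t (s i - x)) \<longlonglongrightarrow> 0" using x(2) by (auto simp: ops [OF t] nrm)
  qed
  interpret mb: mat_bundle X nu Op by (rule mb)
  have rep: "cstar_rep X nu mb.sections (fibre \<xi>) \<Psi>"
    by (intro cstar_rep.intro cstar_rep_axioms.intro mb.cfield_sections) (use X \<Psi>inj ops nrm in auto)
  have sec: "g \<in> mb.sections \<longleftrightarrow> continuous_map (top_of_set X) ?E (\<lambda>t\<in>X. \<Psi> t (g t))" for g
  proof
    assume g: "g \<in> mb.sections"
    show "continuous_map (top_of_set X) ?E (\<lambda>t\<in>X. \<Psi> t (g t))"
      unfolding continuous_map_def
    proof (intro conjI allI impI)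
      fix R assume R: "openin ?E R"
      show "openin (top_of_set X) {x \<in> topspace (top_of_set X). (\<lambda>t\<in>X. \<Psi> t (g t)) x \<in> R}"
        unfolding openin_euclidean_subtopology_iff
      proof (intro conjI ballI)
        fix t assume "t \<in> {x \<in> topspace (top_of_set X). (\<lambda>t\<in>X. \<Psi> t (g t)) x \<in> R}"
        then have t: "t \<in> X" "\<Psi> t (g t) \<in> R" by auto
        have "\<forall>\<^sub>F u in at t within X. (u, g u) \<in> {(u, x). u \<in> X \<and> \<Psi> u x \<in> R}"
          by (rule mb.sectionsD [OF g t(1) OpI [OF R]]) (use t in simp)
        then obtain d where d: "d > 0" "\<And>u. \<lbrakk>u \<in> X; u \<noteq> t; dist u t < d\<rbrakk> \<Longrightarrow> \<Psi> u (g u) \<in> R" unfolding eventually_at by auto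
        show "\<exists>e>0. \<forall>x'\<in>X. dist x' t < e \<longrightarrow> x' \<in> {x \<in> topspace (top_of_set X). (\<lambda>t\<in>X. \<Psi> t (g t)) x \<in> R}"
        proof (intro exI conjI ballI impI)
          fix u assume "u \<in> X" "dist u t < d"
          then show "u \<in> {x \<in> topspace (top_of_set X). (\<lambda>t\<in>X. \<Psi> t (g t)) x \<in> R}" using d(2) [of u] t by (cases "u = t") auto
        qed (rule d(1))
      qed auto
    qed (use \<Psi>c in auto)
  next
    assume g: "continuous_map (top_of_set X) ?E (\<lambda>t\<in>X. \<Psi> t (g t))"
    show "g \<in> mb.sections"
      unfolding mb.sections_def mb.cont_at_def
    proof (intro CollectI ballI impI)
      fix t U assume t: "t \<in> X" and U: "U \<in> Op" "(t, g t) \<in> U"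
      obtain R where R: "openin ?E R" "U = {(u, x). u \<in> X \<and> \<Psi> u x \<in> R}" using OpE [OF U(1)] by blast
      have "\<forall>\<^sub>F u in at t within X. u \<in> {x \<in> topspace (top_of_set X). (\<lambda>t\<in>X. \<Psi> t (g t)) x \<in> R}"
        by (rule openin_eventually_within [OF openin_continuous_map_preimage [OF g R(1)]]) (use U R t in auto)
      then show "\<forall>\<^sub>F u in at t within X. (u, g u) \<in> U" by (rule eventually_mono) (use R in auto)
    qed
  qed
  have "{s \<in> extensional X. continuous_map (top_of_set X) ?E s \<and> (\<forall>t\<in>X. proj \<xi> (s t) = t)} = (\<lambda>g. \<lambda>t\<in>X. \<Psi> t (g t)) ` mb.sections"
  proof (intro subset_antisym subsetI)
    fix s assume "s \<in> {s \<in> extensional X. continuous_map (top_of_set X) ?E s \<and> (\<forall>t\<in>X. proj \<xi> (s t) = t)}"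
    then have s: "s \<in> extensional X" "continuous_map (top_of_set X) ?E s" "\<And>t. t \<in> X \<Longrightarrow> proj \<xi> (s t) = t" by auto
    have "\<exists>x. s t = \<Psi> t x" if t: "t \<in> X" for t
    proof -
      have "s t \<in> topspace ?E" using s(2) t by (auto simp: continuous_map_def)
      then show ?thesis using \<Psi>surj(1) [of "s t"] s(3) [OF t] by simp
    qed
    then obtain g where g: "\<And>t. t \<in> X \<Longrightarrow> s t = \<Psi> t (g t)" by metis
    have eq: "s = (\<lambda>t\<in>X. \<Psi> t (g t))"
      using s(1) by (intro extensionalityI [of s X]) (simp_all add: g)
    then have "g \<in> mb.sections" using s(2) by (simp add: sec)
    then show "s \<in> (\<lambda>g. \<lambda>t\<in>X. \<Psi> t (g t)) ` mb.sections" using eq by blast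
  qed (use sec \<Psi>c in auto)
  then have "section_algebra (top_of_set X) \<xi> = pointwise_algebra X (fibre \<xi>) ((\<lambda>g. \<lambda>t\<in>X. \<Psi> t (g t)) ` mb.sections)"
    by (simp add: section_algebra_def)
  with rep show ?thesis using that by blast
qed

section \<open>The algebra of matrix-valued functions\<close>

definition opn :: "'n::finite cmat \<Rightarrow> real" where "opn x = onorm ((*v) (rep_cmat x))"

lemma opn_apply: "norm (rep_cmat x *v v) \<le> opn x * norm v"
  unfolding opn_def by (rule onorm) simp

lemma opn_nonneg: "0 \<le> opn x"
  unfolding opn_def by (rule onorm_pos_le) simp

lemma opn_leI: "(\<And>v. norm (rep_cmat x *v v) \<le> b * norm v) \<Longrightarrow> opn x \<le> b"
  unfolding opn_def by (rule onorm_le)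

lemma opn_triangle: "opn (x + y) \<le> opn x + opn y"
proof (rule opn_leI)
  fix v
  have "norm (rep_cmat (x + y) *v v) \<le> norm (rep_cmat x *v v) + norm (rep_cmat y *v v)"
    by (simp add: matrix_vector_mult_add_rdistrib norm_triangle_ineq)
  also have "\<dots> \<le> opn x * norm v + opn y * norm v" by (intro add_mono opn_apply)
  finally show "norm (rep_cmat (x + y) *v v) \<le> (opn x + opn y) * norm v" by (simp add: distrib_right)
qed

lemma opn_mult: "opn (x * y) \<le> opn x * opn y"
proof (rule opn_leI)
  fix v
  have "norm (rep_cmat (x * y) *v v) = norm (rep_cmat x *v (rep_cmat y *v v))"
    by (simp add: matrix_vector_mul_assoc)
  also have "\<dots> \<le> opn x * norm (rep_cmat y *v v)" by (rule opn_apply)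
  also have "\<dots> \<le> opn x * (opn y * norm v)" by (intro mult_left_mono opn_apply opn_nonneg)
  finally show "norm (rep_cmat (x * y) *v v) \<le> opn x * opn y * norm v" by (simp add: mult.assoc)
qed

lemma norm_vec_cmod: "norm (\<chi> i. c * v $ i) = cmod c * norm (v :: complex^'n::finite)"
  by (simp add: norm_vec_def norm_mult L2_set_right_distrib)

lemma opn_scale_le: "opn (cc c * x) \<le> cmod c * opn x"
proof (rule opn_leI)
  fix v
  have "rep_cmat (cc c * x) *v v = (\<chi> i. c * (rep_cmat x *v v) $ i)"
    unfolding rep_cc_mult by (simp add: matrix_vector_mult_def vec_eq_iff sum_distrib_left mult.assoc)
  then have "norm (rep_cmat (cc c * x) *v v) = cmod c * norm (rep_cmat x *v v)" by (simp only: norm_vec_cmod)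
  also have "\<dots> \<le> cmod c * (opn x * norm v)" by (intro mult_left_mono opn_apply) simp
  finally show "norm (rep_cmat (cc c * x) *v v) \<le> cmod c * opn x * norm v" by (simp add: mult.assoc)
qed

lemma opn_0 [simp]: "opn (0 :: 'n::finite cmat) = 0"
proof (rule antisym [OF _ opn_nonneg])
  show "opn (0 :: 'n cmat) \<le> 0" by (rule opn_leI) simp
qed

lemma opn_scale: "opn (cc c * x) = cmod c * opn x"
proof (cases "c = 0")
  case False
  have "opn x = opn (cc (inverse c) * (cc c * x))" using False by (simp add: cc_cc_mult)
  also have "\<dots> \<le> cmod (inverse c) * opn (cc c * x)" by (rule opn_scale_le)
  finally have "opn x \<le> inverse (cmod c) * opn (cc c * x)" by (simp only: norm_inverse)
  then have "cmod c * opn x \<le> opn (cc c * x)" using False by (simp add: field_simps)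
  then show ?thesis using opn_scale_le [of c x] by simp
qed simp

lemma ent_le_opn: "cmod (ent x i j) \<le> opn x"
proof -
  have "(rep_cmat x *v axis j 1) $ i = ent x i j"
    by (simp add: matrix_vector_mult_def axis_def ent_def if_distrib cong: if_cong)
  then have "cmod (ent x i j) \<le> norm (rep_cmat x *v axis j 1)"
    using Finite_Cartesian_Product.norm_nth_le [of "rep_cmat x *v axis j 1" i] by simp
  also have "\<dots> \<le> opn x * norm (axis j (1::complex))" by (rule opn_apply)
  finally show ?thesis by simp
qed

lemma opn_eq_0: "opn x = 0 \<longleftrightarrow> x = 0"
proof
  assume "opn x = 0"
  then have "cmod (ent x i j) \<le> 0" for i j using ent_le_opn [of x i j] by simp
  then show "x = 0" by (intro cmat_ent_eqI) simp
qed simp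

text \<open>Together with \<open>ent_le_opn\<close> this makes operator norm convergence the same as
  convergence of all entries.\<close>

lemma opn_le_sum: "opn x \<le> (\<Sum>i\<in>UNIV. \<Sum>j\<in>UNIV. cmod (ent x i j))"
proof (rule opn_leI)
  fix v
  have "norm (rep_cmat x *v v) \<le> (\<Sum>i\<in>UNIV. cmod ((rep_cmat x *v v) $ i))"
    unfolding norm_vec_def by (rule L2_set_le_sum) simp
  also have "\<dots> \<le> (\<Sum>i\<in>UNIV. \<Sum>j\<in>UNIV. cmod (ent x i j) * norm v)"
  proof (rule sum_mono)
    fix i
    have "cmod ((rep_cmat x *v v) $ i) \<le> (\<Sum>j\<in>UNIV. cmod (ent x i j * v $ j))"
      by (simp add: matrix_vector_mult_def ent_def norm_sum)
    also have "\<dots> \<le> (\<Sum>j\<in>UNIV. cmod (ent x i j) * norm v)"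
      by (rule sum_mono) (simp add: norm_mult mult_left_mono Finite_Cartesian_Product.norm_nth_le)
    finally show "cmod ((rep_cmat x *v v) $ i) \<le> (\<Sum>j\<in>UNIV. cmod (ent x i j) * norm v)" .
  qed
  finally show "norm (rep_cmat x *v v) \<le> (\<Sum>i\<in>UNIV. \<Sum>j\<in>UNIV. cmod (ent x i j)) * norm v"
    by (simp add: sum_distrib_right)
qed

text \<open>The real inner product of complex vectors is the real part of the Hermitian one, so
  adjoints carry over.\<close>

lemma inner_adj: "inner (rep_cmat x *v v) w = inner v (rep_cmat (adj x) *v w)"
proof -
  have c: "inner (a * b) c = inner b (cnj a * c)" for a b c :: complex by (simp add: inner_complex_def algebra_simps)
  have "inner (rep_cmat x *v v) w = (\<Sum>i\<in>UNIV. \<Sum>j\<in>UNIV. inner (ent x i j * v $ j) (w $ i))"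
    by (simp add: inner_vec_def matrix_vector_mult_def inner_sum_left ent_def)
  also have "\<dots> = (\<Sum>j\<in>UNIV. \<Sum>i\<in>UNIV. inner (v $ j) (ent (adj x) j i * w $ i))"
    by (subst sum.swap) (simp add: c)
  also have "\<dots> = inner v (rep_cmat (adj x) *v w)"
    by (simp add: inner_vec_def matrix_vector_mult_def inner_sum_right ent_def)
  finally show ?thesis .
qed

text \<open>The hard half of the C*-identity, from the Cauchy-Schwarz inequality applied to v and
  \<open>adj x * x\<close> acting on v.\<close>

lemma opn_square_le: "(opn x)\<^sup>2 \<le> opn (adj x * x)"
proof -
  have "opn x \<le> sqrt (opn (adj x * x))"
  proof (rule opn_leI)
    fix v
    have "(norm (rep_cmat x *v v))\<^sup>2 = inner v (rep_cmat (adj x * x) *v v)"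
      unfolding power2_norm_eq_inner inner_adj by (simp add: matrix_vector_mul_assoc)
    also have "\<dots> \<le> norm v * norm (rep_cmat (adj x * x) *v v)" by (rule norm_cauchy_schwarz)
    also have "\<dots> \<le> norm v * (opn (adj x * x) * norm v)" by (intro mult_left_mono opn_apply) simp
    also have "\<dots> = (sqrt (opn (adj x * x)) * norm v)\<^sup>2"
      by (simp only: power_mult_distrib real_sqrt_pow2 [OF opn_nonneg] power2_eq_square [of "norm v"] ac_simps)
    finally show "norm (rep_cmat x *v v) \<le> sqrt (opn (adj x * x)) * norm v"
      by (rule power2_le_imp_le) (simp add: opn_nonneg)
  qed
  then have "(opn x)\<^sup>2 \<le> (sqrt (opn (adj x * x)))\<^sup>2" by (rule power_mono) (rule opn_nonneg)
  then show ?thesis by (simp add: opn_nonneg)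
qed

lemma opn_cstar: "opn (adj x * x) = (opn x)\<^sup>2"
proof -
  have le: "opn y \<le> opn (adj y)" for y :: "'a cmat"
  proof (cases "opn y = 0")
    case False
    have "opn y * opn y \<le> opn (adj y) * opn y"
      using opn_square_le [of y] opn_mult [of "adj y" y] by (simp add: power2_eq_square)
    then show ?thesis using False opn_nonneg [of y] by simp
  qed (simp add: opn_nonneg)
  have "opn (adj x) = opn x" using le [of x] le [of "adj x"] by simp
  then show ?thesis using opn_square_le [of x] opn_mult [of "adj x" x] by (simp add: power2_eq_square)
qed

lemma continuous_rep_iff: "continuous_on X (\<lambda>t. rep_cmat (g t)) \<longleftrightarrow> (\<forall>i j. continuous_on X (\<lambda>t. ent (g t) i j))"
proof
  assume *: "\<forall>i j. continuous_on X (\<lambda>t. ent (g t) i j)"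
  have "continuous_on X (\<lambda>t. \<chi> i. \<chi> j. rep_cmat (g t) $ i $ j)"
    by (intro continuous_on_vec_lambda) (use * in \<open>simp add: ent_def\<close>)
  then show "continuous_on X (\<lambda>t. rep_cmat (g t))" by simp
qed (auto simp: ent_def intro!: continuous_intros)

definition cont_mats :: "'v::topological_space set \<Rightarrow> ('v \<Rightarrow> 'n::finite cmat) set" where
  "cont_mats X = {g. \<forall>i j. continuous_on X (\<lambda>t. ent (g t) i j)}"

lemma continuous_opn:
  assumes "g \<in> cont_mats X" shows "continuous_on X (\<lambda>t. opn (g t))"
  unfolding continuous_on_def
proof
  fix t assume t: "t \<in> X"
  have c: "((\<lambda>u. ent (g u) i j) \<longlongrightarrow> ent (g t) i j) (at t within X)" for i j
    using assms t by (simp add: cont_mats_def continuous_on_def)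
  have "((\<lambda>u. \<Sum>i\<in>UNIV. \<Sum>j\<in>UNIV. cmod (ent (g u) i j - ent (g t) i j)) \<longlongrightarrow>
      (\<Sum>i\<in>UNIV. \<Sum>j\<in>UNIV. cmod (ent (g t) i j - ent (g t) i j))) (at t within X)"
    by (intro tendsto_intros c)
  then have lim: "((\<lambda>u. \<Sum>i\<in>UNIV. \<Sum>j\<in>UNIV. cmod (ent (g u) i j - ent (g t) i j)) \<longlongrightarrow> 0) (at t within X)" by simp
  have bound: "\<bar>opn x - opn y\<bar> \<le> (\<Sum>i\<in>UNIV. \<Sum>j\<in>UNIV. cmod (ent x i j - ent y i j))" for x y :: "'b cmat"
  proof -
    have "opn (y - x) = opn (x - y)" using opn_scale [of "-1" "x - y"] by (simp add: cc_minus)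
    then have "\<bar>opn x - opn y\<bar> \<le> opn (x - y)"
      using opn_triangle [of "x - y" y] opn_triangle [of "y - x" x] by simp
    then show ?thesis using opn_le_sum [of "x - y"] by simp
  qed
  have "((\<lambda>u. opn (g u) - opn (g t)) \<longlongrightarrow> 0) (at t within X)"
    by (rule Lim_null_comparison [OF _ lim]) (simp add: bound)
  then show "((\<lambda>u. opn (g u)) \<longlongrightarrow> opn (g t)) (at t within X)" by (simp add: LIM_zero_iff)
qed

text \<open>The constant field with the operator norm; \<open>complete\<close> holds because entries
  are dominated by the norm, so the entries of a locally approximated function are
  continuous.\<close>

lemma matrix_functions_rep:
  fixes X :: "'v::euclidean_space set"
  assumes X: "compact X" "X \<noteq> {}"
  shows "cstar_rep X (\<lambda>t. opn) (cont_mats X :: ('v \<Rightarrow> 'n::finite cmat) set) (\<lambda>t. matrix_algebra) (\<lambda>t. rep_cmat)"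
proof (unfold_locales)
  fix a :: "'v \<Rightarrow> 'n cmat" assume a: "a \<in> cont_mats X"
  show "(\<lambda>t. cc c * a t) \<in> cont_mats X" for c using a by (auto simp: cont_mats_def intro!: continuous_intros)
  show "(\<lambda>t. adj (a t)) \<in> cont_mats X" using a by (auto simp: cont_mats_def intro!: continuous_intros)
  show "continuous_on X (\<lambda>t. opn (a t))" by (rule continuous_opn [OF a])
  fix b :: "'v \<Rightarrow> 'n cmat" assume b: "b \<in> cont_mats X"
  show "(\<lambda>t. a t + b t) \<in> cont_mats X" using a b by (auto simp: cont_mats_def intro!: continuous_intros)
  show "(\<lambda>t. a t * b t) \<in> cont_mats X" using a b by (auto simp: cont_mats_def ent_mult intro!: continuous_intros)
next
  show "\<exists>a\<in>cont_mats X. a t = x" for t :: 'v and x :: "'n cmat"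
    by (intro bexI [of _ "\<lambda>_. x"]) (auto simp: cont_mats_def)
next
  fix s :: "'v \<Rightarrow> 'n cmat"
  assume *: "\<And>t. t \<in> X \<Longrightarrow> \<exists>a\<in>cont_mats X. a t = s t \<and> ((\<lambda>u. opn (s u - a u)) \<longlongrightarrow> 0) (at t within X)"
  have "continuous_on X (\<lambda>t. ent (s t) i j)" for i j
    unfolding continuous_on_def
  proof
    fix t assume t: "t \<in> X"
    obtain a where a: "a \<in> cont_mats X" "a t = s t" "((\<lambda>u. opn (s u - a u)) \<longlongrightarrow> 0) (at t within X)" using * [OF t] by blast
    have "((\<lambda>u. ent (s u - a u) i j) \<longlongrightarrow> 0) (at t within X)"
      by (rule Lim_null_comparison [OF _ a(3)]) (simp add: ent_le_opn del: ent_simps)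
    moreover have "((\<lambda>u. ent (a u) i j) \<longlongrightarrow> ent (a t) i j) (at t within X)"
      using a(1) t by (simp add: cont_mats_def continuous_on_def)
    ultimately show "((\<lambda>u. ent (s u) i j) \<longlongrightarrow> ent (s t) i j) (at t within X)"
      using tendsto_add by (fastforce simp: a(2))
  qed
  then show "s \<in> cont_mats X" by (simp add: cont_mats_def)
next
  show "opn (adj x * x) = (opn x)\<^sup>2" if "t \<in> X" for t and x :: "'n cmat" by (rule opn_cstar)
qed (auto simp: X opn_nonneg opn_eq_0 opn_triangle opn_scale opn_mult matrix_algebra_def rep_cc_mult adj_def
    opn_def [symmetric] cmat_eqI simp del: rep_simps(6), simp_all)

lemma matrix_functions_carrier:
  "(\<lambda>g. \<lambda>t\<in>X. rep_cmat (g t)) ` (cont_mats X :: ('v::topological_space \<Rightarrow> 'n::finite cmat) set) =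
   {f \<in> extensional X. continuous_map (top_of_set X) euclidean f}"
proof (intro subset_antisym subsetI)
  fix f assume "f \<in> (\<lambda>g. \<lambda>t\<in>X. rep_cmat (g t)) ` (cont_mats X :: ('v \<Rightarrow> 'n cmat) set)"
  then obtain g :: "'v \<Rightarrow> 'n cmat" where g: "f = (\<lambda>t\<in>X. rep_cmat (g t))" "g \<in> cont_mats X" by blast
  have "continuous_on X (\<lambda>t. rep_cmat (g t))" using g(2) by (simp add: continuous_rep_iff cont_mats_def)
  then have "continuous_on X f" by (rule continuous_on_eq) (simp add: g(1))
  then show "f \<in> {f \<in> extensional X. continuous_map (top_of_set X) euclidean f}" using g(1) by simp
next
  fix f :: "'v \<Rightarrow> complex^'n^'n" assume f: "f \<in> {f \<in> extensional X. continuous_map (top_of_set X) euclidean f}"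
  have m: "(\<lambda>t. Cmat (f t)) \<in> cont_mats X"
    using f continuous_rep_iff [of X "\<lambda>t. Cmat (f t)"] by (simp add: cont_mats_def)
  have "f = (\<lambda>t\<in>X. rep_cmat (Cmat (f t)))" using f by (auto simp: extensional_def)
  then show "f \<in> (\<lambda>g. \<lambda>t\<in>X. rep_cmat (g t)) ` (cont_mats X :: ('v \<Rightarrow> 'n cmat) set)"
    by (rule image_eqI [OF _ m])
qed

subsection \<open>The diagonal subalgebra\<close>

definition is_diag :: "'n::finite cmat \<Rightarrow> bool" where
  "is_diag x \<longleftrightarrow> (\<forall>i j. i \<noteq> j \<longrightarrow> ent x i j = 0)"

lemma is_diag_iff: "is_diag x \<longleftrightarrow> rep_cmat x \<in> diagonal_matrices"
  by (simp add: is_diag_def diagonal_matrices_def ent_def)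

lemma ent_unit_mult: "ent (unit_mat a b * p) i k = (if i = a then ent p b k else 0)"
  using sum_delta_and(2) [of b "i = a" "\<lambda>j. ent p j k"] by (simp add: ent_mult conj_commute)

text \<open>This exhibits the diagonal subalgebra as a commutant, so that it is a sub-C*-algebra by
  \<open>commutant_sub_algebra\<close>; maximality uses the same criterion.\<close>

lemma is_diag_iff_comm: "is_diag x \<longleftrightarrow> (\<forall>k. x * unit_mat k k = unit_mat k k * x)"
proof
  assume d: "is_diag x"
  show "\<forall>k. x * unit_mat k k = unit_mat k k * x"
    by (intro allI cmat_ent_eqI) (use d in \<open>auto simp: ent_mult_unit ent_unit_mult is_diag_def\<close>)
next
  assume c: "\<forall>k. x * unit_mat k k = unit_mat k k * x"
  have "ent x i j = 0" if "i \<noteq> j" for i j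
  proof -
    have "ent (x * unit_mat j j) i j = ent (unit_mat j j * x) i j" using c by simp
    then show ?thesis using that by (simp add: ent_mult_unit ent_unit_mult)
  qed
  then show "is_diag x" by (simp add: is_diag_def)
qed

lemma ent_diag_mult:
  assumes "is_diag x" shows "ent (x * y) i j = ent x i i * ent y i j"
proof -
  have "ent (x * y) i j = (\<Sum>k\<in>UNIV. if k = i then ent x i i * ent y i j else 0)"
    unfolding ent_mult by (rule sum.cong) (use assms in \<open>auto simp: is_diag_def\<close>)
  then show ?thesis by simp
qed

lemma ent_mult_diag:
  assumes "is_diag y" shows "ent (x * y) i j = ent x i j * ent y j j"
proof -
  have "ent (x * y) i j = (\<Sum>k\<in>UNIV. if k = j then ent x i j * ent y j j else 0)"
    unfolding ent_mult by (rule sum.cong) (use assms in \<open>auto simp: is_diag_def\<close>)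
  then show ?thesis by simp
qed

lemma is_diag_commute:
  assumes "is_diag x" "is_diag y" shows "x * y = y * x"
proof (rule cmat_ent_eqI)
  fix i j
  show "ent (x * y) i j = ent (y * x) i j"
    unfolding ent_diag_mult [OF assms(1)] ent_diag_mult [OF assms(2)]
    using assms by (cases "i = j") (auto simp: is_diag_def)
qed

definition dpart :: "'n::finite cmat \<Rightarrow> 'n cmat" where
  "dpart x = Cmat (\<chi> i j. if i = j then ent x i j else 0)"

lemma ent_dpart [simp]: "ent (dpart x) i j = (if i = j then ent x i j else 0)"
  by (simp add: dpart_def ent_def)

lemma continuous_on_if_const:
  "(P \<Longrightarrow> continuous_on X f) \<Longrightarrow> continuous_on X (\<lambda>t. if P then f t else (0 :: 'b::real_normed_vector))"
  by (cases P) auto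

lemma is_diag_dpart: "is_diag (dpart x)" by (simp add: is_diag_def)

lemma dpart_diag: "is_diag x \<Longrightarrow> dpart x = x"
  by (rule cmat_ent_eqI) (simp add: is_diag_def)

lemma dpart_add: "dpart (x + y) = dpart x + dpart y"
  by (rule cmat_ent_eqI) simp

lemma dpart_scale: "dpart (cc c * x) = cc c * dpart x"
  by (rule cmat_ent_eqI) simp

lemma dpart_mult_diag:
  assumes "is_diag b" shows "dpart (b * x) = b * dpart x" "dpart (x * b) = dpart x * b"
  by (rule cmat_ent_eqI; simp add: ent_diag_mult [OF assms] ent_mult_diag [OF assms])+

text \<open>A diagonal matrix acts coordinatewise, and each diagonal entry of x is bounded by the
  norm of x.\<close>

lemma opn_dpart: "opn (dpart x) \<le> opn x"
proof (rule opn_leI)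
  fix v
  have e: "(rep_cmat (dpart x) *v v) $ i = ent x i i * v $ i" for i
  proof -
    have "(rep_cmat (dpart x) *v v) $ i = (\<Sum>j\<in>UNIV. if j = i then ent x i i * v $ i else 0)"
      unfolding matrix_vector_mult_def vec_lambda_beta
      by (rule sum.cong) (auto simp: dpart_def)
    then show ?thesis by simp
  qed
  have "norm (rep_cmat (dpart x) *v v) = L2_set (\<lambda>i. cmod (ent x i i) * cmod (v $ i)) UNIV"
    by (simp add: norm_vec_def e norm_mult)
  also have "\<dots> \<le> L2_set (\<lambda>i. opn x * cmod (v $ i)) UNIV"
    by (rule L2_set_mono) (simp_all add: mult_right_mono ent_le_opn)
  also have "\<dots> = opn x * norm v" by (simp add: norm_vec_def L2_set_right_distrib opn_nonneg)
  finally show "norm (rep_cmat (dpart x) *v v) \<le> opn x * norm v" .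
qed

lemma dpart_faithful: "dpart (adj x * x) = 0 \<Longrightarrow> x = 0"
proof -
  assume "dpart (adj x * x) = 0"
  then have "ent (dpart (adj x * x)) i i = 0" for i by simp
  then have "trc (adj x * x) = 0" by (simp add: trc_def)
  then show "x = 0" by (simp add: trc_adj_mult_eq_0)
qed

text \<open>The positive square root of the diagonal part of \<open>adj x * x\<close>: its entries
  are the Euclidean lengths of the columns of x. It depends continuously on x, so it can witness
  positivity of the expectation within the function algebra.\<close>

definition dsqrt :: "'n::finite cmat \<Rightarrow> 'n cmat" where
  "dsqrt x = Cmat (\<chi> i j. if i = j then of_real (sqrt (\<Sum>k\<in>UNIV. (cmod (ent x k i))\<^sup>2)) else 0)"

lemma ent_dsqrt: "ent (dsqrt x) i j = (if i = j then of_real (sqrt (\<Sum>k\<in>UNIV. (cmod (ent x k i))\<^sup>2)) else 0)"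
  by (simp add: dsqrt_def ent_def)

lemma dpart_adj_mult: "dpart (adj x * x) = adj (dsqrt x) * dsqrt x"
proof (rule cmat_ent_eqI)
  fix i j
  have d: "is_diag (dsqrt x)" by (simp add: is_diag_def ent_dsqrt)
  have "(of_real (sqrt (\<Sum>k\<in>UNIV. (cmod (ent x k i))\<^sup>2)) * of_real (sqrt (\<Sum>k\<in>UNIV. (cmod (ent x k i))\<^sup>2)) :: complex)
      = of_real (\<Sum>k\<in>UNIV. (cmod (ent x k i))\<^sup>2)"
    by (simp add: sum_nonneg flip: of_real_mult)
  also have "\<dots> = ent (adj x * x) i i"
    by (simp only: ent_mult ent_simps of_real_sum complex_norm_square mult.commute)
  finally have sq: "of_real (sqrt (\<Sum>k\<in>UNIV. (cmod (ent x k i))\<^sup>2)) * of_real (sqrt (\<Sum>k\<in>UNIV. (cmod (ent x k i))\<^sup>2))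
      = ent (adj x * x) i i" .
  show "ent (dpart (adj x * x)) i j = ent (adj (dsqrt x) * dsqrt x) i j"
  proof (cases "i = j")
    case True
    then show ?thesis unfolding ent_mult_diag [OF d] using sq by (simp add: ent_dsqrt)
  next
    case False
    then show ?thesis unfolding ent_mult_diag [OF d] by (simp add: ent_dsqrt)
  qed
qed

text \<open>Conjugating a diagonal matrix by a matrix unit moves one diagonal entry to another place
  and deletes the rest.\<close>

lemma entry_normalizer:
  assumes "is_diag b"
  shows "is_diag (cc c * unit_mat i j * b * adj (cc c * unit_mat i j))"
    "is_diag (adj (cc c * unit_mat i j) * b * (cc c * unit_mat i j))"
proof -
  have au: "adj (unit_mat i j) = unit_mat j i" by (rule cmat_ent_eqI) auto
  have n: "is_diag (unit_mat i j * b * unit_mat j i)" for i j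
    by (auto simp: is_diag_def ent_mult_unit ent_unit_mult)
  have s: "is_diag (cc z * x)" if "is_diag x" for z and x :: "'a cmat" using that by (simp add: is_diag_def)
  have "cc c * unit_mat i j * b * adj (cc c * unit_mat i j) = cc (c * cnj c) * (unit_mat i j * b * unit_mat j i)"
    by (rule cmat_ent_eqI) (simp add: adj_mult au mult.assoc [symmetric], simp add: mult.assoc)
  then show "is_diag (cc c * unit_mat i j * b * adj (cc c * unit_mat i j))" using s n by simp
  have "adj (cc c * unit_mat i j) * b * (cc c * unit_mat i j) = cc (c * cnj c) * (unit_mat j i * b * unit_mat i j)"
  proof -
    have "adj (cc c * unit_mat i j) = cc (cnj c) * unit_mat j i" by (simp add: adj_mult au cc_comm)
    then have "adj (cc c * unit_mat i j) * b * (cc c * unit_mat i j) = cc (cnj c) * (unit_mat j i * b * (cc c * unit_mat i j))"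
      by (simp only: mult.assoc)
    also have "\<dots> = cc (c * cnj c) * (unit_mat j i * b * unit_mat i j)"
      by (simp only: cc_left_comm [of "unit_mat j i * b"] cc_cc_mult mult.commute [of c])
    finally show ?thesis .
  qed
  then show "is_diag (adj (cc c * unit_mat i j) * b * (cc c * unit_mat i j))" using s n by simp
qed

lemma diagonal_cartan:
  fixes X :: "'v::euclidean_space set"
  assumes X: "compact X" "X \<noteq> {}"
  shows "cartan_subalgebra (matrix_functions (top_of_set X) :: ('v \<Rightarrow> complex^'n::finite^'n) cstar) (diagonal_functions (top_of_set X))"
proof -
  interpret cm: cstar_rep X "\<lambda>t. opn" "cont_mats X :: ('v \<Rightarrow> 'n cmat) set" "\<lambda>t. matrix_algebra" "\<lambda>t. rep_cmat"
    by (rule matrix_functions_rep [OF X])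
  have alg: "matrix_functions (top_of_set X) = cm.alg"
    using matrix_functions_carrier [of X, where 'n = 'n] by (simp add: matrix_functions_def cm.alg_def cm.Q_def [abs_def])
  define D where "D = {g \<in> cont_mats X :: ('v \<Rightarrow> 'n cmat) set. \<forall>t\<in>X. is_diag (g t)}"
  have diag: "diagonal_functions (top_of_set X) = cm.Q ` D"
  proof -
    have "(cm.Q g t \<in> diagonal_matrices) = is_diag (g t)" if "t \<in> X" for g t
      using that by (simp add: cm.Q_def is_diag_iff)
    then show ?thesis unfolding diagonal_functions_def alg cm.alg_ops(1) D_def by auto
  qed
  \<comment> \<open>The constant diagonal matrix units; they lie in \<open>D\<close>, and
    \<open>D\<close> is their commutant.\<close>
  define U :: "('v \<Rightarrow> 'n cmat) set" where "U = {(\<lambda>_. unit_mat k k) |k. True}"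
  have DU: "D = cm.commutant U"
    unfolding D_def cm.commutant_def U_def is_diag_iff_comm by auto
  have Usub: "(\<lambda>_. unit_mat k k) \<in> D" for k
    by (auto simp: D_def cont_mats_def is_diag_def)
  have Uadj: "\<exists>s'\<in>U. \<forall>t\<in>X. s' t = adj (s t)" if s: "s \<in> U" for s
  proof -
    have "adj (unit_mat k k) = unit_mat k k" for k :: 'n by (rule cmat_ent_eqI) auto
    then show ?thesis using s by (intro bexI [of _ s]) (auto simp: U_def)
  qed
  have sub: "sub_cstar_algebra cm.alg (cm.Q ` D)" unfolding DU by (rule cm.commutant_sub_algebra [OF Uadj])
  have ab: "abelian_sub_cstar_algebra cm.alg (cm.Q ` D)"
    unfolding abelian_sub_cstar_algebra_def
  proof (intro conjI ballI sub)
    fix x y assume "x \<in> cm.Q ` D" "y \<in> cm.Q ` D"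
    then obtain g h where "x = cm.Q g" "y = cm.Q h" "g \<in> D" "h \<in> D" by blast
    then show "cs_mult cm.alg x y = cs_mult cm.alg y x"
      by (auto simp: cm.alg_ops cm.Q_eq D_def is_diag_commute)
  qed
  have max: "maximal_abelian cm.alg (cm.Q ` D)"
    unfolding maximal_abelian_def
  proof (intro conjI ab allI impI)
    fix C assume C: "abelian_sub_cstar_algebra cm.alg C \<and> cm.Q ` D \<subseteq> C"
    have "x \<in> cm.Q ` D" if x: "x \<in> C" for x
    proof -
      have "C \<subseteq> cs_carrier cm.alg" using C by (simp add: abelian_sub_cstar_algebra_def sub_cstar_algebra_def)
      then obtain g where g: "x = cm.Q g" "g \<in> cont_mats X" using x by (auto simp: cm.alg_ops)
      have "is_diag (g t)" if t: "t \<in> X" for t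
        unfolding is_diag_iff_comm
      proof
        fix k
        have "cm.Q (\<lambda>_. unit_mat k k) \<in> C" using C Usub by blast
        then have "cs_mult cm.alg x (cm.Q (\<lambda>_. unit_mat k k)) = cs_mult cm.alg (cm.Q (\<lambda>_. unit_mat k k)) x"
          using C x by (simp add: abelian_sub_cstar_algebra_def)
        then show "g t * unit_mat k k = unit_mat k k * g t" using t by (simp add: g cm.alg_ops cm.Q_eq)
      qed
      then show ?thesis using g by (auto simp: D_def)
    qed
    then show "C = cm.Q ` D" using C by blast
  qed
  have one: "(\<lambda>_. 1) \<in> D" by (auto simp: D_def cont_mats_def is_diag_def)
  have oneG: "(\<lambda>_. 1) \<in> (cont_mats X :: ('v \<Rightarrow> 'n cmat) set)" using one by (simp add: D_def)
  have nrm0: "cs_norm cm.alg (cm.Q (\<lambda>t. 0)) = 0"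
    unfolding cm.alg_norm using X(2) by simp
  \<comment> \<open>The algebra is unital, so the net with the constant function 1 as its only
    member is an approximate unit.\<close>
  have unit: "contains_approximate_unit cm.alg (cm.Q ` D)"
    unfolding contains_approximate_unit_def
  proof (intro exI conjI)
    let ?u = "cm.Q (\<lambda>_. 1)"
    show "approximate_unit cm.alg {?u} (\<lambda>_ _. True) (\<lambda>x. x)"
      unfolding approximate_unit_def
    proof (intro conjI ballI impI allI; (elim singletonE)?; (hypsubst_thin)?)
      show "?u \<in> cs_carrier cm.alg" using oneG by (simp add: cm.alg_ops)
      show "cs_positive cm.alg ?u"
        unfolding cs_positive_def
        by (rule bexI [of _ ?u]) (use oneG in \<open>simp_all add: cm.alg_ops\<close>)
      show "cs_norm cm.alg ?u \<le> 1"
        by (rule cm.norm_leI) (simp add: cm.nu_one)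
      show "cs_positive cm.alg (cs_diff cm.alg ?u ?u)"
        unfolding cs_positive_def
        by (rule bexI [of _ "cm.Q (\<lambda>_. 0)"]) (use cm.G_zero [OF X(2)] in \<open>simp_all add: cm.alg_ops\<close>)
      fix a and \<epsilon> :: real assume "a \<in> cs_carrier cm.alg" and \<epsilon>: "\<epsilon> > 0"
      then obtain g where g: "a = cm.Q g" by (auto simp: cm.alg_ops)
      show "\<exists>i\<in>{?u}. \<forall>j\<in>{?u}. True \<longrightarrow> cs_norm cm.alg (cs_diff cm.alg (cs_mult cm.alg j a) a) < \<epsilon> \<and>
          cs_norm cm.alg (cs_diff cm.alg (cs_mult cm.alg a j) a) < \<epsilon>"
        using \<epsilon> by (simp add: g cm.alg_ops nrm0)
    qed auto
    show "(\<lambda>x. x) ` {?u} \<subseteq> cm.Q ` D" using one by simp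
  qed
  have norml: "cm.Q (\<lambda>t. cc (f t) * unit_mat i j) \<in> normalizers cm.alg (cm.Q ` D)"
    and entG: "(\<lambda>t. cc (f t) * unit_mat i j) \<in> (cont_mats X :: ('v \<Rightarrow> 'n cmat) set)"
    if f: "continuous_on X f" for f and i j :: 'n
  proof -
    show G: "(\<lambda>t. cc (f t) * unit_mat i j) \<in> (cont_mats X :: ('v \<Rightarrow> 'n cmat) set)"
      using f by (auto simp: cont_mats_def intro!: continuous_intros)
    show "cm.Q (\<lambda>t. cc (f t) * unit_mat i j) \<in> normalizers cm.alg (cm.Q ` D)"
      unfolding normalizers_def
    proof (intro CollectI conjI ballI)
      show "cm.Q (\<lambda>t. cc (f t) * unit_mat i j) \<in> cs_carrier cm.alg" using G by (simp add: cm.alg_ops)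
      fix b assume "b \<in> cm.Q ` D"
      then obtain g where g: "b = cm.Q g" "g \<in> cont_mats X" "\<And>t. t \<in> X \<Longrightarrow> is_diag (g t)" by (auto simp: D_def)
      show "cs_mult cm.alg (cs_mult cm.alg (cm.Q (\<lambda>t. cc (f t) * unit_mat i j)) b) (cs_star cm.alg (cm.Q (\<lambda>t. cc (f t) * unit_mat i j))) \<in> cm.Q ` D"
        unfolding g(1) cm.alg_ops
        by (rule imageI, unfold D_def, intro CollectI conjI ballI entry_normalizer g(3) cm.G_mult [OF cm.G_mult [OF G g(2)] cm.G_adj [OF G]])
      show "cs_mult cm.alg (cs_mult cm.alg (cs_star cm.alg (cm.Q (\<lambda>t. cc (f t) * unit_mat i j))) b) (cm.Q (\<lambda>t. cc (f t) * unit_mat i j)) \<in> cm.Q ` D"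
        unfolding g(1) cm.alg_ops
        by (rule imageI, unfold D_def, intro CollectI conjI ballI entry_normalizer g(3) cm.G_mult [OF cm.G_mult [OF cm.G_adj [OF G] g(2)] G])
    qed
  qed
  have gen: "generates cm.alg (normalizers cm.alg (cm.Q ` D))"
    unfolding generates_def
  proof (intro subset_antisym subsetI InterI)
    have "cm.commutant {} = (cont_mats X :: ('v \<Rightarrow> 'n cmat) set)" by (simp add: cm.commutant_def)
    then have "sub_cstar_algebra cm.alg (cs_carrier cm.alg)"
      using cm.commutant_sub_algebra [of "{}"] by (simp add: cm.alg_ops)
    moreover have "normalizers cm.alg (cm.Q ` D) \<subseteq> cs_carrier cm.alg" by (auto simp: normalizers_def)
    ultimately show "x \<in> cs_carrier cm.alg"
      if "x \<in> \<Inter> {C. sub_cstar_algebra cm.alg C \<and> normalizers cm.alg (cm.Q ` D) \<subseteq> C}" for x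
      using that by blast
  next
    fix x C assume "x \<in> cs_carrier cm.alg" and "C \<in> {C. sub_cstar_algebra cm.alg C \<and> normalizers cm.alg (cm.Q ` D) \<subseteq> C}"
    then obtain g where g: "x = cm.Q g" "g \<in> cont_mats X" and C: "sub_cstar_algebra cm.alg C" "normalizers cm.alg (cm.Q ` D) \<subseteq> C"
      by (auto simp: cm.alg_ops)
    have e: "(\<lambda>t. cc (ent (g t) i j) * unit_mat i j) \<in> cm.pull C" for i j
    proof -
      have "continuous_on X (\<lambda>t. ent (g t) i j)" using g by (simp add: cont_mats_def)
      from norml [OF this, of i j] entG [OF this, of i j] show ?thesis using C(2) by (auto simp: cm.pull_def)
    qed
    have zero: "(\<lambda>t. 0) \<in> cm.pull C"
      using C(1) cm.G_zero [OF X(2)] by (simp add: cm.pull_def sub_cstar_algebra_def cm.alg_ops)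
    have sums: "(\<lambda>t. \<Sum>i\<in>I. h i t) \<in> cm.pull C" if "finite I" "\<And>i. i \<in> I \<Longrightarrow> h i \<in> cm.pull C"
      for I :: "'n set" and h
      using that by (induction I rule: finite_induct) (simp_all add: zero cm.pull_closed(1) [OF C(1)])
    \<comment> \<open>Every matrix-valued function is a finite sum of normalizers, one for each
      entry.\<close>
    have "(\<lambda>t. \<Sum>i\<in>UNIV. \<Sum>j\<in>UNIV. cc (ent (g t) i j) * unit_mat i j) \<in> cm.pull C"
      by (intro sums finite e)
    then have "g \<in> cm.pull C" by (simp flip: unit_mat_expand)
    then show "x \<in> C" by (simp add: g cm.pull_def)
  qed
  define E where "E = (\<lambda>x. cm.Q (\<lambda>t. dpart (Cmat (x t))))"
  have EQ: "E (cm.Q g) = cm.Q (\<lambda>t. dpart (g t))" for g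
    unfolding E_def cm.Q_eq by (simp add: cm.Q_def)
  have dG: "(\<lambda>t. dpart (g t)) \<in> D" if "g \<in> cont_mats X" for g :: "'v \<Rightarrow> 'n cmat"
    using that by (auto simp: D_def cont_mats_def is_diag_dpart intro!: continuous_on_if_const)
  have dGG: "(\<lambda>t. dpart (g t)) \<in> cont_mats X" if "g \<in> cont_mats X" for g :: "'v \<Rightarrow> 'n cmat"
    using dG [OF that] by (simp add: D_def)
  have ce: "conditional_expectation cm.alg (cm.Q ` D) E"
    unfolding conditional_expectation_def
  proof (intro conjI ballI allI impI)
    show "E ` cs_carrier cm.alg \<subseteq> cm.Q ` D" using dG by (auto simp: cm.alg_ops EQ)
    show "E b = b" if "b \<in> cm.Q ` D" for b
      using that by (auto simp: EQ cm.Q_eq D_def dpart_diag)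
    fix x assume "x \<in> cs_carrier cm.alg"
    then obtain g where g: "x = cm.Q g" "g \<in> cont_mats X" by (auto simp: cm.alg_ops)
    show "E (cs_scale cm.alg c x) = cs_scale cm.alg c (E x)" for c
      by (simp add: g cm.alg_ops EQ dpart_scale)
    show "cs_norm cm.alg (E x) \<le> cs_norm cm.alg x"
      unfolding g EQ
    proof (rule cm.norm_leI)
      fix t assume t: "t \<in> X"
      show "opn (dpart (g t)) \<le> cs_norm cm.alg (cm.Q g)"
        by (rule order_trans [OF opn_dpart cm.nu_le_norm [OF g(2) t]])
    qed
    show "cs_positive cm.alg (E x)" if pos: "cs_positive cm.alg x"
    proof -
      obtain h where h: "x = cs_mult cm.alg (cs_star cm.alg (cm.Q h)) (cm.Q h)" "h \<in> cont_mats X"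
        using pos by (auto simp: cs_positive_def cm.alg_ops(1))
      have "(\<lambda>t. dsqrt (h t)) \<in> cont_mats X"
        using h(2) by (auto simp: cont_mats_def ent_dsqrt intro!: continuous_on_if_const continuous_intros)
      moreover have "E x = cs_mult cm.alg (cs_star cm.alg (cm.Q (\<lambda>t. dsqrt (h t)))) (cm.Q (\<lambda>t. dsqrt (h t)))"
        by (simp add: h(1) cm.alg_ops EQ dpart_adj_mult)
      ultimately show ?thesis unfolding cs_positive_def by (auto simp: cm.alg_ops(1))
    qed
    show "E (cs_add cm.alg x y) = cs_add cm.alg (E x) (E y)" if "y \<in> cs_carrier cm.alg" for y
      using that by (auto simp: g cm.alg_ops EQ dpart_add)
    fix b assume "b \<in> cm.Q ` D"
    then obtain h where h: "b = cm.Q h" "\<And>t. t \<in> X \<Longrightarrow> is_diag (h t)" by (auto simp: D_def)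
    show "E (cs_mult cm.alg b x) = cs_mult cm.alg b (E x)" "E (cs_mult cm.alg x b) = cs_mult cm.alg (E x) b"
      by (auto simp: g h(1) cm.alg_ops EQ cm.Q_eq dpart_mult_diag [OF h(2)])
  qed
  have faith: "faithful_on cm.alg E"
    unfolding faithful_on_def
  proof (intro ballI impI)
    fix x assume "x \<in> cs_carrier cm.alg" and z: "E (cs_mult cm.alg (cs_star cm.alg x) x) = cs_zero cm.alg"
    then obtain g where g: "x = cm.Q g" by (auto simp: cm.alg_ops)
    have "cm.Q (\<lambda>t. dpart (adj (g t) * g t)) = cm.Q (\<lambda>t. 0)" using z by (simp only: g cm.alg_ops EQ)
    then have "\<forall>t\<in>X. dpart (adj (g t) * g t) = 0" by (simp only: cm.Q_eq)
    then have "g t = 0" if "t \<in> X" for t using dpart_faithful that by blast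
    then show "x = cs_zero cm.alg" by (simp add: g cm.alg_ops cm.Q_eq)
  qed
  show ?thesis
    unfolding alg diag cartan_subalgebra_def using ab unit max gen ce faith by blast
qed

theorem mainTheorem8:
  fixes k n :: nat and \<xi> :: "('v::euclidean_space, 'e) cbundle"
  assumes "k > 2" and "n \<ge> 1"
    and "DIM('v) = k + 1" and "CARD('n::finite) = n"
  defines "S \<equiv> top_of_set (sphere (0::'v) 1)"
  defines "CM \<equiv> (matrix_functions S :: ('v \<Rightarrow> complex^'n^'n) cstar)"
  shows "(cstar_bundle_with_fibre S \<xi> (matrix_algebra :: (complex^'n^'n) cstar) \<longrightarrow>
            (\<exists>B. cartan_subalgebra (section_algebra S \<xi>) B) \<longrightarrow>
            star_isomorphic (section_algebra S \<xi>) CM) \<and>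
         cartan_subalgebra CM (diagonal_functions S) \<and>
         (\<forall>B. cartan_subalgebra CM B \<longrightarrow> cartan_equivalent CM B (diagonal_functions S))"
proof -
  define X where "X = sphere (0::'v) 1"
  have X: "compact X" "X \<noteq> {}" by (auto simp: X_def)
  \<comment> \<open>Here k > 2 enters: the ambient dimension k + 1 is at least 4, as the equator
    argument requires.\<close>
  have dim: "DIM('v) \<ge> 4" using assms(1,3) by simp
  have S: "S = top_of_set X" by (simp add: S_def X_def)
  show ?thesis
  proof (intro conjI impI allI)
    assume \<xi>: "cstar_bundle_with_fibre S \<xi> (matrix_algebra :: (complex^'n^'n) cstar)"
      and "\<exists>B. cartan_subalgebra (section_algebra S \<xi>) B"
    then obtain B where B: "cartan_subalgebra (section_algebra S \<xi>) B" by blast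
    obtain nu and G :: "('v \<Rightarrow> 'n cmat) set" and \<Psi> where rep: "cstar_rep X nu G (fibre \<xi>) \<Psi>"
      and sec: "section_algebra (top_of_set X) \<xi> = pointwise_algebra X (fibre \<xi>) ((\<lambda>g. \<lambda>t\<in>X. \<Psi> t (g t)) ` G)"
      using bundle_cstar_rep [OF X \<xi> [unfolded S]] by blast
    interpret r: cstar_rep X nu G "fibre \<xi>" \<Psi> by (rule rep)
    have alg: "section_algebra S \<xi> = r.alg" by (simp add: S sec r.alg_def r.Q_def [abs_def])
    obtain \<phi> :: "('v \<Rightarrow> 'e) \<Rightarrow> 'v \<Rightarrow> complex^'n^'n" where
      "star_iso r.alg (matrix_functions (top_of_set X)) \<phi>" "\<phi> ` B = diagonal_functions (top_of_set X)"
      by (rule r.cartan_trivialization [OF B [unfolded alg] X_def dim])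
    then show "star_isomorphic (section_algebra S \<xi>) CM"
      unfolding star_isomorphic_def alg CM_def by (auto simp: S)
  next
    show "cartan_subalgebra CM (diagonal_functions S)" unfolding CM_def S by (rule diagonal_cartan [OF X])
  next
    fix B assume B: "cartan_subalgebra CM B"
    interpret cm: cstar_rep X "\<lambda>t. opn" "cont_mats X :: ('v \<Rightarrow> 'n cmat) set" "\<lambda>t. matrix_algebra" "\<lambda>t. rep_cmat"
      by (rule matrix_functions_rep [OF X])
    have alg: "CM = cm.alg"
      using matrix_functions_carrier [of X, where 'n = 'n] by (simp add: CM_def S matrix_functions_def cm.alg_def cm.Q_def [abs_def])
    \<comment> \<open>Source and target are now the same algebra, so the trivialization is an
      automorphism that carries B onto the diagonal functions.\<close>
    obtain \<phi> :: "('v \<Rightarrow> complex^'n^'n) \<Rightarrow> 'v \<Rightarrow> complex^'n^'n" where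
      "star_iso cm.alg (matrix_functions (top_of_set X)) \<phi>" "\<phi> ` B = diagonal_functions (top_of_set X)"
      by (rule cm.cartan_trivialization [OF B [unfolded alg] X_def dim])
    then show "cartan_equivalent CM B (diagonal_functions S)"
      unfolding cartan_equivalent_def using alg by (auto simp: CM_def S)
  qed
qed

end
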